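(* Let $\rho_U$ be the regular character of $U$. Then $$\rho_U=\sum_{D,\phi}\frac{\xi_{D,\phi}(1)}{\langle\xi_{D,\phi},\xi_{D,\phi}\rangle}\,\xi_{D,\phi},$$ where the sum is over all basic pairs $(D,\phi)$ for $U$.
   Context: Let $p$ be an odd prime, $q=p^{e}$ ($e\ge 1$), $\mathbb{F}_q$ the field with $q$ elements, $\mathbb{F}_q^{\times}=\mathbb{F}_q\setminus\{0\}$, and $n\ge 1$. Let $G$ be one of $Sp_{2n}(q)$, $O_{2n}(q)$, $O_{2n+1}(q)$; put $m=2n$ in the first two cases and $m=2n+1$ in the third. $U_m(q)$ is the group of unipotent upper-triangular $m\times m$ matrices over $\mathbb{F}_q$, and $U=G\cap U_m(q)$. Explicitly, with $J$ the $n\times n$ matrix with $1$'s on the anti-diagonal and $0$'s elsewhere, $U$ consists of all block matrices $\begin{pmatrix} x & xv & xw\\ 0 & I_r & -v^{T}J\\ 0&0&Jx^{-T}J\end{pmatrix}$ with $x\in U_n(q)$, $v$ an $n\times r$ matrix, $w$ an $n\times n$ matrix over $\mathbb{F}_q$, where: $r=0$ and $Jw^T-wJ=0$ if $G=Sp_{2n}(q)$; $r=0$ and $Jw^T+wJ=0$ if $G=O_{2n}(q)$; $r=1$ and $Jw^T+wJ=-vv^T$ if $G=O_{2n+1}(q)$. Characters are complex characters, and $\langle\cdot,\cdot\rangle$ is the Frobenius scalar product of class functions on $U$. Indexing. Rows and columns of $m\times m$ matrices are indexed by $1\prec 2\prec\cdots\prec n\prec 0\prec -n\prec\cdots\prec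 -2\prec -1$ (index $0$ present only if $G=O_{2n+1}(q)$). Roots. $\varepsilon_1,\dots,\varepsilon_n$ are formal independent symbols; $\Phi=\{\varepsilon_i\pm\varepsilon_j:1\le i<j\le n\}\cup\Phi'$ with $\Phi'=\{2\varepsilon_i:1\le i\le n\}$ if $G=Sp_{2n}(q)$, $\Phi'=\emptyset$ if $G=O_{2n}(q)$, $\Phi'=\{\varepsilon_i:1\le i\le n\}$ if $G=O_{2n+1}(q)$. For $\alpha\in\Phi$ let $\mathcal{E}(\alpha)$ be: $\{(i,j),(-j,-i)\}$ if $\alpha=\varepsilon_i-\varepsilon_j$; $\{(i,-j),(j,-i)\}$ if $\alpha=\varepsilon_i+\varepsilon_j$ ($i<j$); $\{(i,-i)\}$ if $\alpha=2\varepsilon_i$; $\{(i,0),(0,-i)\}$ if $\alpha=\varepsilon_i$. For $\Psi\subseteq\Phi$, $\mathcal{E}(\Psi)=\bigcup_{\alpha\in\Psi}\mathcal{E}(\alpha)$. Each $\mathcal{E}(\alpha)$ contains exactly one entry $(i,j)$ with $1\le i\le n$ and $i\prec j\preceq -i$; it is called the positive entry of $\alpha$. Basic pairs. $D\subseteq\Phi$ is basic if $\mathcal{E}(D)$ contains at most one entry from each row and at most one from each column. A basic pair for $U$ is $(D,\phi)$ with $D\subseteq\Phi$ basic (possibly empty) and $\phi:D\to\mathbb{F}_q^\times$ a map. Supercharacters. Fix a nontrivial linear character $\vartheta:\mathbb{F}_q\to\mathbb{C}^\times$ of the additive group of $\mathbb{F}_q$. Define subgroups $U_\alpha\le U$: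 if $\alpha=\varepsilon_i-\varepsilon_j$, $U_\alpha=\{x\in U:x_{i,k}=0,\ i<k<j\}$; if $\alpha=\varepsilon_i+\varepsilon_j$ ($i<j$), $U_\alpha=\{x\in U:x_{i,k}=x_{j,l}=0,\ i<k\le n,\ j\prec l\preceq 0\}$ (when the index $0$ is absent, $l$ runs over $j<l\le n$); if $\alpha=2\varepsilon_i$ or $\alpha=\varepsilon_i$, $U_\alpha=\{x\in U:x_{i,k}=0,\ i<k\le n\}$. For $r\in\mathbb{F}_q^\times$, $\lambda_{\alpha,r}(x)=\vartheta(r x_{i,j})$, with $(i,j)$ the positive entry of $\alpha$, is a linear character of $U_\alpha$; the elementary character is the induced character $\xi_{\alpha,r}=(\lambda_{\alpha,r})^U$. The supercharacter of a basic pair is $\xi_{D,\phi}=\prod_{\alpha\in D}\xi_{\alpha,\phi(\alpha)}$ (the trivial character $1_U$ if $D=\emptyset$). *)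

theory Defs
  imports
    "HOL-Library.FuncSet"
    "HOL-Library.Cardinality"
    "HOL-Computational_Algebra.Primes"
    "HOL-Algebra.Group"
    "Jordan_Normal_Form.Matrix"
begin

section \<open>Class functions on a finite group\<close>

text \<open>The \<open>(h,k)\<close> entry of the matrix by which \<open>g\<close> acts on the group algebra by left
  multiplication, in the basis \<open>carrier G\<close>.\<close>

definition regular_rep :: "('g, 'z) monoid_scheme \<Rightarrow> 'g \<Rightarrow> 'g \<Rightarrow> 'g \<Rightarrow> complex" where
  "regular_rep G g h k = (if h = g \<otimes>\<^bsub>G\<^esub> k then 1 else 0)"

definition regular_char :: "('g, 'z) monoid_scheme \<Rightarrow> 'g \<Rightarrow> complex" where
  "regular_char G g = (\<Sum>h\<in>carrier G. regular_rep G g h h)"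

definition cf_scalar_prod ::
  "('g, 'z) monoid_scheme \<Rightarrow> ('g \<Rightarrow> complex) \<Rightarrow> ('g \<Rightarrow> complex) \<Rightarrow> complex" where
  "cf_scalar_prod G \<chi> \<psi> =
     (\<Sum>g\<in>carrier G. \<chi> g * cnj (\<psi> g)) / of_nat (card (carrier G))"

definition induced_char ::
  "('g, 'z) monoid_scheme \<Rightarrow> 'g set \<Rightarrow> ('g \<Rightarrow> complex) \<Rightarrow> 'g \<Rightarrow> complex" where
  "induced_char G H \<chi> g =
     (\<Sum>x | x \<in> carrier G \<and> inv\<^bsub>G\<^esub> x \<otimes>\<^bsub>G\<^esub> g \<otimes>\<^bsub>G\<^esub> x \<in> H.
        \<chi> (inv\<^bsub>G\<^esub> x \<otimes>\<^bsub>G\<^esub> g \<otimes>\<^bsub>G\<^esub> x)) / of_nat (card H)"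


section \<open>The unipotent groups\<close>

text \<open>\<open>Sp\<close>, \<open>O_even\<close> and \<open>O_odd\<close> stand for \<open>Sp\<^sub>2\<^sub>n(q)\<close>, \<open>O\<^sub>2\<^sub>n(q)\<close> and \<open>O\<^sub>2\<^sub>n\<^sub>+\<^sub>1(q)\<close>;
  \<open>mid\<close> is the size \<open>r\<close> of the middle block.\<close>

datatype classical = Sp | O_even | O_odd

fun mid :: "classical \<Rightarrow> nat" where
  "mid Sp = 0"
| "mid O_even = 0"
| "mid O_odd = 1"

abbreviation mat_size :: "classical \<Rightarrow> nat \<Rightarrow> nat" where
  "mat_size T n \<equiv> 2 * n + mid T"

definition antidiag :: "nat \<Rightarrow> 'a :: {zero, one} mat" where
  "antidiag n = mat n n (\<lambda>(i, j). if i + j + 1 = n then 1 else 0)"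

definition unitriangular :: "nat \<Rightarrow> 'a :: {zero, one} mat set" where
  "unitriangular n =
     {A \<in> carrier_mat n n. upper_triangular A \<and> (\<forall>i<n. A $$ (i, i) = 1)}"

fun w_condition :: "classical \<Rightarrow> nat \<Rightarrow> 'a :: field mat \<Rightarrow> 'a mat \<Rightarrow> bool" where
  "w_condition Sp n v w \<longleftrightarrow>
     antidiag n * transpose_mat w - w * antidiag n = 0\<^sub>m n n"
| "w_condition O_even n v w \<longleftrightarrow>
     antidiag n * transpose_mat w + w * antidiag n = 0\<^sub>m n n"
| "w_condition O_odd n v w \<longleftrightarrow>
     antidiag n * transpose_mat w + w * antidiag n = - (v * transpose_mat v)"

text \<open>In the block matrix below, \<open>y\<close> plays the role of \<open>x\<^sup>-\<^sup>1\<close>. The first \<open>n + r\<close> columns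
  and the last \<open>n\<close> columns are grouped together, as are the rows.\<close>

definition block_elem ::
  "classical \<Rightarrow> nat \<Rightarrow> 'a :: field mat \<Rightarrow> 'a mat \<Rightarrow> 'a mat \<Rightarrow> 'a mat \<Rightarrow> 'a mat" where
  "block_elem T n x y v w =
     four_block_mat
       (four_block_mat x (x * v) (0\<^sub>m (mid T) n) (1\<^sub>m (mid T)))
       ((x * w) @\<^sub>r (- (transpose_mat v * antidiag n)))
       (0\<^sub>m n (n + mid T))
       (antidiag n * transpose_mat y * antidiag n)"

definition U_carrier :: "classical \<Rightarrow> nat \<Rightarrow> 'a :: field mat set" where
  "U_carrier T n =
     {block_elem T n x y v w | x y v w.
        x \<in> unitriangular n \<and>
        y \<in> carrier_mat n n \<and> inverts_mat x y \<and> inverts_mat y x \<and>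
        v \<in> carrier_mat n (mid T) \<and> w \<in> carrier_mat n n \<and> w_condition T n v w}"

definition U_group :: "classical \<Rightarrow> nat \<Rightarrow> 'a :: field mat monoid" where
  "U_group T n = \<lparr>carrier = U_carrier T n, mult = (*), one = 1\<^sub>m (mat_size T n)\<rparr>"


section \<open>Row and column indices\<close>

definition idx_set :: "classical \<Rightarrow> nat \<Rightarrow> int set" where
  "idx_set T n = {1..int n} \<union> (if T = O_odd then {0} else {}) \<union> {- int n..-1}"

text \<open>The order \<open>1 \<prec> 2 \<prec> \<dots> \<prec> 0 \<prec> \<dots> \<prec> -2 \<prec> -1\<close>, on all integers at once.\<close>

definition idx_less :: "int \<Rightarrow> int \<Rightarrow> bool" (infix \<open>\<prec>\<close> 50) where
  "i \<prec> j \<longleftrightarrow>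
     (if 0 < i then j \<le> 0 \<or> i < j else if i = 0 then j < 0 else i < j \<and> j < 0)"

abbreviation idx_le :: "int \<Rightarrow> int \<Rightarrow> bool" (infix \<open>\<preceq>\<close> 50) where
  "i \<preceq> j \<equiv> i \<prec> j \<or> i = j"

text \<open>The matrix library numbers rows and columns from 0; \<open>idx_pos\<close> translates.\<close>

definition idx_pos :: "classical \<Rightarrow> nat \<Rightarrow> int \<Rightarrow> nat" where
  "idx_pos T n i = card {k \<in> idx_set T n. k \<prec> i}"

definition entry :: "classical \<Rightarrow> nat \<Rightarrow> 'a mat \<Rightarrow> int \<Rightarrow> int \<Rightarrow> 'a" where
  "entry T n x i j = x $$ (idx_pos T n i, idx_pos T n j)"


section \<open>Roots and basic pairs\<close>

text \<open>\<open>Eps_minus i j\<close>, \<open>Eps_plus i j\<close>, \<open>Eps_double i\<close> and \<open>Eps i\<close> stand for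
  \<open>\<epsilon>\<^sub>i - \<epsilon>\<^sub>j\<close>, \<open>\<epsilon>\<^sub>i + \<epsilon>\<^sub>j\<close>, \<open>2\<epsilon>\<^sub>i\<close> and \<open>\<epsilon>\<^sub>i\<close>. Only terms with \<open>i < j\<close> occur among the
  roots, so that distinct terms are distinct roots.\<close>

datatype eps_root =
    Eps_minus nat nat
  | Eps_plus nat nat
  | Eps_double nat
  | Eps nat

fun extra_roots :: "classical \<Rightarrow> nat \<Rightarrow> eps_root set" where
  "extra_roots Sp n = Eps_double ` {1..n}"
| "extra_roots O_even n = {}"
| "extra_roots O_odd n = Eps ` {1..n}"

definition roots :: "classical \<Rightarrow> nat \<Rightarrow> eps_root set" where
  "roots T n =
     {Eps_minus i j | i j. 1 \<le> i \<and> i < j \<and> j \<le> n} \<union>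
     {Eps_plus i j | i j. 1 \<le> i \<and> i < j \<and> j \<le> n} \<union>
     extra_roots T n"

fun entries :: "eps_root \<Rightarrow> (int \<times> int) set" where
  "entries (Eps_minus i j) = {(int i, int j), (- int j, - int i)}"
| "entries (Eps_plus i j) = {(int i, - int j), (int j, - int i)}"
| "entries (Eps_double i) = {(int i, - int i)}"
| "entries (Eps i) = {(int i, 0), (0, - int i)}"

definition positive_entry :: "nat \<Rightarrow> eps_root \<Rightarrow> int \<times> int" where
  "positive_entry n \<alpha> =
     (THE p. p \<in> entries \<alpha> \<and> 1 \<le> fst p \<and> fst p \<le> int n \<and>
             fst p \<prec> snd p \<and> snd p \<preceq> - fst p)"

definition basic :: "classical \<Rightarrow> nat \<Rightarrow> eps_root set \<Rightarrow> bool" where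
  "basic T n D \<longleftrightarrow>
     D \<subseteq> roots T n \<and>
     (\<forall>i j k. (i, j) \<in> \<Union> (entries ` D) \<and> (i, k) \<in> \<Union> (entries ` D) \<longrightarrow> j = k) \<and>
     (\<forall>i j k. (i, k) \<in> \<Union> (entries ` D) \<and> (j, k) \<in> \<Union> (entries ` D) \<longrightarrow> i = j)"

text \<open>The maps \<open>\<phi>\<close> are taken to be \<open>undefined\<close> outside \<open>D\<close>, so that each map on \<open>D\<close> is
  represented once.\<close>

definition basic_pairs ::
  "classical \<Rightarrow> nat \<Rightarrow> (eps_root set \<times> (eps_root \<Rightarrow> 'a :: field)) set" where
  "basic_pairs T n = {(D, \<phi>). basic T n D \<and> \<phi> \<in> D \<rightarrow>\<^sub>E UNIV - {0}}"


section \<open>Supercharacters\<close>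

fun U_root_cond :: "classical \<Rightarrow> nat \<Rightarrow> eps_root \<Rightarrow> 'a :: field mat \<Rightarrow> bool" where
  "U_root_cond T n (Eps_minus i j) x \<longleftrightarrow>
     (\<forall>k. int i < k \<and> k < int j \<longrightarrow> entry T n x (int i) k = 0)"
| "U_root_cond T n (Eps_plus i j) x \<longleftrightarrow>
     (\<forall>k. int i < k \<and> k \<le> int n \<longrightarrow> entry T n x (int i) k = 0) \<and>
     (\<forall>l \<in> idx_set T n. int j \<prec> l \<and> l \<preceq> 0 \<longrightarrow> entry T n x (int j) l = 0)"
| "U_root_cond T n (Eps_double i) x \<longleftrightarrow>
     (\<forall>k. int i < k \<and> k \<le> int n \<longrightarrow> entry T n x (int i) k = 0)"
| "U_root_cond T n (Eps i) x \<longleftrightarrow>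
     (\<forall>k. int i < k \<and> k \<le> int n \<longrightarrow> entry T n x (int i) k = 0)"

definition U_root :: "classical \<Rightarrow> nat \<Rightarrow> eps_root \<Rightarrow> 'a :: field mat set" where
  "U_root T n \<alpha> = {x \<in> U_carrier T n. U_root_cond T n \<alpha> x}"

definition lambda_char ::
  "('a \<Rightarrow> complex) \<Rightarrow> classical \<Rightarrow> nat \<Rightarrow> eps_root \<Rightarrow> 'a :: field \<Rightarrow> 'a mat \<Rightarrow> complex" where
  "lambda_char \<theta> T n \<alpha> r x =
     \<theta> (r * entry T n x (fst (positive_entry n \<alpha>)) (snd (positive_entry n \<alpha>)))"

definition elementary_char ::
  "('a \<Rightarrow> complex) \<Rightarrow> classical \<Rightarrow> nat \<Rightarrow> eps_root \<Rightarrow> 'a :: field \<Rightarrow> 'a mat \<Rightarrow> complex" where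
  "elementary_char \<theta> T n \<alpha> r =
     induced_char (U_group T n) (U_root T n \<alpha>) (lambda_char \<theta> T n \<alpha> r)"

definition supercharacter ::
  "('a \<Rightarrow> complex) \<Rightarrow> classical \<Rightarrow> nat \<Rightarrow> eps_root set \<Rightarrow> (eps_root \<Rightarrow> 'a :: field) \<Rightarrow>
    'a mat \<Rightarrow> complex" where
  "supercharacter \<theta> T n D \<phi> g = (\<Prod>\<alpha>\<in>D. elementary_char \<theta> T n \<alpha> (\<phi> \<alpha>) g)"

definition nontrivial_linear_char :: "('a :: field \<Rightarrow> complex) \<Rightarrow> bool" where
  "nontrivial_linear_char \<theta> \<longleftrightarrow>
     (\<forall>a. \<theta> a \<noteq> 0) \<and> (\<forall>a b. \<theta> (a + b) = \<theta> a * \<theta> b) \<and> (\<exists>a. \<theta> a \<noteq> 1)"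


section \<open>Consistency of the conventions\<close>

lemma regular_char_eq:
  assumes "group G" and g: "g \<in> carrier G"
  shows "regular_char G g = (if g = \<one>\<^bsub>G\<^esub> then of_nat (card (carrier G)) else 0)"
proof -
  interpret group G by fact
  have "h = g \<otimes>\<^bsub>G\<^esub> h \<longleftrightarrow> g = \<one>\<^bsub>G\<^esub>" if "h \<in> carrier G" for h
    using that g by (metis l_one one_closed right_cancel)
  then show ?thesis
    by (simp add: regular_char_def regular_rep_def)
qed

lemma idx_pos_eq:
  assumes "i \<in> idx_set T n"
  shows "idx_pos T n i =
    (if 0 < i then nat i - 1 else if i = 0 then n else mat_size T n - nat (- i))"
proof -
  consider "0 < i" | "i = 0" | "i < 0" by linarith
  then show ?thesis
  proof cases
    case 1
    then have "{k \<in> idx_set T n. k \<prec> i} = {1..<i}"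
      using assms by (auto simp: idx_set_def idx_less_def split: if_splits)
    with 1 show ?thesis by (simp add: idx_pos_def)
  next
    case 2
    then have "{k \<in> idx_set T n. k \<prec> i} = {1..int n}"
      using assms by (auto simp: idx_set_def idx_less_def split: if_splits)
    with 2 show ?thesis by (simp add: idx_pos_def)
  next
    case 3
    then have *: "{k \<in> idx_set T n. k \<prec> i} =
        ({1..int n} \<union> (if T = O_odd then {0} else {})) \<union> {- int n..<i}"
      using assms by (auto simp: idx_set_def idx_less_def split: if_splits)
    have "card {k \<in> idx_set T n. k \<prec> i} = n + mid T + nat (i + int n)"
      unfolding * using 3 by (subst card_Un_disjoint) (cases T; auto)+
    with 3 assms show ?thesis
      by (auto simp: idx_pos_def idx_set_def split: if_splits)
  qed
qed

lemma positive_entry_eq: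
  assumes "\<alpha> \<in> roots T n"
  shows "positive_entry n \<alpha> =
    (case \<alpha> of Eps_minus i j \<Rightarrow> (int i, int j) | Eps_plus i j \<Rightarrow> (int i, - int j)
     | Eps_double i \<Rightarrow> (int i, - int i) | Eps i \<Rightarrow> (int i, 0))"
  using assms unfolding positive_entry_def
  by (cases T; cases \<alpha>) (auto simp: roots_def idx_less_def intro!: the_equality)

end

theory Submission
  imports Defs "Jordan_Normal_Form.Determinant"
begin

text \<open>Index rows and columns by \<open>0, \<dots>, m - 1\<close> and let \<open>F\<close> be the form preserved by \<open>U\<close>. The Cayley
  transform \<open>y = (u - 1) / (u + 1)\<close> followed by \<open>X = y F\<close> identifies \<open>U\<close> with the space of all
  symmetric (\<open>Sp\<close>) or alternating (\<open>O\<close>) matrices \<open>X\<close> with \<open>X\<^bsub>ab\<^esub> = 0\<close> for \<open>a + b \<ge> m - 1\<close>, and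
  conjugation by \<open>h \<in> U\<close> becomes \<open>X \<mapsto> h X h\<^sup>T\<close>. The latter formula defines an action of the whole
  group \<open>G\<close> of unitriangular matrices. A root is a pair of rows \<open>i \<le> k\<close>, and a basic set of roots
  is a partial matching of the rows.

  For a linear functional \<open>Z\<close> on the space of forms let \<open>S\<^sub>Z(X)\<close> be the average of
  \<open>\<theta>(Z(g X g\<^sup>T))\<close> over \<open>g \<in> G\<close>, that is, the average of \<open>\<theta>(W(X))\<close> over the \<open>G\<close>-orbit of \<open>Z\<close>.
  Three facts give the theorem.
  An elementary character is a multiple of \<open>S\<^sub>Z\<close> with \<open>Z(X) = c X\<^bsub>ik\<^esub>\<close>: averaging over the
  subgroup \<open>K\<close> of \<open>G\<close> cut out by the equations of the root subgroup produces the indicator function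
  of the root subgroup, and \<open>G = K U\<close>.
  Products of elementary characters over a basic set are again multiples of some \<open>S\<^sub>Z\<close>, because
  the factors depend on disjoint sets of rows of \<open>g\<close>.
  Finally, the functionals arising from basic pairs are exactly those with at most one
  nonzero entry in each row, and simultaneous row and column elimination shows that they
  represent each \<open>G\<close>-orbit of functionals exactly once. Orthogonality of the additive
  characters \<open>X \<mapsto> \<theta>(W(X))\<close> then yields both the norms of the supercharacters and the
  decomposition of the regular character.\<close>

section \<open>Unitriangular matrices\<close>

text \<open>The congruence action is taken for all unitriangular matrices, not just for U, because
  there the rows of g vary independently of each other; elimination and the product formula both
  rest on this. Functionals are encoded by forms through \<open>pairing\<close>, and the dual action
  \<open>coact\<close> is g^T Z g cut down to the region that forms can see. S_Z is
  \<open>avg_char\<close>, K is \<open>root_group\<close>.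

  Two things are never computed. G = K U is not proved by factoring matrices: the injection behind
  |G| |\<open>root_forms\<close>| <= |\<open>forms\<close>| |K|, together with |U| =
  |\<open>forms\<close>| and |U cap K| = |\<open>root_forms\<close>|, leaves no room for a fibre of
  K x U -> G of less than full size. And the degrees of the supercharacters stay unknown: xi(1) xi /
  <xi, xi> does not change when xi is multiplied by a nonzero real number, so it is enough to know
  xi up to such a factor.

  The oddness of q enters as 2 \<noteq> 0: in halving u + 1 for the Cayley transform, in removing a
  diagonal entry by a simultaneous row and column operation, and in identifying functionals with
  forms.\<close>

lemma finite_carrier_mat: "finite (carrier_mat m k :: 'a::finite mat set)"
proof -
  have "carrier_mat m k \<subseteq> (\<lambda>f. mat m k f) ` ({..<m} \<times> {..<k} \<rightarrow>\<^sub>E (UNIV :: 'a set))"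
  proof
    fix A :: "'a mat" assume "A \<in> carrier_mat m k"
    then have "A = mat m k (restrict (\<lambda>p. A $$ p) ({..<m} \<times> {..<k}))"
      by (intro eq_matI) auto
    then show "A \<in> (\<lambda>f. mat m k f) ` ({..<m} \<times> {..<k} \<rightarrow>\<^sub>E UNIV)"
      by (auto intro: image_eqI[where x="restrict (\<lambda>p. A $$ p) ({..<m} \<times> {..<k})"])
  qed
  then show ?thesis
    by (rule finite_subset) (intro finite_imageI finite_PiE; simp)
qed

lemma index_mult_mat_sum:
  assumes "A \<in> carrier_mat m k" "B \<in> carrier_mat k l" "a < m" "b < l"
  shows "(A * B) $$ (a, b) = (\<Sum>c<k. A $$ (a, c) * B $$ (c, b))"
  using assms by (simp add: scalar_prod_def atLeast0LessThan)

lemma unitriangularD: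
  assumes "g \<in> unitriangular m"
  shows "g \<in> carrier_mat m m" "\<And>a. a < m \<Longrightarrow> g $$ (a, a) = 1"
    "\<And>a b. b < a \<Longrightarrow> a < m \<Longrightarrow> g $$ (a, b) = 0"
  using assms by (auto simp: unitriangular_def)

lemma unitriangularI:
  assumes "g \<in> carrier_mat m m" "\<And>a. a < m \<Longrightarrow> g $$ (a, a) = 1"
    "\<And>a b. b < a \<Longrightarrow> a < m \<Longrightarrow> g $$ (a, b) = 0"
  shows "g \<in> unitriangular m"
  using assms by (auto simp: unitriangular_def)

lemma finite_unitriangular: "finite (unitriangular m :: 'a::{zero,one,finite} mat set)"
  by (rule finite_subset[OF _ finite_carrier_mat[of m m]]) (auto simp: unitriangular_def)

lemma one_unitriangular: "1\<^sub>m m \<in> (unitriangular m :: 'a::{zero,one} mat set)"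
  by (auto simp: unitriangular_def)

text \<open>Terms left of b vanish because of the row of A, terms right of b because B is
  triangular. This gives closure under products, and later the fact that right multiplication by a
  unitriangular matrix keeps initial zero segments of rows.\<close>

lemma upper_mult_row:
  fixes A B :: "'a::comm_ring_1 mat"
  assumes "A \<in> carrier_mat m m" "B \<in> carrier_mat m m"
    and tri: "\<And>c d. d < c \<Longrightarrow> c < m \<Longrightarrow> B $$ (c, d) = 0"
    and "a < m" "b < m" and zero: "\<And>c. c < b \<Longrightarrow> A $$ (a, c) = 0"
  shows "(A * B) $$ (a, b) = A $$ (a, b) * B $$ (b, b)"
proof -
  have "(A * B) $$ (a, b) = (\<Sum>c<m. if c = b then A $$ (a, b) * B $$ (b, b) else 0)"
    unfolding index_mult_mat_sum[OF assms(1,2,4,5)]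
  proof (intro sum.cong refl)
    fix c assume "c \<in> {..<m}"
    then show "A $$ (a, c) * B $$ (c, b) = (if c = b then A $$ (a, b) * B $$ (b, b) else 0)"
      using zero[of c] tri[of b c] by (cases c b rule: linorder_cases) auto
  qed
  then show ?thesis using assms by simp
qed

lemma unitriangular_mult:
  fixes g h :: "'a::comm_ring_1 mat"
  assumes g: "g \<in> unitriangular m" and h: "h \<in> unitriangular m"
  shows "g * h \<in> unitriangular m"
proof (rule unitriangularI)
  note gD = unitriangularD[OF g] and hD = unitriangularD[OF h]
  show "g * h \<in> carrier_mat m m" using gD hD by auto
  show "(g * h) $$ (a, a) = 1" if "a < m" for a
    using that gD hD by (subst upper_mult_row[of _ m]) auto
  show "(g * h) $$ (a, b) = 0" if "b < a" "a < m" for a b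
    using that gD hD by (subst upper_mult_row[of _ m]) auto
qed

text \<open>Determinant 1 gives a left inverse k of unknown shape. Left multiplication by g is an
  injective self-map of the finite set of unitriangular matrices, hence surjective, which gives a
  unitriangular right inverse; the two agree.\<close>

lemma unitriangular_inverse:
  fixes g :: "'a::{field,finite} mat"
  assumes g: "g \<in> unitriangular m"
  obtains h where "h \<in> unitriangular m" "g * h = 1\<^sub>m m" "h * g = 1\<^sub>m m"
proof -
  note gD = unitriangularD[OF g]
  have "upper_triangular g" using g by (auto simp: unitriangular_def)
  then have "det g = prod_list (diag_mat g)"
    using gD(1) by (rule det_upper_triangular)
  also have "diag_mat g = map (\<lambda>_. 1) [0..<m]"
    using gD by (auto simp: diag_mat_def)
  also have "prod_list (map (\<lambda>_. 1 :: 'a) [0..<m]) = 1"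
    by (induction m) auto
  finally have "det g \<noteq> 0" by simp
  then obtain k where k: "k \<in> carrier_mat m m" "k * g = 1\<^sub>m m"
    using det_non_zero_imp_unit[OF gD(1)] unfolding Units_def ring_mat_def by auto
  have "inj_on ((*) g) (unitriangular m)"
  proof
    fix x y assume x: "x \<in> unitriangular m" and y: "y \<in> unitriangular m" and e: "g * x = g * y"
    have "k * (g * x) = k * (g * y)" using e by simp
    then show "x = y"
      using k gD(1) unitriangularD(1)[OF x] unitriangularD(1)[OF y]
      by (simp add: assoc_mult_mat[symmetric, of _ m m _ m _ m])
  qed
  moreover have "(*) g ` unitriangular m \<subseteq> unitriangular m"
    using unitriangular_mult[OF g] by auto
  ultimately have "(*) g ` unitriangular m = unitriangular m"
    by (rule endo_inj_surj[OF finite_unitriangular, rotated])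
  then obtain h where h: "h \<in> unitriangular m" "g * h = 1\<^sub>m m"
    using one_unitriangular[of m, where 'a='a] by (metis imageE)
  note hD = unitriangularD(1)[OF h(1)]
  have "k = k * (g * h)" using k(1) h(2) by simp
  also have "\<dots> = h" using k hD gD(1) by (simp add: assoc_mult_mat[symmetric, of _ m m _ m _ m])
  finally show thesis using that h k by blast
qed

section \<open>Symmetric and alternating forms in the anti-triangular region\<close>

text \<open>\<open>ep\<close> is \<open>1\<close> in the symplectic and \<open>-1\<close> in the orthogonal case.\<close>

definition forms :: "nat \<Rightarrow> 'a::field \<Rightarrow> 'a mat set" where
  "forms m ep = {X \<in> carrier_mat m m.
     (\<forall>a<m. \<forall>b<m. X $$ (b, a) = ep * X $$ (a, b)) \<and>
     (\<forall>a<m. \<forall>b<m. m \<le> a + b + 1 \<longrightarrow> X $$ (a, b) = 0)}"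

text \<open>Identifies functionals on the space of forms with forms. An off-diagonal entry counts
  twice, so the identification depends on 2 being invertible.\<close>

definition pairing :: "nat \<Rightarrow> 'a::field mat \<Rightarrow> 'a mat \<Rightarrow> 'a" where
  "pairing m Z X = (\<Sum>a<m. \<Sum>b<m. Z $$ (a, b) * X $$ (a, b))"

abbreviation congr_act :: "'a::field mat \<Rightarrow> 'a mat \<Rightarrow> 'a mat" where
  "congr_act g X \<equiv> g * X * transpose_mat g"

text \<open>The dual of \<open>congr_act\<close> under \<open>pairing\<close>. The matrix g^T Z g
  may be nonzero on and below the antidiagonal, where forms vanish; cutting it off there makes the
  result a form again.\<close>

definition coact :: "nat \<Rightarrow> 'a::field mat \<Rightarrow> 'a mat \<Rightarrow> 'a mat" where
  "coact m Z g = mat m m (\<lambda>(a, b). if a + b + 1 < m then (transpose_mat g * Z * g) $$ (a, b) else 0)"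

definition normal_form :: "nat \<Rightarrow> 'a::field mat \<Rightarrow> bool" where
  "normal_form m Z \<longleftrightarrow>
     (\<forall>a<m. \<forall>b<m. \<forall>c<m. Z $$ (a, b) \<noteq> 0 \<and> Z $$ (a, c) \<noteq> 0 \<longrightarrow> b = c)"

lemma formsD:
  assumes "X \<in> forms m ep"
  shows "X \<in> carrier_mat m m" "\<And>a b. a < m \<Longrightarrow> b < m \<Longrightarrow> X $$ (b, a) = ep * X $$ (a, b)"
    "\<And>a b. a < m \<Longrightarrow> b < m \<Longrightarrow> m \<le> a + b + 1 \<Longrightarrow> X $$ (a, b) = 0"
  using assms unfolding forms_def by blast+

lemma formsI:
  assumes "X \<in> carrier_mat m m" "\<And>a b. a < m \<Longrightarrow> b < m \<Longrightarrow> X $$ (b, a) = ep * X $$ (a, b)"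
    "\<And>a b. a < m \<Longrightarrow> b < m \<Longrightarrow> m \<le> a + b + 1 \<Longrightarrow> X $$ (a, b) = 0"
  shows "X \<in> forms m ep"
  using assms unfolding forms_def by blast+

lemma finite_forms: "finite (forms m ep :: 'a::{field,finite} mat set)"
  by (rule finite_subset[OF _ finite_carrier_mat[of m m]]) (auto simp: forms_def)

lemma zero_forms: "0\<^sub>m m m \<in> forms m ep"
  by (auto simp: forms_def)

lemma add_forms:
  assumes "X \<in> forms m ep" "Y \<in> forms m ep"
  shows "X + Y \<in> forms m ep"
proof (rule formsI)
  note XD = formsD[OF assms(1)] and YD = formsD[OF assms(2)]
  show "X + Y \<in> carrier_mat m m" using XD(1) YD(1) by simp
  fix a b assume ab: "a < m" "b < m"
  show "(X + Y) $$ (b, a) = ep * (X + Y) $$ (a, b)"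
    using XD(1) YD(1) ab XD(2)[OF ab] YD(2)[OF ab] by (simp add: distrib_left)
  show "(X + Y) $$ (a, b) = 0" if "m \<le> a + b + 1"
    using XD(1) YD(1) ab XD(3)[OF ab that] YD(3)[OF ab that] by simp
qed

lemma smult_forms:
  assumes "X \<in> forms m ep"
  shows "t \<cdot>\<^sub>m X \<in> forms m ep"
proof (rule formsI)
  note XD = formsD[OF assms]
  show "t \<cdot>\<^sub>m X \<in> carrier_mat m m" using XD(1) by simp
  fix a b assume ab: "a < m" "b < m"
  show "(t \<cdot>\<^sub>m X) $$ (b, a) = ep * (t \<cdot>\<^sub>m X) $$ (a, b)"
    using XD(1) ab XD(2)[OF ab] by simp
  show "(t \<cdot>\<^sub>m X) $$ (a, b) = 0" if "m \<le> a + b + 1"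
    using XD(1) ab XD(3)[OF ab that] by simp
qed

lemma minus_forms:
  assumes "X \<in> forms m ep" "Y \<in> forms m ep"
  shows "X - Y \<in> forms m ep"
proof -
  have "X - Y = X + (-1) \<cdot>\<^sub>m Y"
    using formsD(1)[OF assms(1)] formsD(1)[OF assms(2)] by (intro eq_matI) auto
  then show ?thesis by (simp add: add_forms assms smult_forms)
qed

lemma index_congr_act:
  assumes "g \<in> carrier_mat m m" "X \<in> carrier_mat m m" "a < m" "b < m"
  shows "congr_act g X $$ (a, b) = (\<Sum>c<m. \<Sum>d<m. g $$ (a, c) * X $$ (c, d) * g $$ (b, d))"
proof -
  have "congr_act g X $$ (a, b) = (\<Sum>d<m. (g * X) $$ (a, d) * g $$ (b, d))"
    using assms by (subst index_mult_mat_sum[of _ m m _ m]) auto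
  also have "\<dots> = (\<Sum>d<m. \<Sum>c<m. g $$ (a, c) * X $$ (c, d) * g $$ (b, d))"
    using assms by (intro sum.cong refl) (auto simp: index_mult_mat_sum[of _ m m _ m] sum_distrib_right simp del: index_mult_mat(1))
  finally show ?thesis using sum.swap by (rule trans)
qed

lemma congr_act_mult:
  assumes "g \<in> carrier_mat m m" "h \<in> carrier_mat m m" "X \<in> carrier_mat m m"
  shows "congr_act (g * h) X = congr_act g (congr_act h X)"
proof -
  have "congr_act (g * h) X = g * h * X * (transpose_mat h * transpose_mat g)"
    using assms by (simp add: transpose_mult)
  then show ?thesis using assms by (simp add: assoc_mult_mat[of _ m m _ m _ m])
qed

lemma congr_act_one: "X \<in> carrier_mat m m \<Longrightarrow> congr_act (1\<^sub>m m) X = X"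
  by simp

lemma sum_flip:
  fixes X :: "'a::comm_ring_1 mat"
  assumes "\<And>a b. a < m \<Longrightarrow> b < m \<Longrightarrow> X $$ (b, a) = ep * X $$ (a, b)"
  shows "(\<Sum>c<m. \<Sum>d<m. u c * X $$ (c, d) * v d) =
     ep * (\<Sum>c<m. \<Sum>d<m. v c * X $$ (c, d) * u d)"
proof -
  have "(\<Sum>c<m. \<Sum>d<m. u c * X $$ (c, d) * v d) = (\<Sum>d<m. \<Sum>c<m. ep * (v d * X $$ (d, c) * u c))"
  proof (subst sum.swap, intro sum.cong refl)
    fix c d assume "d \<in> {..<m}" "c \<in> {..<m}"
    then have "X $$ (c, d) = ep * X $$ (d, c)" using assms[of d c] by simp
    then show "u c * X $$ (c, d) * v d = ep * (v d * X $$ (d, c) * u c)"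
      by (simp only: mult_ac)
  qed
  then show ?thesis by (simp only: sum_distrib_left)
qed

text \<open>The zero region survives because row a of g starts at column a: only indices c \<ge> a
  and d \<ge> b contribute to entry (a, b), and for these c + d + 1 \<ge> m as well.\<close>

lemma congr_act_forms:
  assumes g: "g \<in> unitriangular m" and X: "X \<in> forms m ep"
  shows "congr_act g X \<in> forms m ep"
proof (rule formsI)
  note gD = unitriangularD[OF g] and XD = formsD[OF X]
  show "congr_act g X \<in> carrier_mat m m" using gD(1) XD(1) by auto
  fix a b assume ab: "a < m" "b < m"
  show "congr_act g X $$ (b, a) = ep * congr_act g X $$ (a, b)"
    unfolding index_congr_act[OF gD(1) XD(1) ab] index_congr_act[OF gD(1) XD(1) ab(2,1)]
    by (rule sum_flip[OF XD(2), where u="\<lambda>c. g $$ (b, c)" and v="\<lambda>d. g $$ (a, d)"])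
  show "congr_act g X $$ (a, b) = 0" if "m \<le> a + b + 1"
    unfolding index_congr_act[OF gD(1) XD(1) ab]
  proof (intro sum.neutral ballI)
    fix c d assume "c \<in> {..<m}" "d \<in> {..<m}"
    then show "g $$ (a, c) * X $$ (c, d) * g $$ (b, d) = 0"
      using gD(3)[of c a] gD(3)[of d b] XD(3)[of c d] ab that
      by (cases "c < a"; cases "d < b") auto
  qed
qed

lemma index_coact:
  assumes "g \<in> carrier_mat m m" "Z \<in> carrier_mat m m" "a < m" "b < m"
  shows "coact m Z g $$ (a, b) =
    (if a + b + 1 < m then \<Sum>c<m. \<Sum>d<m. g $$ (c, a) * Z $$ (c, d) * g $$ (d, b) else 0)"
proof -
  have "(transpose_mat g * Z * g) $$ (a, b) = congr_act (transpose_mat g) Z $$ (a, b)" by simp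
  also have "\<dots> = (\<Sum>c<m. \<Sum>d<m. g $$ (c, a) * Z $$ (c, d) * g $$ (d, b))"
    using assms by (subst index_congr_act[of _ m]) auto
  finally show ?thesis using assms by (simp add: coact_def)
qed

lemma coact_forms:
  assumes g: "g \<in> unitriangular m" and Z: "Z \<in> forms m ep"
  shows "coact m Z g \<in> forms m ep"
proof (rule formsI)
  note gD = unitriangularD[OF g] and ZD = formsD[OF Z]
  show "coact m Z g \<in> carrier_mat m m" by (simp add: coact_def)
  fix a b assume ab: "a < m" "b < m"
  have eq: "(\<Sum>c<m. \<Sum>d<m. g $$ (c, b) * Z $$ (c, d) * g $$ (d, a)) =
     ep * (\<Sum>c<m. \<Sum>d<m. g $$ (c, a) * Z $$ (c, d) * g $$ (d, b))"
    by (rule sum_flip[OF ZD(2), where u="\<lambda>c. g $$ (c, b)" and v="\<lambda>d. g $$ (d, a)"])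
  show "coact m Z g $$ (b, a) = ep * coact m Z g $$ (a, b)"
    unfolding index_coact[OF gD(1) ZD(1) ab] index_coact[OF gD(1) ZD(1) ab(2,1)] eq
    by (simp only: add.commute[of b a] if_distrib[of "(*) ep"] mult_zero_right)
  show "coact m Z g $$ (a, b) = 0" if "m \<le> a + b + 1"
    using ab that by (simp add: coact_def)
qed

text \<open>The entries removed by \<open>coact\<close> meet only zeros of X, so the truncation does
  not affect the pairing.\<close>

lemma pairing_coact:
  assumes g: "g \<in> unitriangular m" and Z: "Z \<in> forms m ep" and X: "X \<in> forms m ep"
  shows "pairing m (coact m Z g) X = pairing m Z (congr_act g X)"
proof -
  note gD = unitriangularD[OF g] and ZD = formsD[OF Z] and XD = formsD[OF X]
  have "pairing m (coact m Z g) X =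
      (\<Sum>a<m. \<Sum>b<m. \<Sum>c<m. \<Sum>d<m. g $$ (c, a) * Z $$ (c, d) * g $$ (d, b) * X $$ (a, b))"
    unfolding pairing_def using XD(3)
    by (intro sum.cong refl) (auto simp: index_coact[OF gD(1) ZD(1)] sum_distrib_right)
  also have "\<dots> = (\<Sum>c<m. \<Sum>d<m. \<Sum>a<m. \<Sum>b<m. g $$ (c, a) * Z $$ (c, d) * g $$ (d, b) * X $$ (a, b))"
    by (simp only: sum.cartesian_product)
      (rule sum.reindex_bij_witness[where i="\<lambda>(c, d, a, b). (a, b, c, d)" and j="\<lambda>(c, d, a, b). (a, b, c, d)"]; auto)
  also have "\<dots> = pairing m Z (congr_act g X)"
    unfolding pairing_def
    by (intro sum.cong refl) (auto simp: index_congr_act[OF gD(1) XD(1)] sum_distrib_left mult_ac)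
  finally show ?thesis .
qed

section \<open>Normal forms\<close>

text \<open>The sum is an entry of h^T W. By symmetry, column b of W has at most one nonzero entry,
  and h^T only moves it downwards; at its own position it keeps its value because h has ones on the
  diagonal.\<close>

lemma mult_forms_index_restrict:
  fixes h :: "'a::field mat"
  assumes h: "h \<in> unitriangular m" and W: "W \<in> forms m ep" and nf: "normal_form m W"
    and "a < m" "b < m"
  shows "(\<Sum>c<m. h $$ (c, a) * W $$ (c, b)) \<noteq> 0 \<Longrightarrow> \<exists>c\<le>a. W $$ (c, b) \<noteq> 0"
    and "W $$ (a, b) \<noteq> 0 \<Longrightarrow> (\<Sum>c<m. h $$ (c, a) * W $$ (c, b)) = W $$ (a, b)"
proof -
  note hD = unitriangularD[OF h] and WD = formsD[OF W]
  show "\<exists>c\<le>a. W $$ (c, b) \<noteq> 0" if "(\<Sum>c<m. h $$ (c, a) * W $$ (c, b)) \<noteq> 0"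
  proof -
    from that obtain c where "c < m" "h $$ (c, a) * W $$ (c, b) \<noteq> 0"
      by (meson lessThan_iff sum.not_neutral_contains_not_neutral)
    then show ?thesis using hD(3)[of a c] by (intro exI[of _ c]) force
  qed
  show "(\<Sum>c<m. h $$ (c, a) * W $$ (c, b)) = W $$ (a, b)" if nz: "W $$ (a, b) \<noteq> 0"
  proof -
    have "W $$ (c, b) = 0" if "c < m" "c \<noteq> a" for c
    proof (rule ccontr)
      assume "W $$ (c, b) \<noteq> 0"
      then have "W $$ (b, c) \<noteq> 0" "W $$ (b, a) \<noteq> 0"
        using WD(2)[of b c] WD(2)[of b a] nz assms(4,5) that by auto
      then show False using nf that assms(4,5) unfolding normal_form_def by blast
    qed
    then have "(\<Sum>c<m. h $$ (c, a) * W $$ (c, b)) = (\<Sum>c<m. if c = a then W $$ (a, b) else 0)"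
      using hD(2)[OF assms(4)] by (intro sum.cong refl) auto
    then show ?thesis using assms(4) by simp
  qed
qed

text \<open>Moving one factor of \<open>g\<^sup>T Z g\<close> to the other side leaves, for normal forms, a product of a
  monomial and a triangular matrix on both sides, so that single entries can be compared.\<close>

lemma coact_half:
  fixes g :: "'a::field mat"
  assumes g: "g \<in> unitriangular m" and h: "h \<in> unitriangular m" and gh: "g * h = 1\<^sub>m m"
    and Z: "Z \<in> forms m ep" and "a + b + 1 < m"
  shows "(\<Sum>d<m. g $$ (d, b) * Z $$ (a, d)) = (\<Sum>c<m. h $$ (c, a) * coact m Z g $$ (c, b))"
proof -
  note gD = unitriangularD[OF g] and hD = unitriangularD[OF h] and ZD = formsD[OF Z]
  have "(\<Sum>c<m. h $$ (c, a) * coact m Z g $$ (c, b)) =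
    (\<Sum>c<m. h $$ (c, a) * (\<Sum>k<m. g $$ (k, c) * (\<Sum>d<m. Z $$ (k, d) * g $$ (d, b))))"
  proof (intro sum.cong refl)
    fix c assume c: "c \<in> {..<m}"
    show "h $$ (c, a) * coact m Z g $$ (c, b) =
      h $$ (c, a) * (\<Sum>k<m. g $$ (k, c) * (\<Sum>d<m. Z $$ (k, d) * g $$ (d, b)))"
    \<comment> \<open>The truncation in \<open>coact\<close> does no harm: h kills the rows c > a,
      and for c \<le> a the position (c, b) lies inside the region.\<close>
    proof (cases "c \<le> a")
      case True
      then have "c + b + 1 < m" using assms(5) by simp
      then show ?thesis using c by (simp add: index_coact[OF gD(1) ZD(1)] sum_distrib_left mult.assoc)
    next
      case False then show ?thesis using hD(3)[of a c] c by simp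
    qed
  qed
  also have "\<dots> = (\<Sum>k<m. (\<Sum>c<m. g $$ (k, c) * h $$ (c, a)) * (\<Sum>d<m. Z $$ (k, d) * g $$ (d, b)))"
  proof -
    have "(\<Sum>c<m. h $$ (c, a) * (\<Sum>k<m. g $$ (k, c) * V k)) =
        (\<Sum>k<m. (\<Sum>c<m. g $$ (k, c) * h $$ (c, a)) * V k)" for V :: "nat \<Rightarrow> 'a"
      unfolding sum_distrib_left sum_distrib_right by (subst sum.swap) (simp add: mult_ac)
    then show ?thesis .
  qed
  also have "\<dots> = (\<Sum>k<m. (if k = a then 1 else 0) * (\<Sum>d<m. Z $$ (k, d) * g $$ (d, b)))"
  proof (intro sum.cong refl)
    fix k assume "k \<in> {..<m}"
    then have "(\<Sum>c<m. g $$ (k, c) * h $$ (c, a)) = (g * h) $$ (k, a)"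
      using gD(1) hD(1) assms(5) by (subst index_mult_mat_sum[of _ m m _ m]) auto
    then have "(\<Sum>c<m. g $$ (k, c) * h $$ (c, a)) = (if k = a then 1 else 0)"
      unfolding gh using \<open>k \<in> {..<m}\<close> assms(5) by simp
    then show "(\<Sum>c<m. g $$ (k, c) * h $$ (c, a)) * (\<Sum>d<m. Z $$ (k, d) * g $$ (d, b)) =
      (if k = a then 1 else 0) * (\<Sum>d<m. Z $$ (k, d) * g $$ (d, b))" by simp
  qed
  also have "\<dots> = (\<Sum>d<m. g $$ (d, b) * Z $$ (a, d))"
    using assms(5) by (simp add: if_distrib[of "\<lambda>x. x * _"] mult.commute cong: if_cong)
  finally show ?thesis by simp
qed

text \<open>Induction on the row, comparing entries of Z g and h^T W, where W is the transformed
  form and h the inverse of g. At (a, b) the left side is the nonzero entry of Z, so column b of W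
  has a nonzero entry in some row c \<le> a. Read at (c, b), the same identity gives a nonzero entry
  of Z in row c, in a column d \<le> b.\<close>

lemma normal_form_unique_entry:
  fixes Z :: "'a::{field,finite} mat"
  assumes g: "g \<in> unitriangular m" and Z: "Z \<in> forms m ep" and nfZ: "normal_form m Z"
    and nfW: "normal_form m (coact m Z g)"
    and ab: "a < m" "b < m" and nz: "Z $$ (a, b) \<noteq> 0"
  shows "coact m Z g $$ (a, b) = Z $$ (a, b)"
  using ab nz
proof (induction a arbitrary: b rule: less_induct)
  case (less a b)
  define W where "W = coact m Z g"
  obtain h where h: "h \<in> unitriangular m" and gh: "g * h = 1\<^sub>m m"
    using unitriangular_inverse[OF g] by blast
  have W: "W \<in> forms m ep" unfolding W_def by (rule coact_forms[OF g Z])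
  note half = coact_half[OF g h gh Z, folded W_def]
  note nfW = nfW[folded W_def]
  have reg: "a + b + 1 < m" using formsD(3)[OF Z less.prems(1,2)] less.prems(3) by force
  have sym: "Z $$ (j, i) \<noteq> 0" if "Z $$ (i, j) \<noteq> 0" "i < m" "j < m" for i j
    using formsD(2)[OF Z, of j i] that by force
  have Zrow: "(\<Sum>d<m. g $$ (d, j) * Z $$ (i, d)) = ep * (\<Sum>d<m. g $$ (d, j) * Z $$ (d, i))"
    if "i < m" for i j
    unfolding sum_distrib_left using formsD(2)[OF Z _ that]
    by (intro sum.cong refl) (simp add: mult.left_commute)
  have Zba: "Z $$ (b, a) \<noteq> 0" using sym less.prems by blast
  have lhs: "(\<Sum>d<m. g $$ (d, b) * Z $$ (a, d)) = Z $$ (a, b)"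
    unfolding Zrow[OF less.prems(1)]
    using mult_forms_index_restrict(2)[OF g Z nfZ less.prems(2,1) Zba] formsD(2)[OF Z less.prems(2,1)] by simp
  obtain c where c: "c \<le> a" "W $$ (c, b) \<noteq> 0"
    using mult_forms_index_restrict(1)[OF h W nfW less.prems(1,2)] half[OF reg] lhs less.prems(3) by auto
  have cm: "c < m" using c(1) less.prems(1) by simp
  have "(\<Sum>d<m. g $$ (d, b) * Z $$ (c, d)) = W $$ (c, b)"
    using half[of c b] mult_forms_index_restrict(2)[OF h W nfW cm less.prems(2) c(2)] reg c(1) by simp
  then have "(\<Sum>d<m. g $$ (d, b) * Z $$ (d, c)) \<noteq> 0"
    using c(2) Zrow[OF cm] by force
  then obtain d where d: "d \<le> b" "Z $$ (d, c) \<noteq> 0"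
    using mult_forms_index_restrict(1)[OF g Z nfZ less.prems(2) cm] by auto
  have dm: "d < m" using d(1) less.prems(2) by simp
  have Zcd: "Z $$ (c, d) \<noteq> 0" using sym[OF d(2) dm cm] .
  \<comment> \<open>If c < a, the induction hypothesis makes W nonzero at (c, d) too, so d = b since
    W is normal; then row b of Z has nonzero entries in both columns a and c.\<close>
  have "c = a"
  proof (rule ccontr)
    assume "c \<noteq> a"
    then have "W $$ (c, d) = Z $$ (c, d)" using less.IH[of c d] c(1) cm dm Zcd by (simp add: W_def)
    then have "b = d" using nfW c(2) Zcd cm dm less.prems(2) unfolding normal_form_def by metis
    then have "Z $$ (b, c) \<noteq> 0" using d(2) by simp
    then show False using Zba nfZ cm less.prems \<open>c \<noteq> a\<close> unfolding normal_form_def by blast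
  qed
  then have Wab: "W $$ (a, b) \<noteq> 0" using c(2) by simp
  then show ?case
    using half[OF reg] lhs mult_forms_index_restrict(2)[OF h W nfW less.prems(1,2) Wab] by (simp add: W_def)
qed

lemma coact_one: "Z \<in> forms m ep \<Longrightarrow> coact m Z (1\<^sub>m m) = Z"
proof -
  assume Z: "Z \<in> forms m ep"
  note ZD = formsD[OF Z]
  show ?thesis
    using ZD(1) ZD(3) by (intro eq_matI) (auto simp: coact_def)
qed

text \<open>The preceding lemma speaks only of positions where the first form is nonzero. Applied in
  both directions it covers the positions where either form is nonzero.\<close>

lemma normal_form_unique:
  fixes Z :: "'a::{field,finite} mat"
  assumes g: "g \<in> unitriangular m" and Z: "Z \<in> forms m ep" and W: "W \<in> forms m ep"
    and nfZ: "normal_form m Z" and nfW: "normal_form m W"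
    and h: "h \<in> unitriangular m" and "W = coact m Z g" "Z = coact m W h"
  shows "W = Z"
proof (rule eq_matI)
  fix a b assume "a < dim_row Z" "b < dim_col Z"
  then have ab: "a < m" "b < m" using formsD(1)[OF Z] by auto
  show "W $$ (a, b) = Z $$ (a, b)"
    using normal_form_unique_entry[OF g Z nfZ _ ab, folded assms(7), OF nfW]
      normal_form_unique_entry[OF h W nfW _ ab, folded assms(8), OF nfZ] by metis
qed (use formsD(1)[OF Z] formsD(1)[OF W] in auto)

text \<open>The invariant of the elimination. The partner b of a treated row a may itself be
  untreated; requiring row b to be finished as well is what lets later steps leave the pair
  alone.\<close>

definition cleared :: "nat \<Rightarrow> nat \<Rightarrow> 'a::field mat \<Rightarrow> bool" where
  "cleared m i Z \<longleftrightarrow> (\<forall>a<i. \<forall>b<m. Z $$ (a, b) \<noteq> 0 \<longrightarrow>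
     (\<forall>c<m. Z $$ (a, c) \<noteq> 0 \<longrightarrow> c = b) \<and> (\<forall>d<m. Z $$ (b, d) \<noteq> 0 \<longrightarrow> d = a))"

text \<open>The matrix 1 - e_b c^T - e_i d^T. Acting by congruence, it subtracts c_l times row and
  column b and d_l times row and column i from row and column l, for all l at once.\<close>

definition shear :: "nat \<Rightarrow> nat \<Rightarrow> nat \<Rightarrow> (nat \<Rightarrow> 'a) \<Rightarrow> (nat \<Rightarrow> 'a) \<Rightarrow> 'a::field mat" where
  "shear m i b c d = mat m m (\<lambda>(r, l).
     (if r = l then 1 else 0) - (if r = b then c l else 0) - (if r = i then d l else 0))"

lemma shear_unitriangular:
  assumes "i < m" "b < m" "\<And>l. l \<le> b \<Longrightarrow> c l = 0" "\<And>l. l \<le> i \<Longrightarrow> d l = 0"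
  shows "shear m i b c d \<in> unitriangular m"
  using assms by (intro unitriangularI) (auto simp: shear_def)

text \<open>\<open>W\<close> is column l after the column operation; the row operation is then
  applied to \<open>W\<close>.\<close>

lemma coact_shear:
  fixes Z :: "'a::field mat" and c d :: "nat \<Rightarrow> 'a"
  assumes "Z \<in> carrier_mat m m" "i < m" "b < m" "k + l + 1 < m"
  defines "W \<equiv> \<lambda>r. Z $$ (r, l) - c l * Z $$ (r, b) - d l * Z $$ (r, i)"
  shows "coact m Z (shear m i b c d) $$ (k, l) = W k - c k * W b - d k * W i"
proof -
  let ?g = "shear m i b c d"
  have gi: "?g $$ (r, l) = (if r = l then 1 else 0) - (if r = b then c l else 0) - (if r = i then d l else 0)"
    if "r < m" "l < m" for r l using that by (simp add: shear_def)
  have in_sum: "(\<Sum>r<m. f r * ?g $$ (r, l)) = f l - c l * f b - d l * f i" if "l < m" for f l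
  proof -
    have "(\<Sum>r<m. f r * ?g $$ (r, l)) =
      (\<Sum>r<m. (if r = l then f l else 0) - (if r = b then c l * f b else 0) - (if r = i then d l * f i else 0))"
      using that by (intro sum.cong refl) (auto simp: gi algebra_simps)
    then show ?thesis using that assms(2,3) by (simp add: sum_subtractf)
  qed
  have "coact m Z ?g $$ (k, l) = (\<Sum>r<m. (\<Sum>t<m. Z $$ (r, t) * ?g $$ (t, l)) * ?g $$ (r, k))"
    using assms(1,4) by (subst index_coact[of _ m]) (auto simp: shear_def sum_distrib_left mult_ac)
  also have "\<dots> = (\<Sum>r<m. W r * ?g $$ (r, k))"
    using assms(4) by (subst in_sum) (auto simp: W_def)
  also have "\<dots> = W k - c k * W b - d k * W i"
    using assms(4) by (intro in_sum) simp
  finally show ?thesis .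
qed

text \<open>The pivot at (i, i) clears the rest of its row and column. As it is the first nonzero
  entry of its row, multiples of row i are only subtracted from later rows, so the shear is
  unitriangular.\<close>

lemma clear_diagonal:
  fixes Z :: "'a::field mat"
  assumes Z: "Z \<in> forms m ep" and cl: "cleared m i Z" and i: "i < m"
    and nz: "Z $$ (i, i) \<noteq> 0" and least: "\<And>l. l < i \<Longrightarrow> Z $$ (i, l) = 0"
  shows "\<exists>g \<in> unitriangular m. cleared m (Suc i) (coact m Z g)"
proof -
  note ZD = formsD[OF Z]
  define d where "d l = (if l = i then 0 else Z $$ (i, l) / Z $$ (i, i))" for l
  let ?g = "shear m i i (\<lambda>_. 0) d"
  have g: "?g \<in> unitriangular m"
    using i least by (intro shear_unitriangular) (auto simp: d_def)
  define Y where "Y = coact m Z ?g"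
  have Y: "Y $$ (k, l) = Z $$ (k, l) - d l * Z $$ (k, i) - d k * (Z $$ (i, l) - d l * Z $$ (i, i))"
    if "Y $$ (k, l) \<noteq> 0" "k < m" "l < m" for k l
  proof -
    have "k + l + 1 < m" using that by (auto simp: Y_def coact_def split: if_splits)
    then show ?thesis unfolding Y_def using i by (subst coact_shear[OF ZD(1)]) auto
  qed
  have Yi: "l = i" if "Y $$ (i, l) \<noteq> 0" "l < m" for l
  proof (rule ccontr)
    assume "l \<noteq> i"
    then show False using Y[OF that(1) i that(2)] that(1) nz by (simp add: d_def)
  qed
  have zsym: "Z $$ (k, l) = 0 \<longleftrightarrow> Z $$ (l, k) = 0" if "k < m" "l < m" for k l
    using ZD(2)[OF that] ZD(2)[OF that(2,1)] by auto
  have Yk: "Y $$ (k, l) = Z $$ (k, l)" if "Y $$ (k, l) \<noteq> 0" "k < m" "l < m" "Z $$ (k, i) = 0" for k l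
    using Y[OF that(1-3)] that zsym[of k i] i nz by (auto simp: d_def split: if_splits)
  have "cleared m (Suc i) Y"
    unfolding cleared_def
  proof (intro allI impI)
    fix a b assume ab: "a < Suc i" "b < m" and nzY: "Y $$ (a, b) \<noteq> 0"
    show "(\<forall>c<m. Y $$ (a, c) \<noteq> 0 \<longrightarrow> c = b) \<and> (\<forall>d<m. Y $$ (b, d) \<noteq> 0 \<longrightarrow> d = a)"
    proof (cases "a = i")
      case True
      then show ?thesis using nzY Yi ab by auto
    next
      case False
      then have a: "a < i" "a < m" using ab i by auto
      then have ai: "Z $$ (a, i) = 0" using least zsym[of a i] i by auto
      have Zab: "Z $$ (a, b) \<noteq> 0" using Yk[OF nzY a(2) ab(2) ai] nzY by simp
      have row: "\<forall>c<m. Z $$ (a, c) \<noteq> 0 \<longrightarrow> c = b" and col: "\<forall>d<m. Z $$ (b, d) \<noteq> 0 \<longrightarrow> d = a"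
        using cl Zab a ab unfolding cleared_def by blast+
      have bi: "Z $$ (b, i) = 0" using col i a by force
      show ?thesis using row col Yk[OF _ a(2) _ ai] Yk[OF _ ab(2) _ bi] by metis
    qed
  qed
  then show ?thesis using g by (auto simp: Y_def)
qed

text \<open>The pivots p at (i, b) and q at (b, i) have to clear two rows and two columns
  simultaneously: multiples of line b clear row i, multiples of line i clear row b.\<close>

lemma clear_off_diagonal:
  fixes Z :: "'a::field mat"
  assumes ep: "ep = 1 \<or> ep = -1" and two: "(2::'a) \<noteq> 0"
    and Z: "Z \<in> forms m ep" and cl: "cleared m i Z" and ib: "i < b" "b < m"
    and nz: "Z $$ (i, b) \<noteq> 0" and least: "\<And>l. l < b \<Longrightarrow> Z $$ (i, l) = 0"
  shows "\<exists>g \<in> unitriangular m. cleared m (Suc i) (coact m Z g)"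
proof -
  note ZD = formsD[OF Z]
  have i: "i < m" using ib by simp
  have zsym: "Z $$ (k, l) = 0 \<longleftrightarrow> Z $$ (l, k) = 0" if "k < m" "l < m" for k l
    using ZD(2)[OF that] ZD(2)[OF that(2,1)] by auto
  define p where "p = Z $$ (i, b)"
  define q where "q = Z $$ (b, i)"
  have pq: "p \<noteq> 0" "q = ep * p" using nz ZD(2)[OF i ib(2)] by (auto simp: p_def q_def)
  have q0: "q \<noteq> 0" using pq ep by auto
  have ii: "Z $$ (i, i) = 0" using least ib by simp
  define c where "c l = (if l = b then 0 else Z $$ (i, l) / p)" for l
  \<comment> \<open>The entry (b, b) is hit by the row and by the column operation, hence the factor
    1/2 for l = b. For l = i nothing is subtracted, because q itself is to stay. Otherwise d cancels
    what the subtraction of line b has left in row b.\<close>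
  define d where "d l = (if l = b then Z $$ (b, b) / (2 * q)
    else if l = i then 0 else (Z $$ (b, l) - c l * Z $$ (b, b)) / q)" for l
  \<comment> \<open>Needed for d to be supported to the right of i. A nonzero entry here would make
    b the partner of the finished row l, but row b already meets row i.\<close>
  have row_below: "Z $$ (b, l) = 0" if "l < i" for l
  proof (rule ccontr)
    assume "Z $$ (b, l) \<noteq> 0"
    then have "Z $$ (l, b) \<noteq> 0" using zsym[of b l] that i ib by auto
    then have "i = l" using cl that ib i q0 unfolding cleared_def q_def by blast
    then show False using that by simp
  qed
  let ?g = "shear m i b c d"
  have c0: "c l = 0" if "l \<le> b" for l using that least by (auto simp: c_def)
  have g: "?g \<in> unitriangular m"
    using c0 row_below ib by (intro shear_unitriangular) (auto simp: d_def)
  define Y where "Y = coact m Z ?g"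
  define W where "W r l = Z $$ (r, l) - c l * Z $$ (r, b) - d l * Z $$ (r, i)" for r l
  have Y: "Y $$ (k, l) = W k l - c k * W b l - d k * W i l"
    if "Y $$ (k, l) \<noteq> 0" "k < m" "l < m" for k l
  proof -
    have "k + l + 1 < m" using that by (auto simp: Y_def coact_def split: if_splits)
    then show ?thesis unfolding Y_def W_def using i ib by (subst coact_shear[OF ZD(1)]) auto
  qed
  have Wi: "W i l = (if l = b then p else 0)" for l
    using pq ii by (simp add: W_def c_def p_def)
  have Yi: "l = b" if "Y $$ (i, l) \<noteq> 0" "l < m" for l
    using Y[OF that(1) i that(2)] that(1) Wi[of l] c0[of i] ib by (auto simp: d_def split: if_splits)
  have Wb: "W b l = 0" if "l \<noteq> b" "l \<noteq> i" for l
    using that q0 by (simp add: W_def d_def flip: q_def)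
  have Yb: "l = i" if nzl: "Y $$ (b, l) \<noteq> 0" "l < m" for l
  proof (rule ccontr)
    assume l: "l \<noteq> i"
    have eq: "Y $$ (b, l) = W b l - d b * W i l" using Y[OF nzl(1) ib(2) nzl(2)] c0[of b] by simp
    show False
    proof (cases "l = b")
      case False
      then show False using eq nzl Wi[of l] Wb[of l] l by simp
    next
      case True
      have zb: "(1 - ep) * Z $$ (b, b) = 0"
        using ZD(2)[OF ib(2) ib(2)] by (simp add: algebra_simps)
      have "W b b = Z $$ (b, b) - Z $$ (b, b) / (2 * q) * q"
        using c0[of b] by (simp add: W_def d_def q_def)
      then have "Y $$ (b, l) = Z $$ (b, b) - Z $$ (b, b) / (2 * q) * q - Z $$ (b, b) / (2 * q) * p"
        using eq Wi[of l] True by (simp add: d_def)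
      also have "\<dots> = 0"
        using ep zb pq two q0 by (auto simp: field_simps)
      finally show False using nzl by simp
    qed
  qed
  have Yk: "Y $$ (k, l) = Z $$ (k, l)"
    if "Y $$ (k, l) \<noteq> 0" "k < m" "l < m" "Z $$ (k, i) = 0" "Z $$ (k, b) = 0" for k l
  proof -
    have "k \<noteq> b" "k \<noteq> i" using that q0 pq(1) by (auto simp: q_def p_def)
    then have "c k = 0" "d k = 0"
      using that zsym[of k i] zsym[of k b] i ib by (auto simp: c_def d_def)
    then show ?thesis using Y[OF that(1-3)] that(4,5) by (simp add: W_def)
  qed
  have "cleared m (Suc i) Y"
    unfolding cleared_def
  proof (intro allI impI)
    fix a x assume ax: "a < Suc i" "x < m" and nzY: "Y $$ (a, x) \<noteq> 0"
    show "(\<forall>c<m. Y $$ (a, c) \<noteq> 0 \<longrightarrow> c = x) \<and> (\<forall>d<m. Y $$ (x, d) \<noteq> 0 \<longrightarrow> d = a)"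
    proof (cases "a = i")
      case True
      then have "x = b" using Yi nzY ax by simp
      then show ?thesis using True Yi Yb by auto
    next
      case False
      then have a: "a < i" "a < m" using ax i by auto
      then have ai: "Z $$ (a, i) = 0" using least zsym[of a i] i ib by auto
      have ab: "Z $$ (a, b) = 0" using row_below a zsym[of a b] ib by auto
      have Zax: "Z $$ (a, x) \<noteq> 0" using Yk[OF nzY a(2) ax(2) ai ab] nzY by simp
      have row: "\<forall>c<m. Z $$ (a, c) \<noteq> 0 \<longrightarrow> c = x" and col: "\<forall>d<m. Z $$ (x, d) \<noteq> 0 \<longrightarrow> d = a"
        using cl Zax a ax unfolding cleared_def by blast+
      have xi: "Z $$ (x, i) = 0" and xb: "Z $$ (x, b) = 0" using col i a ib by (metis less_irrefl, metis less_asym)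
      show ?thesis using row col Yk[OF _ a(2) _ ai ab] Yk[OF _ ax(2) _ xi xb] by metis
    qed
  qed
  then show ?thesis using g by (auto simp: Y_def)
qed

lemma clear_step:
  fixes Z :: "'a::field mat"
  assumes ep: "ep = 1 \<or> ep = -1" and two: "(2::'a) \<noteq> 0"
    and Z: "Z \<in> forms m ep" and cl: "cleared m i Z" and i: "i < m"
  shows "\<exists>g \<in> unitriangular m. cleared m (Suc i) (coact m Z g)"
proof -
  have triv: ?thesis if "cleared m (Suc i) Z"
    using that one_unitriangular coact_one[OF Z] by metis
  show ?thesis
  proof (cases "\<exists>b<m. Z $$ (i, b) \<noteq> 0")
    case False
    then have "cleared m (Suc i) Z" using cl by (auto simp: cleared_def less_Suc_eq)
    then show ?thesis by (rule triv)
  next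
    case True
    define b where "b = (LEAST b. b < m \<and> Z $$ (i, b) \<noteq> 0)"
    have b: "b < m" "Z $$ (i, b) \<noteq> 0" using LeastI_ex[OF True] by (auto simp: b_def)
    have least: "Z $$ (i, l) = 0" if "l < b" for l
      using not_less_Least[of l "\<lambda>b. b < m \<and> Z $$ (i, b) \<noteq> 0"] that b(1) by (auto simp: b_def)
    consider "b < i" | "b = i" | "i < b" by linarith
    then show ?thesis
    proof cases
      \<comment> \<open>Row i is the partner of a finished row, so the invariant already covers
        it.\<close>
      case 1
      have "Z $$ (b, i) \<noteq> 0" using formsD(2)[OF Z b(1) i] b(2) by auto
      then have "\<forall>c<m. Z $$ (b, c) \<noteq> 0 \<longrightarrow> c = i" "\<forall>d<m. Z $$ (i, d) \<noteq> 0 \<longrightarrow> d = b"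
        using cl 1 i unfolding cleared_def by blast+
      then have "cleared m (Suc i) Z" using cl b unfolding cleared_def less_Suc_eq by metis
      then show ?thesis by (rule triv)
    next
      case 2
      then show ?thesis using clear_diagonal[OF Z cl i] b least by auto
    next
      case 3
      then show ?thesis using clear_off_diagonal[OF ep two Z cl _ b(1) b(2) least] by blast
    qed
  qed
qed

text \<open>An entry (a, b) of the second product depends only on entries (c, d) with c \<le> a and
  d \<le> b. These lie in the region whenever (a, b) does, so the intermediate truncation goes
  unnoticed.\<close>

lemma coact_mult_eq:
  fixes Z :: "'a::field mat"
  assumes g: "g \<in> unitriangular m" and h: "h \<in> unitriangular m" and Z: "Z \<in> forms m ep"
  shows "coact m (coact m Z g) h = coact m Z (g * h)"
proof (rule eq_matI)
  note gD = unitriangularD[OF g] and hD = unitriangularD[OF h] and ZD = formsD[OF Z]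
  fix a b assume "a < dim_row (coact m Z (g * h))" "b < dim_col (coact m Z (g * h))"
  then have ab: "a < m" "b < m" by (auto simp: coact_def)
  let ?M = "transpose_mat g * Z * g"
  have M: "?M \<in> carrier_mat m m" using gD(1) ZD(1) by auto
  have eq: "transpose_mat (g * h) * Z * (g * h) = transpose_mat h * ?M * h"
    using gD(1) hD(1) ZD(1) by (simp add: transpose_mult assoc_mult_mat[of _ m m _ m _ m])
  show "coact m (coact m Z g) h $$ (a, b) = coact m Z (g * h) $$ (a, b)"
  proof (cases "a + b + 1 < m")
    case True
    have entry: "(transpose_mat h * N * h) $$ (a, b) = (\<Sum>c<m. \<Sum>d<m. h $$ (c, a) * N $$ (c, d) * h $$ (d, b))"
      if "N \<in> carrier_mat m m" for N
      using index_coact[OF hD(1) that ab] True ab by (simp add: coact_def)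
    have "coact m (coact m Z g) h $$ (a, b) =
        (\<Sum>c<m. \<Sum>d<m. h $$ (c, a) * coact m Z g $$ (c, d) * h $$ (d, b))"
      using index_coact[OF hD(1) _ ab, of "coact m Z g"] True by (simp add: coact_def)
    also have "\<dots> = (\<Sum>c<m. \<Sum>d<m. h $$ (c, a) * ?M $$ (c, d) * h $$ (d, b))"
    proof (intro sum.cong refl)
      fix c d assume "c \<in> {..<m}" "d \<in> {..<m}"
      then show "h $$ (c, a) * coact m Z g $$ (c, d) * h $$ (d, b) = h $$ (c, a) * ?M $$ (c, d) * h $$ (d, b)"
        using hD(3)[of a c] hD(3)[of b d] True by (cases "a < c"; cases "b < d") (auto simp: coact_def)
    qed
    also have "\<dots> = coact m Z (g * h) $$ (a, b)"
      using True ab by (simp add: coact_def eq entry[OF M])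
    finally show ?thesis .
  qed (use ab in \<open>simp add: coact_def\<close>)
qed (simp_all add: coact_def)

lemma normal_form_exists:
  fixes Z :: "'a::field mat"
  assumes ep: "ep = 1 \<or> ep = -1" and two: "(2::'a) \<noteq> 0" and Z: "Z \<in> forms m ep"
  shows "\<exists>g \<in> unitriangular m. normal_form m (coact m Z g)"
proof -
  have "i \<le> m \<Longrightarrow> \<exists>g \<in> unitriangular m. cleared m i (coact m Z g)" for i
  proof (induction i)
    case 0
    show ?case using one_unitriangular by (auto simp: cleared_def)
  next
    case (Suc i)
    then obtain g where g: "g \<in> unitriangular m" "cleared m i (coact m Z g)" by auto
    obtain h where h: "h \<in> unitriangular m" "cleared m (Suc i) (coact m (coact m Z g) h)"
      using clear_step[OF ep two coact_forms[OF g(1) Z] g(2)] Suc.prems by auto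
    then show ?case
      using coact_mult_eq[OF g(1) h(1) Z] unitriangular_mult[OF g(1) h(1)] by auto
  qed
  then obtain g where "g \<in> unitriangular m" "cleared m m (coact m Z g)" by auto
  then show ?thesis unfolding cleared_def normal_form_def by blast
qed

section \<open>Additive characters of the space of forms\<close>

locale add_char =
  fixes th :: "'a::{field,finite} \<Rightarrow> complex"
  assumes nontrivial_linear_char: "nontrivial_linear_char th"
begin

lemma th_add: "th (a + b) = th a * th b"
  and th_nonzero: "th a \<noteq> 0"
  and th_nontrivial: "\<exists>a. th a \<noteq> 1"
  using nontrivial_linear_char by (auto simp: nontrivial_linear_char_def)

lemma th_zero: "th 0 = 1"
  using th_add[of 0 0] th_nonzero[of 0] by simp

lemma th_of_nat_mult: "th (of_nat k * a) = th a ^ k"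
  by (induction k) (simp_all add: th_zero th_add distrib_right)

text \<open>The powers of \<open>th a\<close> are values of \<open>th\<close> at multiples of a, so
  there are finitely many; two powers of the positive number \<open>norm (th a)\<close>
  coincide.\<close>

lemma norm_th: "norm (th a) = 1"
proof -
  have fin: "finite (range (\<lambda>k::nat. norm (th a) ^ k))"
    by (rule finite_subset[of _ "range (\<lambda>b. norm (th b))"])
      (auto simp: norm_power[symmetric] th_of_nat_mult[symmetric])
  then obtain i j :: nat where ij: "i < j" "norm (th a) ^ i = norm (th a) ^ j"
  proof -
    have "\<not> inj (\<lambda>k::nat. norm (th a) ^ k)" using fin finite_imageD infinite_UNIV_nat by blast
    then obtain i j :: nat where "i \<noteq> j" "norm (th a) ^ i = norm (th a) ^ j" unfolding inj_def by auto
    then show ?thesis using that by (metis nat_neq_iff)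
  qed
  have "0 < norm (th a)" using th_nonzero by simp
  then have "norm (th a) ^ (j - i) = 1"
    using ij by (simp add: power_diff)
  then show ?thesis using ij \<open>0 < norm (th a)\<close>
    by (metis abs_of_pos gr_implies_not0 power_eq_1_iff real_norm_def zero_less_diff)
qed

lemma cnj_th: "cnj (th a) = th (- a)"
proof -
  have "th a * cnj (th a) = th a * th (- a)"
    using complex_norm_square[of "th a"] norm_th[of a] th_add[of a "- a"] by (simp add: th_zero)
  then show ?thesis using th_nonzero by simp
qed

end

text \<open>For a = b and \<open>ep = 1\<close> the diagonal entry is 2 t. With this convention the
  pairing with X is 2 t times entry (a, b) of X, on the diagonal as well as off it.\<close>

definition unit_form :: "nat \<Rightarrow> 'a::field \<Rightarrow> nat \<Rightarrow> nat \<Rightarrow> 'a \<Rightarrow> 'a mat" where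
  "unit_form m ep a b t = mat m m (\<lambda>(c, d).
     (if c = a \<and> d = b then t else 0) + ep * (if c = b \<and> d = a then t else 0))"

lemma unit_form_forms:
  assumes "ep * ep = 1" "a + b + 1 < m"
  shows "unit_form m ep a b t \<in> forms m ep"
proof (rule formsI)
  fix c d assume cd: "c < m" "d < m"
  have "ep * (ep * x) = x" for x using assms(1) by (simp add: mult.assoc[symmetric])
  then show "unit_form m ep a b t $$ (d, c) = ep * unit_form m ep a b t $$ (c, d)"
    using cd by (simp add: unit_form_def distrib_left add.commute conj_commute)
  show "unit_form m ep a b t $$ (c, d) = 0" if "m \<le> c + d + 1"
    using that assms(2) cd by (auto simp: unit_form_def)
qed (simp add: unit_form_def)

lemma pairing_unit_form:
  assumes ep: "ep * ep = 1" and X: "X \<in> forms m ep" and ab: "a < m" "b < m"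
  shows "pairing m (unit_form m ep a b t) X = 2 * t * X $$ (a, b)"
proof -
  have dlt: "(\<Sum>c<m. \<Sum>d<m. (if c = a \<and> d = b then t else 0) * X $$ (c, d)) = t * X $$ (a, b)"
    if "a < m" "b < m" for a b
  proof -
    have "(\<Sum>c<m. \<Sum>d<m. (if c = a \<and> d = b then t else 0) * X $$ (c, d)) =
      (\<Sum>c<m. \<Sum>d<m. if d = b then if c = a then t * X $$ (a, b) else 0 else 0)"
      by (intro sum.cong refl) simp
    also have "\<dots> = (\<Sum>c<m. if c = a then t * X $$ (a, b) else 0)"
      using that by (intro sum.cong refl) simp
    finally show ?thesis using that by simp
  qed
  have "pairing m (unit_form m ep a b t) X =
     (\<Sum>c<m. \<Sum>d<m. (if c = a \<and> d = b then t else 0) * X $$ (c, d)) +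
     ep * (\<Sum>c<m. \<Sum>d<m. (if c = b \<and> d = a then t else 0) * X $$ (c, d))"
    unfolding pairing_def sum_distrib_left sum.distrib[symmetric]
    by (intro sum.cong refl) (simp add: unit_form_def distrib_right mult.assoc)
  also have "\<dots> = t * X $$ (a, b) + ep * (t * X $$ (b, a))"
    unfolding dlt[OF ab] dlt[OF ab(2,1)] ..
  also have "\<dots> = 2 * t * X $$ (a, b)"
  proof -
    have "ep * X $$ (b, a) = X $$ (a, b)"
      by (subst formsD(2)[OF X ab]) (simp only: mult.assoc[symmetric] ep mult_1_left)
    then have "ep * (t * X $$ (b, a)) = t * X $$ (a, b)"
      using mult.left_commute[of ep t "X $$ (b, a)"] by simp
    then show ?thesis by (simp only: mult_2 distrib_right)
  qed
  finally show ?thesis .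
qed

section \<open>The pairing and the orbits of functionals\<close>

lemma pairing_commute: "pairing m Z X = pairing m X Z"
  by (simp add: pairing_def mult.commute)

lemma pairing_add:
  assumes "X \<in> carrier_mat m m" "Y \<in> carrier_mat m m"
  shows "pairing m Z (X + Y) = pairing m Z X + pairing m Z Y"
  using assms by (simp add: pairing_def distrib_left sum.distrib)

lemma pairing_diff_left:
  assumes "X \<in> carrier_mat m m" "Y \<in> carrier_mat m m"
  shows "pairing m (X - Y) Z = pairing m X Z - pairing m Y Z"
  using assms by (simp add: pairing_def left_diff_distrib sum_subtractf)

definition orbit :: "nat \<Rightarrow> 'a::field mat \<Rightarrow> 'a mat set" where
  "orbit m Z = coact m Z ` unitriangular m"

lemma orbit_forms: "Z \<in> forms m ep \<Longrightarrow> orbit m Z \<subseteq> forms m ep"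
  by (auto simp: orbit_def coact_forms)

lemma orbit_self: "Z \<in> forms m ep \<Longrightarrow> Z \<in> orbit m Z"
  unfolding orbit_def using coact_one one_unitriangular by (metis imageI)

lemma orbit_eq:
  fixes Z :: "'a::{field,finite} mat"
  assumes Z: "Z \<in> forms m ep" and W: "W \<in> orbit m Z"
  shows "orbit m W = orbit m Z"
proof -
  have sub: "orbit m W \<subseteq> orbit m Z" if F: "Z \<in> forms m ep" and O: "W \<in> orbit m Z" for Z W :: "'a mat"
  proof
    fix V assume "V \<in> orbit m W"
    then obtain g h where gh: "g \<in> unitriangular m" "h \<in> unitriangular m" "V = coact m (coact m Z g) h"
      using O by (auto simp: orbit_def)
    then have "V = coact m Z (g * h)" using coact_mult_eq[OF gh(1,2) F] by simp
    then show "V \<in> orbit m Z" using unitriangular_mult[OF gh(1,2)] by (auto simp: orbit_def)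
  qed
  obtain g where g: "g \<in> unitriangular m" "W = coact m Z g" using W by (auto simp: orbit_def)
  obtain h where h: "h \<in> unitriangular m" "g * h = 1\<^sub>m m" using unitriangular_inverse[OF g(1)] by blast
  have "coact m W h = Z" using coact_mult_eq[OF g(1) h(1) Z] g(2) h(2) coact_one[OF Z] by simp
  then have "Z \<in> orbit m W" using h(1) by (auto simp: orbit_def)
  then show ?thesis using sub[OF Z W] sub[of W Z] W orbit_forms[OF Z] by blast
qed

text \<open>The fibres are the right cosets of the stabilizer of Z: right multiplication by any g
  that carries Z to W is the bijection.\<close>

lemma card_coact_fibre:
  fixes Z :: "'a::{field,finite} mat"
  assumes Z: "Z \<in> forms m ep" and W: "W \<in> orbit m Z"
  shows "card {g \<in> unitriangular m. coact m Z g = W} = card {g \<in> unitriangular m. coact m Z g = Z}"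
proof -
  obtain g where g: "g \<in> unitriangular m" "W = coact m Z g" using W by (auto simp: orbit_def)
  obtain h where h: "h \<in> unitriangular m" "g * h = 1\<^sub>m m" "h * g = 1\<^sub>m m"
    using unitriangular_inverse[OF g(1)] by blast
  have Wh: "coact m W h = Z" using coact_mult_eq[OF g(1) h(1) Z] g(2) h(2) coact_one[OF Z] by simp
  have c: "g \<in> carrier_mat m m" "h \<in> carrier_mat m m" using unitriangularD(1) g h by auto
  have "bij_betw (\<lambda>k. k * g) {k \<in> unitriangular m. coact m Z k = Z} {k \<in> unitriangular m. coact m Z k = W}"
  proof (rule bij_betwI[where g="\<lambda>k. k * h"])
    show "(\<lambda>k. k * g) \<in> {k \<in> unitriangular m. coact m Z k = Z} \<rightarrow> {k \<in> unitriangular m. coact m Z k = W}"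
      using g(2) by (auto simp: unitriangular_mult[OF _ g(1)] coact_mult_eq[OF _ g(1) Z, symmetric])
    show "(\<lambda>k. k * h) \<in> {k \<in> unitriangular m. coact m Z k = W} \<rightarrow> {k \<in> unitriangular m. coact m Z k = Z}"
      using Wh by (auto simp: unitriangular_mult[OF _ h(1)] coact_mult_eq[OF _ h(1) Z, symmetric])
    show "k * g * h = k" if "k \<in> {k \<in> unitriangular m. coact m Z k = Z}" for k
      using that c h(2) unitriangularD(1)[of k m] by (simp add: assoc_mult_mat[of _ m m _ m _ m])
    show "k * h * g = k" if "k \<in> {k \<in> unitriangular m. coact m Z k = W}" for k
      using that c h(3) unitriangularD(1)[of k m] by (simp add: assoc_mult_mat[of _ m m _ m _ m])
  qed
  then show ?thesis by (simp add: bij_betw_same_card)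
qed

lemma sum_over_orbit:
  fixes Z :: "'a::{field,finite} mat" and f :: "'a mat \<Rightarrow> complex"
  assumes Z: "Z \<in> forms m ep"
  shows "(\<Sum>g\<in>unitriangular m. f (coact m Z g)) / of_nat (card (unitriangular m :: 'a mat set)) =
    (\<Sum>W\<in>orbit m Z. f W) / of_nat (card (orbit m Z))"
proof -
  define k where "k = card {g \<in> unitriangular m. coact m Z g = Z}"
  have sum: "(\<Sum>g\<in>unitriangular m. f (coact m Z g)) = of_nat k * (\<Sum>W\<in>orbit m Z. f W)" for f :: "'a mat \<Rightarrow> complex"
  proof -
    have "(\<Sum>g\<in>unitriangular m. f (coact m Z g)) =
      (\<Sum>W\<in>coact m Z ` unitriangular m. \<Sum>g | g \<in> unitriangular m \<and> coact m Z g = W. f (coact m Z g))"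
      by (rule sum.image_gen[OF finite_unitriangular])
    also have "\<dots> = (\<Sum>W\<in>orbit m Z. of_nat k * f W)"
      unfolding orbit_def[symmetric]
      by (intro sum.cong refl) (simp add: k_def card_coact_fibre[OF Z, symmetric])
    finally show ?thesis by (simp add: sum_distrib_left)
  qed
  have "of_nat (card (unitriangular m :: 'a mat set)) = (of_nat k * of_nat (card (orbit m Z)) :: complex)"
    using sum[of "\<lambda>_. 1"] by simp
  moreover have "k \<noteq> 0"
    using finite_unitriangular[of m, where 'a='a] one_unitriangular[of m, where 'a='a] coact_one[OF Z]
    by (auto simp: k_def card_eq_0_iff)
  ultimately show ?thesis using sum[of f] by simp
qed

section \<open>Orthogonality relations and orbit averages\<close>

locale form_char = add_char th for th :: "'a::{field,finite} \<Rightarrow> complex" +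
  fixes m :: nat and ep :: 'a
  assumes ep: "ep = 1 \<or> ep = -1" and two: "(2::'a) \<noteq> 0"
begin

lemma ep_square: "ep * ep = 1"
  using ep by auto

text \<open>For Z \<noteq> 0, translating X by a suitable V multiplies the sum by a value of
  \<open>th\<close> different from 1.\<close>

lemma sum_th_pairing:
  assumes Z: "Z \<in> forms m ep"
  shows "(\<Sum>X\<in>forms m ep. th (pairing m Z X)) = (if Z = 0\<^sub>m m m then of_nat (card (forms m ep)) else 0)"
proof (cases "Z = 0\<^sub>m m m")
  case True
  then show ?thesis by (simp add: pairing_def th_zero)
next
  case False
  note ZD = formsD[OF Z]
  obtain a b where ab: "a < m" "b < m" "Z $$ (a, b) \<noteq> 0"
    using False ZD(1) by (metis (no_types, lifting) eq_matI carrier_matD index_zero_mat)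
  have reg: "a + b + 1 < m" using ZD(3)[OF ab(1,2)] ab(3) by force
  obtain s where s: "th s \<noteq> 1" using th_nontrivial by auto
  \<comment> \<open>The coefficient makes the pairing of Z with V equal to s; the 2 cancels the one
    in \<open>pairing_unit_form\<close>.\<close>
  define V where "V = unit_form m ep a b (s / (2 * Z $$ (a, b)))"
  have V: "V \<in> forms m ep" unfolding V_def by (rule unit_form_forms[OF ep_square reg])
  have pV: "pairing m Z V = s"
    unfolding V_def pairing_commute[of m Z] pairing_unit_form[OF ep_square Z ab(1,2)]
    using ab(3) two by simp
  have "(\<Sum>X\<in>forms m ep. th (pairing m Z X)) = (\<Sum>X\<in>forms m ep. th (pairing m Z (X + V)))"
  proof (rule sum.reindex_bij_witness[where i="\<lambda>X. X + V" and j="\<lambda>X. X - V"])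
    fix X assume X: "X \<in> forms m ep"
    show "X - V + V = X" "X + V - V = X"
      using formsD(1)[OF X] formsD(1)[OF V] by (auto intro!: eq_matI)
    then show "th (pairing m Z (X - V + V)) = th (pairing m Z X)" by simp
  qed (auto intro: add_forms minus_forms V)
  also have "\<dots> = (\<Sum>X\<in>forms m ep. th (pairing m Z X)) * th s"
    unfolding sum_distrib_right
    by (intro sum.cong refl) (simp add: pairing_add[OF formsD(1) formsD(1)[OF V]] pV th_add)
  finally show ?thesis using s False by simp
qed

definition avg_char :: "'a mat \<Rightarrow> 'a mat \<Rightarrow> complex" where
  "avg_char Z X = (\<Sum>g\<in>unitriangular m. th (pairing m Z (congr_act g X))) /
     of_nat (card (unitriangular m :: 'a mat set))"

lemma avg_char_orbit:
  assumes Z: "Z \<in> forms m ep" and X: "X \<in> forms m ep"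
  shows "avg_char Z X = (\<Sum>W\<in>orbit m Z. th (pairing m W X)) / of_nat (card (orbit m Z))"
  unfolding avg_char_def sum_over_orbit[OF Z, symmetric]
  by (intro arg_cong2[of _ _ _ _ "(/)"] sum.cong refl) (simp add: pairing_coact[OF _ Z X])

lemma finite_orbit: "finite (orbit m Z)" for Z :: "'a mat"
  by (simp add: orbit_def finite_unitriangular)

lemma card_orbit_pos: "Z \<in> forms m ep \<Longrightarrow> card (orbit m Z) \<noteq> 0"
  using orbit_self[of Z m ep] finite_orbit[of Z] by (auto simp: card_eq_0_iff)

text \<open>After both orbit averages are expanded, orthogonality leaves only the pairs W = V, one
  for each point of the orbit.\<close>

lemma avg_char_norm:
  assumes Z: "Z \<in> forms m ep"
  shows "(\<Sum>X\<in>forms m ep. avg_char Z X * cnj (avg_char Z X)) =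
    of_nat (card (forms m ep)) / of_nat (card (orbit m Z))"
proof -
  let ?O = "orbit m Z" and ?F = "forms m ep"
  have OF: "W \<in> ?F" if "W \<in> ?O" for W using that orbit_forms[OF Z] by auto
  have "(\<Sum>X\<in>?F. avg_char Z X * cnj (avg_char Z X)) =
     (\<Sum>X\<in>?F. \<Sum>W\<in>?O. \<Sum>V\<in>?O. th (pairing m (W - V) X)) / (of_nat (card ?O))\<^sup>2"
    unfolding sum_divide_distrib[of _ ?F]
  proof (intro sum.cong refl)
    fix X assume X: "X \<in> ?F"
    have "avg_char Z X * cnj (avg_char Z X) =
      (\<Sum>W\<in>?O. th (pairing m W X)) * (\<Sum>V\<in>?O. cnj (th (pairing m V X))) / (of_nat (card ?O))\<^sup>2"
      by (simp add: avg_char_orbit[OF Z X] power2_eq_square)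
    also have "(\<Sum>W\<in>?O. th (pairing m W X)) * (\<Sum>V\<in>?O. cnj (th (pairing m V X))) =
      (\<Sum>W\<in>?O. \<Sum>V\<in>?O. th (pairing m (W - V) X))"
      unfolding sum_product cnj_th th_add[symmetric]
      by (intro sum.cong refl) (simp add: pairing_diff_left[OF formsD(1)[OF OF] formsD(1)[OF OF]])
    finally show "avg_char Z X * cnj (avg_char Z X) =
      (\<Sum>W\<in>?O. \<Sum>V\<in>?O. th (pairing m (W - V) X)) / (of_nat (card ?O))\<^sup>2" .
  qed
  also have "(\<Sum>X\<in>?F. \<Sum>W\<in>?O. \<Sum>V\<in>?O. th (pairing m (W - V) X)) =
     (\<Sum>W\<in>?O. \<Sum>X\<in>?F. \<Sum>V\<in>?O. th (pairing m (W - V) X))"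
    by (rule sum.swap)
  also have "\<dots> = (\<Sum>W\<in>?O. \<Sum>V\<in>?O. \<Sum>X\<in>?F. th (pairing m (W - V) X))"
    by (intro sum.cong refl sum.swap)
  also have "\<dots> = (\<Sum>W\<in>?O. \<Sum>V\<in>?O. if V = W then of_nat (card ?F) else 0)"
  proof (intro sum.cong refl)
    fix W V assume "W \<in> ?O" "V \<in> ?O"
    then have WV: "W \<in> ?F" "V \<in> ?F" using OF by auto
    have "W - V = 0\<^sub>m m m \<longleftrightarrow> V = W"
    proof
      assume e: "W - V = 0\<^sub>m m m"
      have "(W - V) $$ (i, j) = 0" if "i < m" "j < m" for i j using that by (simp add: e)
      then show "V = W" using formsD(1)[OF WV(1)] formsD(1)[OF WV(2)] by (intro eq_matI) auto
    next
      assume "V = W" then show "W - V = 0\<^sub>m m m" using formsD(1)[OF WV(1)] by (intro eq_matI) auto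
    qed
    then show "(\<Sum>X\<in>?F. th (pairing m (W - V) X)) = (if V = W then of_nat (card ?F) else 0)"
      by (simp add: sum_th_pairing minus_forms WV)
  qed
  also have "\<dots> = of_nat (card ?O) * of_nat (card ?F)"
    by (simp add: finite_orbit)
  finally show ?thesis by (simp add: power2_eq_square card_orbit_pos[OF Z])
qed

lemma forms_partition:
  "(\<Union>Z\<in>{Z \<in> forms m ep. normal_form m Z}. orbit m Z) = forms m ep"
proof
  show "(\<Union>Z\<in>{Z \<in> forms m ep. normal_form m Z}. orbit m Z) \<subseteq> forms m ep"
    using orbit_forms by blast
  show "forms m ep \<subseteq> (\<Union>Z\<in>{Z \<in> forms m ep. normal_form m Z}. orbit m Z)"
  proof
    fix W assume W: "W \<in> forms m ep"
    obtain g where g: "g \<in> unitriangular m" "normal_form m (coact m W g)"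
      using normal_form_exists[OF ep two W] by auto
    have O: "coact m W g \<in> orbit m W" using g by (auto simp: orbit_def)
    then have "W \<in> orbit m (coact m W g)" using orbit_eq[OF W O] orbit_self[OF W] by simp
    then show "W \<in> (\<Union>Z\<in>{Z \<in> forms m ep. normal_form m Z}. orbit m Z)"
      using g coact_forms[OF g(1) W] by blast
  qed
qed

lemma orbits_disjoint:
  assumes "Z \<in> forms m ep" "normal_form m Z" "W \<in> forms m ep" "normal_form m W" "Z \<noteq> W"
  shows "orbit m Z \<inter> orbit m W = {}"
proof (rule ccontr)
  assume "orbit m Z \<inter> orbit m W \<noteq> {}"
  then have "orbit m Z = orbit m W" using orbit_eq assms(1,3) by blast
  then have "W \<in> orbit m Z" "Z \<in> orbit m W" using orbit_self assms(1,3) by blast+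
  then obtain g h where "g \<in> unitriangular m" "h \<in> unitriangular m" "W = coact m Z g" "Z = coact m W h"
    by (auto simp: orbit_def)
  then show False using normal_form_unique[of g m Z ep W h] assms by metis
qed

text \<open>The weight turns each average into a sum over its orbit. The orbits of normal forms
  partition the space of functionals, so the total is a full character sum, now over the functionals
  with X fixed.\<close>

lemma sum_avg_char:
  assumes X: "X \<in> forms m ep"
  shows "(\<Sum>Z | Z \<in> forms m ep \<and> normal_form m Z. of_nat (card (orbit m Z)) * avg_char Z X) =
    (if X = 0\<^sub>m m m then of_nat (card (forms m ep)) else 0)"
proof -
  let ?N = "{Z \<in> forms m ep. normal_form m Z}"
  have "(\<Sum>Z\<in>?N. of_nat (card (orbit m Z)) * avg_char Z X) = (\<Sum>Z\<in>?N. \<Sum>W\<in>orbit m Z. th (pairing m W X))"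
    by (intro sum.cong refl) (simp add: avg_char_orbit X card_orbit_pos)
  also have "\<dots> = (\<Sum>W\<in>(\<Union>Z\<in>?N. orbit m Z). th (pairing m W X))"
    by (rule sum.UNION_disjoint[symmetric])
      (use orbits_disjoint finite_forms[of m ep] in \<open>auto simp: finite_orbit\<close>)
  also have "\<dots> = (\<Sum>W\<in>forms m ep. th (pairing m X W))"
    unfolding forms_partition by (simp add: pairing_commute)
  finally show ?thesis using sum_th_pairing[OF X] by simp
qed

end

section \<open>The group as an isometry group\<close>

definition ref_sign :: "classical \<Rightarrow> nat \<Rightarrow> nat \<Rightarrow> 'a::field" where
  "ref_sign T n k = (if T = Sp \<and> n \<le> k then -1 else 1)"

definition ref_form :: "classical \<Rightarrow> nat \<Rightarrow> 'a::field mat" where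
  "ref_form T n = mat (mat_size T n) (mat_size T n)
     (\<lambda>(l, k). if l + k + 1 = mat_size T n then ref_sign T n k else 0)"

text \<open>The symmetry sign of the forms X = y F, opposite to that of F itself: F is skew in the
  symplectic case and symmetric in the orthogonal ones.\<close>

definition form_sign :: "classical \<Rightarrow> 'a::field" where
  "form_sign T = (if T = Sp then 1 else -1)"

text \<open>In the shape u F u^T = F, invariance prescribes the products of all pairs of rows of u
  with respect to F.\<close>

definition isometries :: "classical \<Rightarrow> nat \<Rightarrow> 'a::field mat set" where
  "isometries T n = {u \<in> unitriangular (mat_size T n). congr_act u (ref_form T n) = ref_form T n}"

lemma ref_form_carrier: "ref_form T n \<in> carrier_mat (mat_size T n) (mat_size T n)"
  by (simp add: ref_form_def)

lemma mid_cases: "mid T = 0 \<and> T \<noteq> O_odd \<or> mid T = 1 \<and> T = O_odd"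
  by (cases T) auto

text \<open>The last block is run through backwards, so that j and m - 1 - j are partners under the
  reference form.\<close>

lemma sum_three_parts:
  fixes f :: "nat \<Rightarrow> 'a::comm_monoid_add"
  shows "(\<Sum>l<mat_size T n. f l) =
    (\<Sum>j<n. f j) + (if T = O_odd then f n else 0) + (\<Sum>j<n. f (mat_size T n - 1 - j))"
proof -
  have hi: "(\<Sum>j<n. f (mat_size T n - 1 - j)) = (\<Sum>l\<in>{n + mid T..<mat_size T n}. f l)"
    by (rule sum.reindex_bij_witness[where i="\<lambda>l. mat_size T n - 1 - l" and j="\<lambda>j. mat_size T n - 1 - j"]) auto
  have md: "(if T = O_odd then f n else 0) = (\<Sum>l\<in>{n..<n + mid T}. f l)"
    using mid_cases[of T] by auto
  show ?thesis
    unfolding hi md unfolding lessThan_atLeast0 by (simp add: sum.atLeastLessThan_concat)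
qed

lemma ref_form_mult:
  assumes "u \<in> carrier_mat (mat_size T n) (mat_size T n)" "a < mat_size T n" "b < mat_size T n"
  shows "(u * ref_form T n) $$ (a, b) = u $$ (a, mat_size T n - 1 - b) * ref_sign T n b"
proof -
  let ?m = "mat_size T n"
  have "(u * ref_form T n) $$ (a, b) =
      (\<Sum>l<?m. if l = ?m - 1 - b then u $$ (a, ?m - 1 - b) * ref_sign T n b else 0)"
    unfolding index_mult_mat_sum[OF assms(1) ref_form_carrier assms(2,3)]
    using assms(3) by (intro sum.cong refl) (auto simp: ref_form_def)
  then show ?thesis using assms(3) by simp
qed

lemma congr_ref_form:
  assumes "u \<in> carrier_mat (mat_size T n) (mat_size T n)" "a < mat_size T n" "b < mat_size T n"
  shows "congr_act u (ref_form T n) $$ (a, b) =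
    (\<Sum>l<mat_size T n. ref_sign T n (mat_size T n - 1 - l) * u $$ (a, l) * u $$ (b, mat_size T n - 1 - l))"
proof -
  let ?m = "mat_size T n"
  have "congr_act u (ref_form T n) $$ (a, b) = (\<Sum>k<?m. (u * ref_form T n) $$ (a, k) * u $$ (b, k))"
    using assms mult_carrier_mat[OF assms(1) ref_form_carrier] by (subst index_mult_mat_sum[of _ ?m ?m _ ?m]) auto
  also have "\<dots> = (\<Sum>k<?m. u $$ (a, ?m - 1 - k) * ref_sign T n k * u $$ (b, k))"
    using assms by (intro sum.cong refl) (simp add: ref_form_mult)
  also have "\<dots> = (\<Sum>l<?m. ref_sign T n (?m - 1 - l) * u $$ (a, l) * u $$ (b, ?m - 1 - l))"
    by (rule sum.reindex_bij_witness[where i="\<lambda>l. ?m - 1 - l" and j="\<lambda>l. ?m - 1 - l"]) auto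
  finally show ?thesis .
qed

lemma ref_sign_square: "ref_sign T n k * ref_sign T n k = 1"
  by (simp add: ref_sign_def)

lemma ref_sign_reverse:
  "k < mat_size T n \<Longrightarrow> ref_sign T n (mat_size T n - 1 - k) = - form_sign T * ref_sign T n k"
  using mid_cases[of T] by (auto simp: ref_sign_def form_sign_def)

lemma congr_ref_form_sym:
  assumes "u \<in> carrier_mat (mat_size T n) (mat_size T n)" "a < mat_size T n" "b < mat_size T n"
  shows "congr_act u (ref_form T n) $$ (b, a) = - form_sign T * congr_act u (ref_form T n) $$ (a, b)"
proof -
  let ?m = "mat_size T n"
  have "congr_act u (ref_form T n) $$ (b, a) =
     (\<Sum>l<?m. ref_sign T n l * u $$ (b, ?m - 1 - l) * u $$ (a, l))"
    unfolding congr_ref_form[OF assms(1,3,2)]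
    by (rule sum.reindex_bij_witness[where i="\<lambda>l. ?m - 1 - l" and j="\<lambda>l. ?m - 1 - l"]) auto
  also have "\<dots> = (\<Sum>l<?m. - form_sign T * (ref_sign T n (?m - 1 - l) * u $$ (a, l) * u $$ (b, ?m - 1 - l)))"
  proof (intro sum.cong refl)
    fix l assume "l \<in> {..<?m}"
    then have r: "ref_sign T n (?m - 1 - l) = - form_sign T * (ref_sign T n l :: 'a)"
      using ref_sign_reverse by blast
    show "ref_sign T n l * u $$ (b, ?m - 1 - l) * u $$ (a, l) =
        - form_sign T * (ref_sign T n (?m - 1 - l) * u $$ (a, l) * u $$ (b, ?m - 1 - l))"
      unfolding r by (simp add: form_sign_def)
  qed
  finally show ?thesis unfolding congr_ref_form[OF assms(1-3)] sum_distrib_left .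
qed

text \<open>Both sides have the same symmetry, so entries on and above the diagonal suffice. This
  spares the products of lower rows with upper rows in the verifications below.\<close>

lemma congr_ref_form_eqI:
  fixes u :: "'a::field mat"
  assumes u: "u \<in> carrier_mat (mat_size T n) (mat_size T n)"
    and "\<And>a b. a \<le> b \<Longrightarrow> b < mat_size T n \<Longrightarrow>
      congr_act u (ref_form T n) $$ (a, b) = ref_form T n $$ (a, b)"
  shows "congr_act u (ref_form T n) = ref_form T n"
proof (rule eq_matI)
  fix a b assume "a < dim_row (ref_form T n :: 'a mat)" "b < dim_col (ref_form T n :: 'a mat)"
  then have ab: "a < mat_size T n" "b < mat_size T n" by (auto simp: ref_form_def)
  show "congr_act u (ref_form T n) $$ (a, b) = ref_form T n $$ (a, b)"
  proof (cases "a \<le> b")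
    case True then show ?thesis using assms(2) ab by blast
  next
    case False
    then have ba: "b \<le> a" by simp
    have "ref_form T n $$ (a, b) = - form_sign T * (ref_form T n $$ (b, a) :: 'a)"
    proof (cases "a + b + 1 = mat_size T n")
      case True
      then have "b = mat_size T n - 1 - a" by simp
      then show ?thesis using True ab ref_sign_reverse[OF ab(1), where 'a='a] by (simp add: ref_form_def)
    qed (use ab in \<open>simp add: ref_form_def add.commute\<close>)
    then show ?thesis
      using congr_ref_form_sym[OF u ab(2,1)] assms(2)[OF ba ab(1)] by simp
  qed
qed (use u in \<open>simp_all add: ref_form_def\<close>)

section \<open>Entries of the block matrices\<close>

lemma mult_antidiag:
  fixes M :: "'a::field mat"
  assumes "M \<in> carrier_mat k n" "a < k" "b < n"
  shows "(M * antidiag n) $$ (a, b) = M $$ (a, n - 1 - b)"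
proof -
  have "(M * antidiag n) $$ (a, b) = (\<Sum>l<n. if l = n - 1 - b then M $$ (a, n - 1 - b) else 0)"
    using assms by (subst index_mult_mat_sum[of _ k n _ n]) (auto simp: antidiag_def intro!: sum.cong simp del: sum.delta)
  then show ?thesis using assms(3) by simp
qed

lemma antidiag_mult:
  fixes M :: "'a::field mat"
  assumes "M \<in> carrier_mat n k" "a < n" "b < k"
  shows "(antidiag n * M) $$ (a, b) = M $$ (n - 1 - a, b)"
proof -
  have "(antidiag n * M) $$ (a, b) = (\<Sum>l<n. if l = n - 1 - a then M $$ (n - 1 - a, b) else 0)"
    using assms by (subst index_mult_mat_sum[of _ n n _ k]) (auto simp: antidiag_def intro!: sum.cong simp del: sum.delta)
  then show ?thesis using assms(2) by simp
qed

lemma antidiag_carrier: "antidiag n \<in> carrier_mat n n"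
  by (simp add: antidiag_def)

context
  fixes T :: classical and n :: nat and x y v w :: "'a::field mat"
  assumes x: "x \<in> carrier_mat n n" and y: "y \<in> carrier_mat n n"
    and v: "v \<in> carrier_mat n (mid T)" and w: "w \<in> carrier_mat n n"
begin

lemma block_elem_carrier: "block_elem T n x y v w \<in> carrier_mat (mat_size T n) (mat_size T n)"
proof -
  have "antidiag n * transpose_mat y * antidiag n \<in> carrier_mat n n"
    using y antidiag_carrier[of n, where 'a='a] by auto
  moreover have "four_block_mat x (x * v) (0\<^sub>m (mid T) n) (1\<^sub>m (mid T)) \<in> carrier_mat (n + mid T) (n + mid T)"
    using x by auto
  ultimately have "block_elem T n x y v w \<in> carrier_mat (n + mid T + n) (n + mid T + n)"
    unfolding block_elem_def by (rule four_block_carrier_mat[rotated])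
  then show ?thesis by (simp add: mult_2 add.commute add.left_commute)
qed

lemma block_elem_index:
  assumes ab: "a < mat_size T n" "b < mat_size T n"
  shows "block_elem T n x y v w $$ (a, b) =
    (if a < n then
       if b < n then x $$ (a, b)
       else if b < n + mid T then (x * v) $$ (a, b - n)
       else (x * w) $$ (a, b - n - mid T)
     else if a < n + mid T then
       if b < n then 0
       else if b < n + mid T then 1
       else - (v $$ (mat_size T n - 1 - b, 0))
     else if b < n + mid T then 0
     else y $$ (mat_size T n - 1 - b, mat_size T n - 1 - a))"
proof -
  let ?J = "antidiag n :: 'a mat"
  have J: "?J \<in> carrier_mat n n" by (rule antidiag_carrier)
  have lr: "(?J * transpose_mat y * ?J) $$ (i, j) = y $$ (n - 1 - j, n - 1 - i)" if "i < n" "j < n" for i j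
    using that y J by (subst mult_antidiag[of _ n]) (auto simp: antidiag_mult[of _ n n] simp del: index_mult_mat)
  have vt: "(transpose_mat v * ?J) $$ (i, j) = v $$ (n - 1 - j, i)" if "i < mid T" "j < n" for i j
    using that v J by (subst mult_antidiag[of _ "mid T"]) auto
  have dims: "dim_row x = n" "dim_col x = n" "dim_row v = n" "dim_col v = mid T" "dim_col w = n" "dim_row w = n"
    "dim_row ?J = n" "dim_col ?J = n"
    using x v w J by auto
  have mid1: "mid T = 1" if "n \<le> c" "c < n + mid T" for c using that mid_cases[of T] by auto
  show ?thesis
    using ab mid1[of a] mid1[of b] unfolding block_elem_def append_rows_def
    by (auto simp: dims lr vt mult_2 add.assoc simp del: index_mult_mat(1)) (cases "b < n + mid T"; auto)
qed

end

section \<open>Factorization into a block diagonal and a block unipotent matrix\<close>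

abbreviation block_diag :: "classical \<Rightarrow> nat \<Rightarrow> 'a::field mat \<Rightarrow> 'a mat \<Rightarrow> 'a mat" where
  "block_diag T n x y \<equiv> block_elem T n x y (0\<^sub>m n (mid T)) (0\<^sub>m n n)"

abbreviation block_unip :: "classical \<Rightarrow> nat \<Rightarrow> 'a::field mat \<Rightarrow> 'a mat \<Rightarrow> 'a mat" where
  "block_unip T n v w \<equiv> block_elem T n (1\<^sub>m n) (1\<^sub>m n) v w"

lemma block_diag_index:
  fixes x y :: "'a::field mat"
  assumes x: "x \<in> carrier_mat n n" and y: "y \<in> carrier_mat n n"
    and ij: "i < mat_size T n" "j < mat_size T n"
  shows "block_diag T n x y $$ (i, j) =
    (if i < n then if j < n then x $$ (i, j) else 0
     else if i < n + mid T then if j = i then 1 else 0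
     else if j < n + mid T then 0 else y $$ (mat_size T n - 1 - j, mat_size T n - 1 - i))"
proof -
  have z: "0\<^sub>m n (mid T) \<in> carrier_mat n (mid T)" "0\<^sub>m n n \<in> carrier_mat n n" by simp_all
  have xv: "(x * 0\<^sub>m n k) $$ (i, j) = 0" if "i < n" "j < k" for i j k
    using that x by simp
  have mid1: "mid T = 1" if "n \<le> c" "c < n + mid T" for c using that mid_cases[of T] by auto
  have "j - n - mid T < n" if "\<not> j < n + mid T" using that ij(2) by linarith
  then show ?thesis
    unfolding block_elem_index[OF x y z ij]
    using ij mid1[of i] mid1[of j] by (auto simp: xv simp del: index_mult_mat)
qed

lemma block_diag_mult:
  fixes x y :: "'a::field mat"
  assumes x: "x \<in> carrier_mat n n" and y: "y \<in> carrier_mat n n"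
    and M: "M \<in> carrier_mat (mat_size T n) (mat_size T n)"
    and ab: "a < mat_size T n" "b < mat_size T n"
  shows "(block_diag T n x y * M) $$ (a, b) =
    (if a < n then \<Sum>j<n. x $$ (a, j) * M $$ (j, b)
     else if a < n + mid T then M $$ (a, b)
     else \<Sum>j<n. y $$ (j, mat_size T n - 1 - a) * M $$ (mat_size T n - 1 - j, b))"
proof -
  let ?m = "mat_size T n" and ?D = "block_diag T n x y"
  have z: "0\<^sub>m n (mid T) \<in> carrier_mat n (mid T)" "0\<^sub>m n n \<in> carrier_mat n n" by simp_all
  have D: "?D \<in> carrier_mat ?m ?m" by (rule block_elem_carrier[OF x y z])
  have Dindex: "?D $$ (i, j) =
    (if i < n then if j < n then x $$ (i, j) else 0
     else if i < n + mid T then if j = i then 1 else 0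
     else if j < n + mid T then 0 else y $$ (?m - 1 - j, ?m - 1 - i))" if "i < ?m" "j < ?m" for i j
    by (rule block_diag_index[OF x y that])
  have h1: "(\<Sum>j<n. ?D $$ (a, j) * M $$ (j, b)) = (if a < n then \<Sum>j<n. x $$ (a, j) * M $$ (j, b) else 0)"
    using ab by (auto simp: Dindex intro!: sum.neutral)
  have h2: "(if T = O_odd then ?D $$ (a, n) * M $$ (n, b) else 0) =
      (if n \<le> a \<and> a < n + mid T then M $$ (a, b) else 0)"
  proof (cases "T = O_odd")
    case True
    then have "?D $$ (a, n) = (if a = n then 1 else 0)"
      using ab Dindex[of a n] by auto
    then show ?thesis using True by auto
  qed (use mid_cases[of T] in auto)
  have h3: "(\<Sum>j<n. ?D $$ (a, ?m - 1 - j) * M $$ (?m - 1 - j, b)) =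
      (if a < n + mid T then 0 else \<Sum>j<n. y $$ (j, ?m - 1 - a) * M $$ (?m - 1 - j, b))"
  proof -
    have "?D $$ (a, ?m - 1 - j) = (if a < n + mid T then 0 else y $$ (j, ?m - 1 - a))" if "j < n" for j
    proof -
      have "\<not> ?m - 1 - j < n + mid T" "?m - 1 - j < ?m" "?m - 1 - (?m - 1 - j) = j"
        using that by linarith+
      then show ?thesis using ab Dindex[of a "?m - 1 - j"] by auto
    qed
    then show ?thesis by (auto intro!: sum.neutral)
  qed
  show ?thesis
    unfolding index_mult_mat_sum[OF D M ab] sum_three_parts h1 h2 h3 by simp
qed

text \<open>The lower block contains the transpose of y, which reverses products; hence the
  condition on \<open>y' * y\<close>.\<close>

lemma block_diag_mult_block_diag:
  fixes x y x' y' :: "'a::field mat"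
  assumes x: "x \<in> carrier_mat n n" "x' \<in> carrier_mat n n" and y: "y \<in> carrier_mat n n" "y' \<in> carrier_mat n n"
    and inv: "x * x' = 1\<^sub>m n" "y' * y = 1\<^sub>m n"
  shows "block_diag T n x y * block_diag T n x' y' = 1\<^sub>m (mat_size T n)"
proof (rule eq_matI)
  let ?m = "mat_size T n"
  have z: "0\<^sub>m n (mid T) \<in> carrier_mat n (mid T)" "0\<^sub>m n n \<in> carrier_mat n n" by simp_all
  note D' = block_elem_carrier[OF x(2) y(2) z] and D = block_elem_carrier[OF x(1) y(1) z]
  show "dim_row (block_diag T n x y * block_diag T n x' y') = dim_row (1\<^sub>m ?m)"
    "dim_col (block_diag T n x y * block_diag T n x' y') = dim_col (1\<^sub>m ?m)"
    using D D' by auto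
  fix a b assume "a < dim_row (1\<^sub>m ?m)" "b < dim_col (1\<^sub>m ?m)"
  then have ab: "a < ?m" "b < ?m" by auto
  have D'index: "block_diag T n x' y' $$ (i, b) =
    (if i < n then if b < n then x' $$ (i, b) else 0
     else if i < n + mid T then if b = i then 1 else 0
     else if b < n + mid T then 0 else y' $$ (?m - 1 - b, ?m - 1 - i))" if "i < ?m" for i
    by (rule block_diag_index[OF x(2) y(2) that ab(2)])
  have e1: "(\<Sum>j<n. x $$ (i, j) * x' $$ (j, k)) = (if i = k then 1 else 0)" if "i < n" "k < n" for i k
    using that x inv(1) by (subst index_mult_mat_sum[symmetric, of _ n n _ n]) auto
  have e2: "(\<Sum>j<n. y $$ (j, k) * y' $$ (i, j)) = (if i = k then 1 else 0)" if "i < n" "k < n" for i k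
  proof -
    have "(\<Sum>j<n. y $$ (j, k) * y' $$ (i, j)) = (y' * y) $$ (i, k)"
      using that y by (subst index_mult_mat_sum[of _ n n _ n]) (auto simp: mult.commute)
    then show ?thesis using that inv(2) by simp
  qed
  have "(\<Sum>j<n. x $$ (a, j) * block_diag T n x' y' $$ (j, b)) = (if a = b then 1 else 0)" if "a < n"
    using that e1[of a b] ab by (cases "b < n") (auto simp: D'index)
  moreover have "(\<Sum>j<n. y $$ (j, ?m - 1 - a) * block_diag T n x' y' $$ (?m - 1 - j, b)) = (if a = b then 1 else 0)"
    if a: "\<not> a < n + mid T"
  proof -
    have "block_diag T n x' y' $$ (?m - 1 - j, b) = (if b < n + mid T then 0 else y' $$ (?m - 1 - b, j))" if "j < n" for j
    proof -
      have "\<not> ?m - 1 - j < n + mid T" "?m - 1 - j < ?m" "?m - 1 - (?m - 1 - j) = j"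
        using that by linarith+
      then show ?thesis using D'index[of "?m - 1 - j"] by auto
    qed
    then have "(\<Sum>j<n. y $$ (j, ?m - 1 - a) * block_diag T n x' y' $$ (?m - 1 - j, b)) =
      (if b < n + mid T then 0 else \<Sum>j<n. y $$ (j, ?m - 1 - a) * y' $$ (?m - 1 - b, j))"
      by (auto intro: sum.neutral)
    also have "\<dots> = (if a = b then 1 else 0)"
    proof (cases "b < n + mid T")
      case False
      have "?m - 1 - a < n" "?m - 1 - b < n" "?m - 1 - b = ?m - 1 - a \<longleftrightarrow> a = b"
        using a False ab by linarith+
      then show ?thesis using False e2 by simp
    qed (use a in auto)
    finally show ?thesis .
  qed
  ultimately show "(block_diag T n x y * block_diag T n x' y') $$ (a, b) = 1\<^sub>m ?m $$ (a, b)"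
    unfolding block_diag_mult[OF x(1) y(1) D' ab] using ab D'index[OF ab(1)] by auto
qed

text \<open>This is the reason for the products x v and x w in the first block row of the
  definition.\<close>

lemma block_elem_factor:
  fixes x y v w :: "'a::field mat"
  assumes x: "x \<in> carrier_mat n n" and y: "y \<in> carrier_mat n n"
    and v: "v \<in> carrier_mat n (mid T)" and w: "w \<in> carrier_mat n n"
  shows "block_diag T n x y * block_unip T n v w = block_elem T n x y v w"
proof (rule eq_matI)
  let ?m = "mat_size T n"
  have z: "0\<^sub>m n (mid T) \<in> carrier_mat n (mid T)" "0\<^sub>m n n \<in> carrier_mat n n" by simp_all
  have one: "1\<^sub>m n \<in> carrier_mat n n" by simp
  note D = block_elem_carrier[OF x y z] and N = block_elem_carrier[OF one one v w]
    and E = block_elem_carrier[OF x y v w]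
  show "dim_row (block_diag T n x y * block_unip T n v w) = dim_row (block_elem T n x y v w)"
    "dim_col (block_diag T n x y * block_unip T n v w) = dim_col (block_elem T n x y v w)"
    using D N E by auto
  fix a b assume "a < dim_row (block_elem T n x y v w)" "b < dim_col (block_elem T n x y v w)"
  then have ab: "a < ?m" "b < ?m" using E by auto
  note Nindex = block_elem_index[OF one one v w _ ab(2)]
  have row1: "(\<Sum>j<n. x $$ (a, j) * block_unip T n v w $$ (j, b)) = block_elem T n x y v w $$ (a, b)" if a: "a < n"
  proof -
    have "(\<Sum>j<n. x $$ (a, j) * block_unip T n v w $$ (j, b)) = (\<Sum>j<n. x $$ (a, j) *
      (if b < n then 1\<^sub>m n $$ (j, b) else if b < n + mid T then v $$ (j, b - n) else w $$ (j, b - n - mid T)))"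
      using ab v w by (intro sum.cong refl) (simp add: Nindex del: index_mult_mat(1) index_one_mat(1))
    also have "\<dots> = (if b < n then (x * 1\<^sub>m n) $$ (a, b) else if b < n + mid T then (x * v) $$ (a, b - n)
      else (x * w) $$ (a, b - n - mid T))"
      using a ab x v w by (auto simp: index_mult_mat_sum[of _ n n] index_mult_mat_sum[OF x one] simp del: index_mult_mat(1) index_one_mat(1) right_mult_one_mat right_mult_one_mat')
    finally show ?thesis using a x by (simp add: block_elem_index[OF x y v w ab] del: index_mult_mat(1))
  qed
  have row3: "(\<Sum>j<n. y $$ (j, ?m - 1 - a) * block_unip T n v w $$ (?m - 1 - j, b)) = block_elem T n x y v w $$ (a, b)"
    if a: "\<not> a < n + mid T"
  proof -
    have "block_unip T n v w $$ (?m - 1 - j, b) = (if j = ?m - 1 - b then 1 else 0)" if "j < n" for j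
    proof -
      have "\<not> ?m - 1 - j < n + mid T" "\<not> ?m - 1 - j < n" "?m - 1 - j < ?m" "?m - 1 - (?m - 1 - j) = j"
        using that by linarith+
      then show ?thesis using Nindex[of "?m - 1 - j"] that ab by auto
    qed
    then have "(\<Sum>j<n. y $$ (j, ?m - 1 - a) * block_unip T n v w $$ (?m - 1 - j, b)) =
      (\<Sum>j<n. if j = ?m - 1 - b then y $$ (?m - 1 - b, ?m - 1 - a) else 0)"
      by (intro sum.cong refl) auto
    also have "\<dots> = (if b < n + mid T then 0 else y $$ (?m - 1 - b, ?m - 1 - a))"
      using ab by auto
    finally show ?thesis using a by (simp add: block_elem_index[OF x y v w ab])
  qed
  show "(block_diag T n x y * block_unip T n v w) $$ (a, b) = block_elem T n x y v w $$ (a, b)"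
    unfolding block_diag_mult[OF x y N ab]
    using row1 row3 ab Nindex[OF ab(1)] block_elem_index[OF x y v w ab] by (auto simp del: index_mult_mat(1))
qed

text \<open>The essential products are those of a top row with a bottom row: up to sign they are
  entries of x y, the transposed and reversed copy of y being paired with x.\<close>

lemma congr_block_diag:
  fixes x y :: "'a::field mat"
  assumes x: "x \<in> carrier_mat n n" and y: "y \<in> carrier_mat n n" and xy: "x * y = 1\<^sub>m n"
  shows "congr_act (block_diag T n x y) (ref_form T n) = ref_form T n"
proof (rule congr_ref_form_eqI)
  let ?m = "mat_size T n"
  have z: "0\<^sub>m n (mid T) \<in> carrier_mat n (mid T)" "0\<^sub>m n n \<in> carrier_mat n n" by simp_all
  show D: "block_diag T n x y \<in> carrier_mat ?m ?m" by (rule block_elem_carrier[OF x y z])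
  fix a b assume le: "a \<le> b" and b: "b < ?m"
  have a: "a < ?m" using le b by simp
  have F: "(ref_form T n :: 'a mat) \<in> carrier_mat ?m ?m" by (rule ref_form_carrier)
  have Dindex: "block_diag T n x y $$ (i, j) =
    (if i < n then if j < n then x $$ (i, j) else 0
     else if i < n + mid T then if j = i then 1 else 0
     else if j < n + mid T then 0 else y $$ (?m - 1 - j, ?m - 1 - i))" if "i < ?m" "j < ?m" for i j
    by (rule block_diag_index[OF x y that])
  have FD: "(ref_form T n * transpose_mat (block_diag T n x y)) $$ (i, b) =
      ref_sign T n (?m - 1 - i) * block_diag T n x y $$ (b, ?m - 1 - i)" if i: "i < ?m" for i
  proof -
    have "(ref_form T n * transpose_mat (block_diag T n x y)) $$ (i, b) =
      (\<Sum>k<?m. if k = ?m - 1 - i then ref_sign T n (?m - 1 - i) * block_diag T n x y $$ (b, ?m - 1 - i) else 0)"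
      using i b D by (subst index_mult_mat_sum[OF F _ i b]) (auto simp: ref_form_def intro!: sum.cong simp del: sum.delta)
    then show ?thesis using i by simp
  qed
  have FDc: "ref_form T n * transpose_mat (block_diag T n x y) \<in> carrier_mat ?m ?m"
    using F D by auto
  have assoc: "congr_act (block_diag T n x y) (ref_form T n) =
      block_diag T n x y * (ref_form T n * transpose_mat (block_diag T n x y))"
    using F D by (simp add: assoc_mult_mat[of _ ?m ?m _ ?m _ ?m])
  show "congr_act (block_diag T n x y) (ref_form T n) $$ (a, b) = ref_form T n $$ (a, b)"
  proof -
    consider "a < n" | "n \<le> a" "a < n + mid T" | "n + mid T \<le> a" by linarith
    then show ?thesis
    proof cases
      case 1
      have "congr_act (block_diag T n x y) (ref_form T n) $$ (a, b) =
        (\<Sum>j<n. x $$ (a, j) * (ref_sign T n (?m - 1 - j) * block_diag T n x y $$ (b, ?m - 1 - j)))"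
        unfolding assoc block_diag_mult[OF x y FDc a b] using 1 by (simp add: FD)
      also have "\<dots> = (\<Sum>j<n. x $$ (a, j) * (if b < n + mid T then 0 else - form_sign T * y $$ (j, ?m - 1 - b)))"
      proof (intro sum.cong refl)
        fix j assume "j \<in> {..<n}"
        then have j: "j < n" "\<not> ?m - 1 - j < n + mid T" "\<not> ?m - 1 - j < n" "?m - 1 - j < ?m" "?m - 1 - (?m - 1 - j) = j"
          by auto
        have sg: "ref_sign T n (?m - 1 - j) = (- form_sign T :: 'a)"
          using j by (simp add: ref_sign_def form_sign_def)
        have "block_diag T n x y $$ (b, ?m - 1 - j) = (if b < n + mid T then 0 else y $$ (j, ?m - 1 - b))"
          using j Dindex[OF b j(4)] by auto
        then show "x $$ (a, j) * (ref_sign T n (?m - 1 - j) * block_diag T n x y $$ (b, ?m - 1 - j)) =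
          x $$ (a, j) * (if b < n + mid T then 0 else - form_sign T * y $$ (j, ?m - 1 - b))"
          unfolding sg by auto
      qed
      also have "\<dots> = (if b < n + mid T then 0 else - form_sign T * (x * y) $$ (a, ?m - 1 - b))"
      proof (cases "b < n + mid T")
        case False
        then have "?m - 1 - b < n" using b by auto
        then show ?thesis
          unfolding index_mult_mat_sum[OF x y 1 \<open>?m - 1 - b < n\<close>] sum_distrib_left
          using False by (simp add: mult.left_commute)
      qed simp
      also have "\<dots> = ref_form T n $$ (a, b)"
      proof (cases "b < n + mid T")
        case True
        then have "a + b + 1 \<noteq> ?m" using 1 by linarith
        then show ?thesis using True a b by (simp add: ref_form_def)
      next
        case False
        have sg: "ref_sign T n b = (- form_sign T :: 'a)"
          using False by (simp add: ref_sign_def form_sign_def)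
        have "?m - 1 - b < n" "a = ?m - 1 - b \<longleftrightarrow> a + b + 1 = ?m" using False b by linarith+
        then show ?thesis using False a b 1 unfolding xy by (simp add: ref_form_def sg)
      qed
      finally show ?thesis .
    next
      case 2
      then have T: "T = O_odd" "a = n" using mid_cases[of T] by auto
      have "congr_act (block_diag T n x y) (ref_form T n) $$ (a, b) =
          ref_sign T n (?m - 1 - a) * block_diag T n x y $$ (b, ?m - 1 - a)"
        unfolding assoc block_diag_mult[OF x y FDc a b] using 2 a by (simp add: FD)
      also have "?m - 1 - a = n" using T by simp
      finally show ?thesis using T a b le Dindex[of b n] by (auto simp: ref_form_def ref_sign_def)
    next
      case 3
      have "congr_act (block_diag T n x y) (ref_form T n) $$ (a, b) =
        (\<Sum>j<n. y $$ (j, ?m - 1 - a) * (ref_sign T n j * block_diag T n x y $$ (b, j)))"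
        unfolding assoc block_diag_mult[OF x y FDc a b] using 3
        by (simp add: FD)
      also have "\<dots> = 0"
      proof (intro sum.neutral ballI)
        fix j assume "j \<in> {..<n}"
        then have "block_diag T n x y $$ (b, j) = 0" using 3 le b Dindex[of b j] by simp
        then show "y $$ (j, ?m - 1 - a) * (ref_sign T n j * block_diag T n x y $$ (b, j)) = 0" by simp
      qed
      finally show ?thesis using 3 le a b by (simp add: ref_form_def)
    qed
  qed
qed

lemma w_condition_index:
  fixes v w :: "'a::field mat"
  assumes v: "v \<in> carrier_mat n (mid T)" and w: "w \<in> carrier_mat n n"
  shows "w_condition T n v w \<longleftrightarrow> (\<forall>a<n. \<forall>b<n.
    w $$ (a, n - 1 - b) - form_sign T * w $$ (b, n - 1 - a) +
      (if T = O_odd then v $$ (a, 0) * v $$ (b, 0) else 0) = 0)"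
proof -
  let ?J = "antidiag n :: 'a mat"
  have J: "?J \<in> carrier_mat n n" by (rule antidiag_carrier)
  have wJ: "(w * ?J) $$ (a, b) = w $$ (a, n - 1 - b)" if "a < n" "b < n" for a b
    using that w by (rule mult_antidiag[rotated])
  have Jw: "(?J * transpose_mat w) $$ (a, b) = w $$ (b, n - 1 - a)" if "a < n" "b < n" for a b
    using that w by (subst antidiag_mult[of _ n n]) auto
  have c: "?J * transpose_mat w \<in> carrier_mat n n" "w * ?J \<in> carrier_mat n n" using J w by auto
  have ext: "A = B \<longleftrightarrow> (\<forall>a<n. \<forall>b<n. A $$ (a, b) = B $$ (a, b))"
    if "A \<in> carrier_mat n n" "B \<in> carrier_mat n n" for A B :: "'a mat"
    using that by (auto intro!: eq_matI)
  show ?thesis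
  proof (cases T)
    case Sp
    have "w_condition T n v w \<longleftrightarrow> (\<forall>a<n. \<forall>b<n. w $$ (b, n - 1 - a) - w $$ (a, n - 1 - b) = 0)"
      using c w J Sp by (subst w_condition.simps(1)[folded Sp], subst ext) (auto simp: wJ Jw simp del: index_mult_mat(1))
    then show ?thesis using Sp by (auto simp: form_sign_def)
  next
    case O_even
    have "w_condition T n v w \<longleftrightarrow> (\<forall>a<n. \<forall>b<n. w $$ (b, n - 1 - a) + w $$ (a, n - 1 - b) = 0)"
      using c w J O_even by (subst w_condition.simps(2)[folded O_even], subst ext) (auto simp: wJ Jw simp del: index_mult_mat(1))
    then show ?thesis using O_even by (auto simp: form_sign_def add.commute)
  next
    case O_odd
    have vv: "(v * transpose_mat v) $$ (a, b) = v $$ (a, 0) * v $$ (b, 0)" if "a < n" "b < n" for a b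
      using that v O_odd by (subst index_mult_mat_sum[of _ n 1 _ n]) auto
    have vc: "v * transpose_mat v \<in> carrier_mat n n" using v by auto
    have "w_condition T n v w \<longleftrightarrow>
      (\<forall>a<n. \<forall>b<n. w $$ (b, n - 1 - a) + w $$ (a, n - 1 - b) = - (v $$ (a, 0) * v $$ (b, 0)))"
      using c vc w v J O_odd by (subst w_condition.simps(3)[folded O_odd], subst ext) (auto simp: wJ Jw vv simp del: index_mult_mat(1))
    then show ?thesis using O_odd by (auto simp: form_sign_def add.commute eq_neg_iff_add_eq_0)
  qed
qed

text \<open>Row a meets the first block only in column a, which contributes the first summand. Row
  b, being zero or a unit vector in the first block, picks at most one entry from the last block of
  row a.\<close>

lemma congr_identity_rows:
  fixes N :: "'a::field mat"
  assumes N: "N \<in> unitriangular (mat_size T n)"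
    and id: "\<And>a j. a < n \<Longrightarrow> j < n \<Longrightarrow> N $$ (a, j) = (if a = j then 1 else 0)"
    and a: "a < n" and b: "b < mat_size T n"
  shows "congr_act N (ref_form T n) $$ (a, b) =
    - form_sign T * N $$ (b, mat_size T n - 1 - a) +
    (if T = O_odd then N $$ (a, n) * N $$ (b, n) else 0) +
    (if b < n then N $$ (a, mat_size T n - 1 - b) else 0)"
proof -
  let ?m = "mat_size T n"
  note ND = unitriangularD[OF N]
  have "a < ?m" using a by simp
  have s1: "(\<Sum>j<n. ref_sign T n (?m - 1 - j) * N $$ (a, j) * N $$ (b, ?m - 1 - j)) =
      - form_sign T * N $$ (b, ?m - 1 - a)"
  proof -
    have "(\<Sum>j<n. ref_sign T n (?m - 1 - j) * N $$ (a, j) * N $$ (b, ?m - 1 - j)) =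
        (\<Sum>j<n. if j = a then - form_sign T * N $$ (b, ?m - 1 - a) else 0)"
      using a by (intro sum.cong refl) (auto simp: id ref_sign_def form_sign_def)
    then show ?thesis using a by simp
  qed
  have s2: "(\<Sum>j<n. ref_sign T n (?m - 1 - (?m - 1 - j)) * N $$ (a, ?m - 1 - j) * N $$ (b, ?m - 1 - (?m - 1 - j))) =
      (if b < n then N $$ (a, ?m - 1 - b) else 0)"
  proof -
    have "(\<Sum>j<n. ref_sign T n (?m - 1 - (?m - 1 - j)) * N $$ (a, ?m - 1 - j) * N $$ (b, ?m - 1 - (?m - 1 - j))) =
        (\<Sum>j<n. if j = b then N $$ (a, ?m - 1 - b) else 0)"
    proof (intro sum.cong refl)
      fix j assume "j \<in> {..<n}"
      then have j: "j < n" "?m - 1 - (?m - 1 - j) = j" by auto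
      have "N $$ (b, j) = (if j = b then 1 else 0)"
        using id[of b j] ND(3)[of j b] j b by (cases "b < n") auto
      then show "ref_sign T n (?m - 1 - (?m - 1 - j)) * N $$ (a, ?m - 1 - j) * N $$ (b, ?m - 1 - (?m - 1 - j)) =
        (if j = b then N $$ (a, ?m - 1 - b) else 0)"
        unfolding j(2) using j(1) by (auto simp: ref_sign_def)
    qed
    then show ?thesis by auto
  qed
  have s3: "ref_sign T n (?m - 1 - n) * N $$ (a, n) * N $$ (b, ?m - 1 - n) = N $$ (a, n) * N $$ (b, n)"
    if "T = O_odd" using that by (simp add: ref_sign_def)
  show ?thesis
    unfolding congr_ref_form[OF ND(1) \<open>a < ?m\<close> b] sum_three_parts s1 s2 using s3 by simp
qed

text \<open>Products of two top rows give exactly the condition on w. Products of a top row with a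
  middle or bottom row determine the last n columns of the lower rows, so an isometry with an
  identity corner has no freedom besides v and w.\<close>

lemma congr_block_unip:
  fixes v w :: "'a::field mat"
  assumes v: "v \<in> carrier_mat n (mid T)" and w: "w \<in> carrier_mat n n"
    and N: "N \<in> unitriangular (mat_size T n)"
    and id: "\<And>a j. a < n \<Longrightarrow> j < n \<Longrightarrow> N $$ (a, j) = (if a = j then 1 else 0)"
    and vN: "\<And>a. a < n \<Longrightarrow> T = O_odd \<Longrightarrow> N $$ (a, n) = v $$ (a, 0)"
    and wN: "\<And>a b. a < n \<Longrightarrow> b < n \<Longrightarrow> N $$ (a, mat_size T n - 1 - b) = w $$ (a, n - 1 - b)"
  shows "congr_act N (ref_form T n) = ref_form T n \<longleftrightarrow> N = block_unip T n v w \<and> w_condition T n v w"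
proof -
  let ?m = "mat_size T n"
  have one: "1\<^sub>m n \<in> carrier_mat n n" by simp
  have "mid T \<le> 1" using mid_cases[of T] by auto
  note ND = unitriangularD[OF N]
  note B = block_elem_carrier[OF one one v w]
  note Bi = block_elem_index[OF one one v w]
  define C where "C = congr_act N (ref_form T n)"
  have row: "C $$ (a, b) = - form_sign T * N $$ (b, ?m - 1 - a) +
    (if T = O_odd then N $$ (a, n) * N $$ (b, n) else 0) +
    (if b < n then N $$ (a, ?m - 1 - b) else 0)" if "a < n" "b < ?m" for a b
    unfolding C_def using that by (intro congr_identity_rows[OF N id])
  have F: "ref_form T n $$ (a, b) = (if a + b + 1 = ?m then ref_sign T n b else (0::'a))" if "a < ?m" "b < ?m" for a b
    using that by (simp add: ref_form_def)
  have top: "C $$ (a, b) = - form_sign T * w $$ (b, n - 1 - a) +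
      (if T = O_odd then v $$ (a, 0) * v $$ (b, 0) else 0) + w $$ (a, n - 1 - b)" if "a < n" "b < n" for a b
    using row[of a b] that vN wN by auto
  have wc: "(\<forall>a<n. \<forall>b<n. C $$ (a, b) = 0) \<longleftrightarrow> w_condition T n v w"
    unfolding w_condition_index[OF v w] by (auto simp: top algebra_simps)
  show ?thesis
  proof
    assume CF: "congr_act N (ref_form T n) = ref_form T n"
    then have CF': "C $$ (a, b) = ref_form T n $$ (a, b)" for a b by (simp add: C_def)
    have "\<forall>a<n. \<forall>b<n. C $$ (a, b) = 0"
      by (auto simp: CF' F)
    then have W: "w_condition T n v w" by (simp add: wc)
    \<comment> \<open>The product of the top row a with the bottom row b is, up to sign, this single
      entry.\<close>
    have low: "N $$ (b, ?m - 1 - a) = (if a + b + 1 = ?m then 1 else 0)"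
      if "a < n" "n + mid T \<le> b" "b < ?m" for a b
    proof -
      have sg: "ref_sign T n b = (- form_sign T :: 'a)"
        using that by (simp add: ref_sign_def form_sign_def)
      have "(if T = O_odd then N $$ (a, n) * N $$ (b, n) else 0) = 0"
        using ND(3)[of n b] that by auto
      then have "- form_sign T * N $$ (b, ?m - 1 - a) = (if a + b + 1 = ?m then - form_sign T else 0)"
        using row[of a b] that F[of a b] by (cases "a + b + 1 = ?m") (simp_all add: CF' sg)
      then show ?thesis by (auto simp: form_sign_def split: if_splits)
    qed
    have midrow: "N $$ (n, ?m - 1 - a) = - v $$ (a, 0)" if "a < n" "T = O_odd" for a
      using row[of a n] that F[of a n] ND(2)[of n] vN[of a] by (simp add: CF' form_sign_def eq_neg_iff_add_eq_0)
    have "N = block_unip T n v w"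
    proof (rule eq_matI)
      show "dim_row N = dim_row (block_unip T n v w)" "dim_col N = dim_col (block_unip T n v w)"
        using ND(1) B by auto
      fix a b assume "a < dim_row (block_unip T n v w)" "b < dim_col (block_unip T n v w)"
      then have ab: "a < ?m" "b < ?m" using B by auto
      consider "b \<le> a" "b < n + mid T" | "a < n" "b < n" | "a < n" "n \<le> b" "b < n + mid T" | "a < n" "n + mid T \<le> b"
        | "n \<le> a" "a < n + mid T" "n + mid T \<le> b" | "n + mid T \<le> a" "n + mid T \<le> b"
        using \<open>mid T \<le> 1\<close> by linarith
      then show "N $$ (a, b) = block_unip T n v w $$ (a, b)"
      proof cases
        case 1
        have eq: "a = b \<or> n \<le> a \<and> a \<noteq> b \<or> a < n \<and> b < n" using 1 by linarith
        have "\<not> (n \<le> a \<and> a < n + mid T \<and> n \<le> b \<and> b < a)" using mid_cases[of T] by auto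
        then show ?thesis
          using 1 eq ND(2)[of a] ND(3)[of b a] Bi[OF ab] ab v by (cases "a = b") auto
      next
        case 2 then show ?thesis using id[of a b] Bi[OF ab] by auto
      next
        case 3
        then have "T = O_odd" "b = n" using mid_cases[of T] by auto
        then show ?thesis using 3 vN[of a] Bi[OF ab] v by auto
      next
        case 4
        then have "N $$ (a, ?m - 1 - (?m - 1 - b)) = w $$ (a, n - 1 - (?m - 1 - b))"
          using ab by (intro wN) linarith+
        moreover have "?m - 1 - (?m - 1 - b) = b" "n - 1 - (?m - 1 - b) = b - n - mid T" "b - n - mid T < n"
          using 4 ab by linarith+
        ultimately show ?thesis using 4 Bi[OF ab] w by auto
      next
        case 5
        then have "T = O_odd" "a = n" using mid_cases[of T] by auto
        then show ?thesis using 5 midrow[of "?m - 1 - b"] Bi[OF ab] ab by auto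
      next
        case 6
        have "?m - 1 - b < n" "?m - 1 - a < n" "?m - 1 - (?m - 1 - b) = b"
          "?m - 1 - b + a + 1 = ?m \<longleftrightarrow> ?m - 1 - b = ?m - 1 - a"
          using 6 ab by linarith+
        then show ?thesis using 6 low[of "?m - 1 - b" a] Bi[OF ab] ab by auto
      qed
    qed
    with W show "N = block_unip T n v w \<and> w_condition T n v w" by simp
  next
    assume NB: "N = block_unip T n v w \<and> w_condition T n v w"
    then have C0: "C $$ (a, b) = 0" if "a < n" "b < n" for a b using that wc by blast
    have Nlow: "N $$ (b, ?m - 1 - a) = (if a + b + 1 = ?m then 1 else 0)"
      if "a < n" "n + mid T \<le> b" "b < ?m" for a b
    proof -
      have "?m - 1 - a < ?m" "\<not> ?m - 1 - a < n + mid T" "?m - 1 - (?m - 1 - a) = a" "?m - 1 - b < n"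
        "a = ?m - 1 - b \<longleftrightarrow> a + b + 1 = ?m"
        using that by linarith+
      then show ?thesis using NB Bi[of b "?m - 1 - a"] that by auto
    qed
    have Nmid: "N $$ (n, ?m - 1 - a) = - v $$ (a, 0)" if "a < n" "T = O_odd" for a
    proof -
      have "?m - 1 - a < ?m" "\<not> ?m - 1 - a < n + mid T" "?m - 1 - (?m - 1 - a) = a"
        using that by auto
      then show ?thesis using NB Bi[of n "?m - 1 - a"] that by auto
    qed
    show "congr_act N (ref_form T n) = ref_form T n"
    proof (rule congr_ref_form_eqI[OF ND(1)])
      fix a b assume le: "a \<le> b" and b: "b < ?m"
      have a: "a < ?m" using le b by simp
      consider "a < n" "b < n" | "a < n" "n \<le> b" "b < n + mid T" | "a < n" "n + mid T \<le> b"
        | "n \<le> a" by linarith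
      then have "C $$ (a, b) = ref_form T n $$ (a, b)"
      proof cases
        case 1 then show ?thesis using C0 F[OF a b] by auto
      next
        case 2
        then have T: "T = O_odd" "b = n" using mid_cases[of T] by auto
        then show ?thesis using row[of a b] 2 Nmid[of a] vN[of a] ND(2)[of n] F[OF a b] by (simp add: form_sign_def)
      next
        case 3
        have sg: "ref_sign T n b = (- form_sign T :: 'a)"
          using 3 by (simp add: ref_sign_def form_sign_def)
        have "(if T = O_odd then N $$ (a, n) * N $$ (b, n) else 0) = 0"
          using ND(3)[of n b] 3 b by auto
        then show ?thesis using row[of a b] 3 Nlow[of a b] F[OF a b] b by (simp add: sg)
      next
        case 4
        have "ref_sign T n (?m - 1 - l) * N $$ (a, l) * N $$ (b, ?m - 1 - l) =
            (if l = a \<and> a + b + 1 = ?m then ref_sign T n b else 0)" if l: "l < ?m" for l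
        proof -
          \<comment> \<open>For n \<le> a \<le> b, triangularity lets both factors survive only at
            the centre of the matrix, which exists only in odd dimension.\<close>
          consider "l < a" | "?m - 1 - l < b" | "l = a" "a = b" "?m - 1 - l = b" using l le b 4 mid_cases[of T] by fastforce
          then show ?thesis
          proof cases
            case 1 then show ?thesis using ND(3)[of l a] a by simp
          next
            case 2
            then have "\<not> (l = a \<and> a + b + 1 = ?m)" by auto
            then show ?thesis using ND(3)[OF 2 b] by auto
          next
            case 3
            then show ?thesis using ND(2)[OF a] b by auto
          qed
        qed
        then have "C $$ (a, b) = (\<Sum>l<?m. if l = a then (if a + b + 1 = ?m then ref_sign T n b else 0) else 0)"
          unfolding C_def congr_ref_form[OF ND(1) a b] by (intro sum.cong refl) auto
        then show ?thesis using F[OF a b] a by simp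
      qed
      then show "congr_act N (ref_form T n) $$ (a, b) = ref_form T n $$ (a, b)" by (simp add: C_def)
    qed
  qed
qed

section \<open>The isometry group and its identification with U\<close>

lemma one_isometries: "1\<^sub>m (mat_size T n) \<in> (isometries T n :: 'a::field mat set)"
  using ref_form_carrier[of T n, where 'a='a] by (simp add: isometries_def one_unitriangular)

lemma isometries_unitriangular: "u \<in> isometries T n \<Longrightarrow> u \<in> unitriangular (mat_size T n)"
  by (simp add: isometries_def)

lemma isometries_mult:
  fixes u v :: "'a::field mat"
  assumes "u \<in> isometries T n" "v \<in> isometries T n"
  shows "u * v \<in> isometries T n"
proof -
  have c: "u \<in> carrier_mat (mat_size T n) (mat_size T n)" "v \<in> carrier_mat (mat_size T n) (mat_size T n)"
    using assms by (auto simp: isometries_def unitriangularD(1))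
  show ?thesis
    using assms congr_act_mult[OF c ref_form_carrier] by (simp add: isometries_def unitriangular_mult)
qed

lemma isometries_inverse:
  fixes u :: "'a::{field,finite} mat"
  assumes u: "u \<in> isometries T n"
  obtains h where "h \<in> isometries T n" "u * h = 1\<^sub>m (mat_size T n)" "h * u = 1\<^sub>m (mat_size T n)"
proof -
  let ?m = "mat_size T n"
  have uu: "u \<in> unitriangular ?m" using u by (rule isometries_unitriangular)
  obtain h where h: "h \<in> unitriangular ?m" "u * h = 1\<^sub>m ?m" "h * u = 1\<^sub>m ?m"
    using unitriangular_inverse[OF uu] by blast
  have "congr_act h (ref_form T n) = congr_act h (congr_act u (ref_form T n))"
    using u by (simp add: isometries_def)
  also have "\<dots> = ref_form T n"
    using congr_act_mult[OF unitriangularD(1)[OF h(1)] unitriangularD(1)[OF uu] ref_form_carrier[of T n]]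
      congr_act_one[OF ref_form_carrier[of T n, where 'a='a]] unfolding h(3) by simp
  finally show thesis using that h by (simp add: isometries_def)
qed

lemma block_diag_unitriangular:
  fixes x y :: "'a::field mat"
  assumes x: "x \<in> unitriangular n" and y: "y \<in> unitriangular n"
  shows "block_diag T n x y \<in> unitriangular (mat_size T n)"
proof (rule unitriangularI)
  note xD = unitriangularD[OF x] and yD = unitriangularD[OF y]
  show "block_diag T n x y \<in> carrier_mat (mat_size T n) (mat_size T n)"
    by (rule block_elem_carrier[OF xD(1) yD(1)]) simp_all
  note index = block_diag_index[OF xD(1) yD(1)]
  fix a assume a: "a < mat_size T n"
  show "block_diag T n x y $$ (a, a) = 1"
    using a xD(2) yD(2)[of "mat_size T n - 1 - a"] by (auto simp: index)
  fix b assume ba: "b < a"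
  show "block_diag T n x y $$ (a, b) = 0"
    using ba a xD(3) yD(3)[of "mat_size T n - 1 - a" "mat_size T n - 1 - b"]
    by (auto simp: index)
qed

lemma block_unip_unitriangular:
  fixes v w :: "'a::field mat"
  assumes v: "v \<in> carrier_mat n (mid T)" and w: "w \<in> carrier_mat n n"
  shows "block_unip T n v w \<in> unitriangular (mat_size T n)"
proof (rule unitriangularI)
  have one: "1\<^sub>m n \<in> carrier_mat n n" by simp
  show "block_unip T n v w \<in> carrier_mat (mat_size T n) (mat_size T n)"
    by (rule block_elem_carrier[OF one one v w])
  note index = block_elem_index[OF one one v w]
  fix a assume a: "a < mat_size T n"
  show "block_unip T n v w $$ (a, a) = 1"
    using a by (auto simp: index)
  fix b assume ba: "b < a"
  show "block_unip T n v w $$ (a, b) = 0"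
    using ba a mid_cases[of T] by (auto simp: index)
qed

text \<open>For the inclusion into the block matrices, dividing u by the block diagonal matrix built
  from its top left corner leaves an isometry with identity corner, to which
  \<open>congr_block_unip\<close> applies.\<close>

lemma U_carrier_eq: "(U_carrier T n :: 'a::{field,finite} mat set) = isometries T n"
proof
  let ?m = "mat_size T n"
  show "U_carrier T n \<subseteq> (isometries T n :: 'a mat set)"
  proof
    fix u :: "'a mat" assume "u \<in> U_carrier T n"
    then obtain x y v w where u: "u = block_elem T n x y v w" and x: "x \<in> unitriangular n"
      and y: "y \<in> carrier_mat n n" and xy: "inverts_mat x y" "inverts_mat y x"
      and v: "v \<in> carrier_mat n (mid T)" and w: "w \<in> carrier_mat n n" and W: "w_condition T n v w"
      by (auto simp: U_carrier_def)
    note xc = unitriangularD(1)[OF x]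
    have xy': "x * y = 1\<^sub>m n" "y * x = 1\<^sub>m n" using xy xc y by (auto simp: inverts_mat_def)
    obtain h where h: "h \<in> unitriangular n" "x * h = 1\<^sub>m n" "h * x = 1\<^sub>m n"
      using unitriangular_inverse[OF x] by blast
    have "y = y * (x * h)" using y h by simp
    also have "\<dots> = (y * x) * h" using y xc unitriangularD(1)[OF h(1)] by (simp add: assoc_mult_mat[of _ n n _ n _ n])
    also have "\<dots> = h" using xy' unitriangularD(1)[OF h(1)] by simp
    finally have yu: "y \<in> unitriangular n" using h by simp
    have D: "block_diag T n x y \<in> isometries T n"
      using block_diag_unitriangular[OF x yu] congr_block_diag[OF xc y xy'(1)] by (simp add: isometries_def)
    have one: "1\<^sub>m n \<in> carrier_mat n n" by simp
    have "block_unip T n v w \<in> isometries T n"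
      unfolding isometries_def mem_Collect_eq
    proof
      show N: "block_unip T n v w \<in> unitriangular ?m" by (rule block_unip_unitriangular[OF v w])
      have "congr_act (block_unip T n v w) (ref_form T n) = ref_form T n \<longleftrightarrow>
        block_unip T n v w = block_unip T n v w \<and> w_condition T n v w"
      proof (rule congr_block_unip[OF v w N])
        fix a j assume aj: "a < n" "j < n"
        show "block_unip T n v w $$ (a, j) = (if a = j then 1 else 0)"
          using aj by (simp add: block_elem_index[OF one one v w])
        have "?m - 1 - j < ?m" "\<not> ?m - 1 - j < n + mid T" "\<not> ?m - 1 - j < n" "?m - 1 - j - n - mid T = n - 1 - j"
          using aj by linarith+
        then show "block_unip T n v w $$ (a, ?m - 1 - j) = w $$ (a, n - 1 - j)"
          using aj w block_elem_index[OF one one v w, of a "?m - 1 - j"] by auto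
      next
        fix a assume "a < n" "T = O_odd"
        then show "block_unip T n v w $$ (a, n) = v $$ (a, 0)"
          using v block_elem_index[OF one one v w, of a n] by simp
      qed
      then show "congr_act (block_unip T n v w) (ref_form T n) = ref_form T n" using W by simp
    qed
    then show "u \<in> isometries T n"
      unfolding u block_elem_factor[OF xc y v w, symmetric] by (rule isometries_mult[OF D])
  qed
  show "(isometries T n :: 'a mat set) \<subseteq> U_carrier T n"
  proof
    fix u :: "'a mat" assume u: "u \<in> isometries T n"
    note uu = isometries_unitriangular[OF u] and uD = unitriangularD[OF isometries_unitriangular[OF u]]
    define x where "x = mat n n (\<lambda>(a, b). u $$ (a, b))"
    have x: "x \<in> unitriangular n"
      using uD by (intro unitriangularI) (auto simp: x_def)
    note xc = unitriangularD(1)[OF x]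
    obtain y where y: "y \<in> unitriangular n" "x * y = 1\<^sub>m n" "y * x = 1\<^sub>m n"
      using unitriangular_inverse[OF x] by blast
    note yc = unitriangularD(1)[OF y(1)]
    have D': "block_diag T n y x \<in> isometries T n"
      using block_diag_unitriangular[OF y(1) x] congr_block_diag[OF yc xc y(3)] by (simp add: isometries_def)
    define N where "N = block_diag T n y x * u"
    have N: "N \<in> isometries T n" unfolding N_def by (rule isometries_mult[OF D' u])
    have Nindex: "N $$ (a, b) = (\<Sum>j<n. y $$ (a, j) * u $$ (j, b))" if "a < n" "b < ?m" for a b
      unfolding N_def using that by (subst block_diag_mult[OF yc xc uD(1)]) auto
    define v where "v = mat n (mid T) (\<lambda>(a, b). N $$ (a, n + b))"
    define w where "w = mat n n (\<lambda>(a, b). N $$ (a, n + mid T + b))"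
    have v: "v \<in> carrier_mat n (mid T)" and w: "w \<in> carrier_mat n n" by (simp_all add: v_def w_def)
    have "N = block_unip T n v w \<and> w_condition T n v w"
    proof (rule iffD1[OF congr_block_unip[OF v w isometries_unitriangular[OF N]]])
      fix a j assume aj: "a < n" "j < n"
      have "N $$ (a, j) = (\<Sum>i<n. y $$ (a, i) * x $$ (i, j))"
        using aj by (subst Nindex) (auto simp: x_def)
      also have "\<dots> = (y * x) $$ (a, j)"
        using index_mult_mat_sum[OF yc xc aj] by simp
      finally show "N $$ (a, j) = (if a = j then 1 else 0)" using y(3) aj by simp
      have "?m - 1 - j = n + mid T + (n - 1 - j)" using aj by linarith
      then show "N $$ (a, ?m - 1 - j) = w $$ (a, n - 1 - j)" using aj by (simp add: w_def)
    next
      show "N $$ (a, n) = v $$ (a, 0)" if "a < n" "T = O_odd" for a using that by (simp add: v_def)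
      show "congr_act N (ref_form T n) = ref_form T n" using N by (simp add: isometries_def)
    qed
    then have NB: "N = block_unip T n v w" and W: "w_condition T n v w" by auto
    have Dc: "block_diag T n x y \<in> carrier_mat ?m ?m" "block_diag T n y x \<in> carrier_mat ?m ?m"
      using block_diag_unitriangular[OF x y(1)] block_diag_unitriangular[OF y(1) x] by (auto intro: unitriangularD(1))
    have "block_elem T n x y v w = block_diag T n x y * (block_diag T n y x * u)"
      using block_elem_factor[OF xc yc v w] NB N_def by simp
    also have "\<dots> = u"
      using Dc uD(1) block_diag_mult_block_diag[OF xc yc yc xc y(2) y(2)]
      by (simp add: assoc_mult_mat[of _ ?m ?m _ ?m _ ?m, symmetric])
    finally have "u = block_elem T n x y v w" ..
    then show "u \<in> U_carrier T n"
      unfolding U_carrier_def mem_Collect_eq using x y yc xc v w W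
      by - (rule exI[of _ x], rule exI[of _ y], rule exI[of _ v], rule exI[of _ w], simp add: inverts_mat_def)
  qed
qed

lemma U_group_simps:
  "carrier (U_group T n :: 'a::{field,finite} mat monoid) = isometries T n"
  "mult (U_group T n :: 'a mat monoid) = (*)"
  "one (U_group T n :: 'a mat monoid) = 1\<^sub>m (mat_size T n)"
  by (simp_all add: U_group_def U_carrier_eq)

lemma isometries_carrier: "u \<in> isometries T n \<Longrightarrow> u \<in> carrier_mat (mat_size T n) (mat_size T n)"
  by (rule unitriangularD(1)[OF isometries_unitriangular])

lemma group_U: "group (U_group T n :: 'a::{field,finite} mat monoid)"
proof (rule groupI)
  let ?m = "mat_size T n"
  fix u :: "'a mat" assume u: "u \<in> carrier (U_group T n)"
  show "\<one>\<^bsub>U_group T n\<^esub> \<otimes>\<^bsub>U_group T n\<^esub> u = u"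
    using u by (simp add: U_group_simps left_mult_one_mat[OF isometries_carrier])
  show "\<exists>v\<in>carrier (U_group T n). v \<otimes>\<^bsub>U_group T n\<^esub> u = \<one>\<^bsub>U_group T n\<^esub>"
    using u isometries_inverse by (metis U_group_simps)
next
  fix u v w :: "'a mat"
  assume "u \<in> carrier (U_group T n)" "v \<in> carrier (U_group T n)" "w \<in> carrier (U_group T n)"
  then show "u \<otimes>\<^bsub>U_group T n\<^esub> v \<otimes>\<^bsub>U_group T n\<^esub> w = u \<otimes>\<^bsub>U_group T n\<^esub> (v \<otimes>\<^bsub>U_group T n\<^esub> w)"
    by (simp add: U_group_simps assoc_mult_mat[OF isometries_carrier isometries_carrier isometries_carrier])
qed (simp_all add: U_group_simps isometries_mult one_isometries)

section \<open>The Cayley transform\<close>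

text \<open>This is \<open>(u - 1) / (u + 1)\<close> times \<open>ref_form\<close>, since \<open>1 - 2 / (u + 1) = (u - 1) / (u + 1)\<close>.\<close>

definition cayley_form :: "classical \<Rightarrow> nat \<Rightarrow> 'a::field mat \<Rightarrow> 'a mat" where
  "cayley_form T n u = (let m = mat_size T n in
     (1\<^sub>m m - (SOME w. w \<in> unitriangular m \<and> (1/2) \<cdot>\<^sub>m (u + 1\<^sub>m m) * w = 1\<^sub>m m)) * ref_form T n)"

text \<open>The factor 1/2 restores the ones on the diagonal, so that the Cayley transform can be
  carried out with unitriangular matrices only.\<close>

lemma half_unitriangular:
  fixes u :: "'a::field mat"
  assumes "(2::'a) \<noteq> 0" "u \<in> unitriangular m"
  shows "(1/2) \<cdot>\<^sub>m (u + 1\<^sub>m m) \<in> unitriangular m"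
  using unitriangularD[OF assms(2)] assms(1) by (intro unitriangularI) auto

lemma right_inverse_unique:
  fixes g :: "'a::{field,finite} mat"
  assumes g: "g \<in> unitriangular m" and w: "w \<in> carrier_mat m m" "g * w = 1\<^sub>m m"
    and h: "h \<in> carrier_mat m m" "g * h = 1\<^sub>m m"
  shows "w = h"
proof -
  obtain k where k: "k \<in> unitriangular m" "k * g = 1\<^sub>m m" using unitriangular_inverse[OF g] by blast
  have "x = k" if "x \<in> carrier_mat m m" "g * x = 1\<^sub>m m" for x
  proof -
    have "x = k * g * x" using k that by simp
    also have "\<dots> = k * (g * x)"
      using unitriangularD(1)[OF k(1)] unitriangularD(1)[OF g] that(1) by (rule assoc_mult_mat)
    finally show ?thesis using that(2) unitriangularD(1)[OF k(1)] by simp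
  qed
  from this[OF w] this[OF h] show ?thesis by simp
qed

lemma cayley_formI:
  fixes u :: "'a::{field,finite} mat"
  assumes "(2::'a) \<noteq> 0" "u \<in> unitriangular (mat_size T n)" "w \<in> unitriangular (mat_size T n)"
    and "(1/2) \<cdot>\<^sub>m (u + 1\<^sub>m (mat_size T n)) * w = 1\<^sub>m (mat_size T n)"
  shows "cayley_form T n u = (1\<^sub>m (mat_size T n) - w) * ref_form T n"
proof -
  let ?m = "mat_size T n"
  have "(SOME w. w \<in> unitriangular ?m \<and> (1/2) \<cdot>\<^sub>m (u + 1\<^sub>m ?m) * w = 1\<^sub>m ?m) = w"
  proof (rule some_equality)
    show "w \<in> unitriangular ?m \<and> (1/2) \<cdot>\<^sub>m (u + 1\<^sub>m ?m) * w = 1\<^sub>m ?m" using assms by simp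
    fix h assume "h \<in> unitriangular ?m \<and> (1/2) \<cdot>\<^sub>m (u + 1\<^sub>m ?m) * h = 1\<^sub>m ?m"
    then show "h = w"
      using right_inverse_unique[OF half_unitriangular[OF assms(1,2)]] assms(3,4) unitriangularD(1) by metis
  qed
  then show ?thesis by (simp add: cayley_form_def)
qed

lemma double_half:
  fixes u :: "'a::field mat"
  assumes "(2::'a) \<noteq> 0" "u \<in> carrier_mat m m"
  shows "2 \<cdot>\<^sub>m ((1/2) \<cdot>\<^sub>m (u + 1\<^sub>m m)) - 1\<^sub>m m = u"
  using assms by (intro eq_matI) (auto simp: add_divide_distrib)

text \<open>With g = (u + 1) / 2 and w its inverse, y is the Cayley transform of u. The relations
  are ways of writing u = (1 + y) / (1 - y) without division.\<close>

lemma cayley_relations: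
  fixes g w :: "'a::{field,finite} mat"
  assumes g: "g \<in> unitriangular m" and w: "w \<in> unitriangular m" and gw: "g * w = 1\<^sub>m m"
  defines "u \<equiv> 2 \<cdot>\<^sub>m g - 1\<^sub>m m" and "y \<equiv> 1\<^sub>m m - w"
  shows "w * g = 1\<^sub>m m" "w * u = 1\<^sub>m m + y" "w = 1\<^sub>m m - y"
    "u - 1\<^sub>m m = 2 \<cdot>\<^sub>m (y * g)" "(u - 1\<^sub>m m) * w = 2 \<cdot>\<^sub>m y"
proof -
  have c: "g \<in> carrier_mat m m" "w \<in> carrier_mat m m" using g w by (auto intro: unitriangularD(1))
  obtain h where h: "h \<in> unitriangular m" "g * h = 1\<^sub>m m" "h * g = 1\<^sub>m m"
    using unitriangular_inverse[OF g] by blast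
  show wg: "w * g = 1\<^sub>m m"
    using right_inverse_unique[OF g c(2) gw unitriangularD(1)[OF h(1)] h(2)] h(3) by simp
  show "w = 1\<^sub>m m - y" unfolding y_def using c by (intro eq_matI) auto
  have "w * u = 2 \<cdot>\<^sub>m (w * g) - w"
    unfolding u_def using c by (subst mult_minus_distrib_mat[of _ m m _ m]) (auto simp: mult_smult_distrib[of _ m m _ m])
  also have "\<dots> = 1\<^sub>m m + y" unfolding wg y_def using c by (intro eq_matI) auto
  finally show "w * u = 1\<^sub>m m + y" .
  have "2 \<cdot>\<^sub>m (y * g) = 2 \<cdot>\<^sub>m (g - 1\<^sub>m m)"
    unfolding y_def using c by (subst minus_mult_distrib_mat[of _ m m]) (auto simp: wg)
  also have "\<dots> = u - 1\<^sub>m m" unfolding u_def using c by (intro eq_matI) auto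
  finally show "u - 1\<^sub>m m = 2 \<cdot>\<^sub>m (y * g)" by simp
  have "u - 1\<^sub>m m = 2 \<cdot>\<^sub>m (g - 1\<^sub>m m)" unfolding u_def using c by (intro eq_matI) auto
  then have "(u - 1\<^sub>m m) * w = 2 \<cdot>\<^sub>m ((g - 1\<^sub>m m) * w)"
    using c mult_smult_assoc_mat[OF minus_carrier_mat[OF one_carrier_mat], of w m m 2 g] by simp
  also have "(g - 1\<^sub>m m) * w = y" unfolding y_def using c by (subst minus_mult_distrib_mat[of _ m m]) (auto simp: gw)
  finally show "(u - 1\<^sub>m m) * w = 2 \<cdot>\<^sub>m y" .
qed

lemma congr_one_plus:
  fixes y :: "'a::field mat"
  assumes y: "y \<in> carrier_mat m m" and F: "F \<in> carrier_mat m m" and "a < m" "b < m"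
  shows "congr_act (1\<^sub>m m + y) F $$ (a, b) = F $$ (a, b) + (y * F) $$ (a, b) +
    (F * transpose_mat y) $$ (a, b) + congr_act y F $$ (a, b)"
proof -
  have t: "transpose_mat (1\<^sub>m m + y) = 1\<^sub>m m + transpose_mat y"
    using y by (subst transpose_add[of _ m m]) auto
  have "congr_act (1\<^sub>m m + y) F = (F + y * F) * (1\<^sub>m m + transpose_mat y)"
    unfolding t using y F by (subst add_mult_distrib_mat[of _ m m]) auto
  also have "\<dots> = (F + y * F) + (F * transpose_mat y + congr_act y F)"
    using y F mult_carrier_mat[OF y F]
    by (subst mult_add_distrib_mat[of _ m m _ m])
      (auto simp: add_mult_distrib_mat[of F m m "y * F"])
  finally show ?thesis using assms by (simp del: index_mult_mat(1))
qed

text \<open>The terms of degree 0 and 2 in y agree on both sides; what remains is twice the linear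
  part.\<close>

lemma congr_one_plus_minus_eq_iff:
  fixes y :: "'a::field mat"
  assumes two: "(2::'a) \<noteq> 0" and y: "y \<in> carrier_mat m m" and F: "F \<in> carrier_mat m m"
  shows "congr_act (1\<^sub>m m + y) F = congr_act (1\<^sub>m m - y) F \<longleftrightarrow>
    (\<forall>a<m. \<forall>b<m. (y * F) $$ (a, b) + (F * transpose_mat y) $$ (a, b) = 0)"
proof -
  have neg: "1\<^sub>m m - y = 1\<^sub>m m + (- y)" using y by (intro eq_matI) auto
  have yn: "- y \<in> carrier_mat m m" using y by simp
  have e1: "(- y * F) $$ (a, b) = - (y * F) $$ (a, b)"
    "(F * transpose_mat (- y)) $$ (a, b) = - (F * transpose_mat y) $$ (a, b)"
    "congr_act (- y) F $$ (a, b) = congr_act y F $$ (a, b)" if ab: "a < m" "b < m" for a b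
  proof -
    show "(- y * F) $$ (a, b) = - (y * F) $$ (a, b)"
      using index_mult_mat_sum[OF yn F ab] index_mult_mat_sum[OF y F ab] y ab by (simp add: sum_negf)
    have ty: "transpose_mat y \<in> carrier_mat m m" "transpose_mat (- y) \<in> carrier_mat m m" using y by auto
    show "(F * transpose_mat (- y)) $$ (a, b) = - (F * transpose_mat y) $$ (a, b)"
      using index_mult_mat_sum[OF F ty(2) ab] index_mult_mat_sum[OF F ty(1) ab] y ab by (simp add: sum_negf)
    show "congr_act (- y) F $$ (a, b) = congr_act y F $$ (a, b)"
      unfolding index_congr_act[OF yn F ab] index_congr_act[OF y F ab] using y ab by simp
  qed
  have dims: "congr_act (1\<^sub>m m + y) F \<in> carrier_mat m m" "congr_act (1\<^sub>m m - y) F \<in> carrier_mat m m"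
    using y F by auto
  have halves: "p + q + r + s = p + - q + - r + s \<longleftrightarrow> q + r = 0" for p q r s :: 'a
  proof -
    have "p + q + r + s = p + - q + - r + s \<longleftrightarrow> 2 * (q + r) = 0" by (auto simp: algebra_simps)
    then show ?thesis using two by (simp only: mult_eq_0_iff) simp
  qed
  have "congr_act (1\<^sub>m m + y) F = congr_act (1\<^sub>m m - y) F \<longleftrightarrow>
    (\<forall>a<m. \<forall>b<m. congr_act (1\<^sub>m m + y) F $$ (a, b) = congr_act (1\<^sub>m m - y) F $$ (a, b))"
    using dims by (auto intro!: eq_matI)
  then show ?thesis
    unfolding neg using congr_one_plus[OF y F] congr_one_plus[OF yn F] e1 halves by simp
qed

text \<open>Acting with w turns u F u^T = F into an equality of the congruences by 1 + y and 1 - y,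
  that is, into y F + F y^T = 0. Since F has symmetry sign \<open>- form_sign T\<close>, this says
  that y F has sign \<open>form_sign T\<close>; the zero region of y F reflects that y is strictly
  upper triangular.\<close>

lemma cayley_isometry_iff:
  fixes g w :: "'a::{field,finite} mat"
  assumes two: "(2::'a) \<noteq> 0"
    and g: "g \<in> unitriangular (mat_size T n)" and w: "w \<in> unitriangular (mat_size T n)"
    and gw: "g * w = 1\<^sub>m (mat_size T n)"
  shows "2 \<cdot>\<^sub>m g - 1\<^sub>m (mat_size T n) \<in> isometries T n \<longleftrightarrow>
    (1\<^sub>m (mat_size T n) - w) * ref_form T n \<in> forms (mat_size T n) (form_sign T)"
proof -
  let ?m = "mat_size T n" and ?F = "ref_form T n :: 'a mat"
  define u where "u = 2 \<cdot>\<^sub>m g - 1\<^sub>m ?m"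
  define y where "y = 1\<^sub>m ?m - w"
  note gD = unitriangularD[OF g] and wD = unitriangularD[OF w]
  have uu: "u \<in> unitriangular ?m" unfolding u_def using gD by (intro unitriangularI) auto
  note uD = unitriangularD[OF uu]
  note F = ref_form_carrier[of T n, where 'a='a]
  have y: "y \<in> carrier_mat ?m ?m" unfolding y_def by (rule minus_carrier_mat[OF wD(1)])
  note rel = cayley_relations[OF g w gw, folded u_def y_def]
  have "u \<in> isometries T n \<longleftrightarrow> congr_act (w * u) ?F = congr_act w ?F"
  proof
    assume "u \<in> isometries T n"
    then show "congr_act (w * u) ?F = congr_act w ?F"
      using congr_act_mult[OF wD(1) uD(1) F] by (simp add: isometries_def)
  next
    assume e: "congr_act (w * u) ?F = congr_act w ?F"
    have "congr_act u ?F = congr_act (g * w * u) ?F" using uD(1) gw by simp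
    also have "g * w * u = g * (w * u)" using gD(1) wD(1) uD(1) by (rule assoc_mult_mat)
    also have "congr_act (g * (w * u)) ?F = congr_act g (congr_act w ?F)"
      using congr_act_mult[OF gD(1) mult_carrier_mat[OF wD(1) uD(1)] F] e by simp
    also have "\<dots> = ?F" using congr_act_mult[OF gD(1) wD(1) F, symmetric] F gw by simp
    finally show "u \<in> isometries T n" using uu by (simp add: isometries_def)
  qed
  also have "\<dots> \<longleftrightarrow> congr_act (1\<^sub>m ?m + y) ?F = congr_act (1\<^sub>m ?m - y) ?F"
    using rel(2,3) by simp
  also have "\<dots> \<longleftrightarrow> (\<forall>a<?m. \<forall>b<?m. (y * ?F) $$ (a, b) + (?F * transpose_mat y) $$ (a, b) = 0)"
    by (rule congr_one_plus_minus_eq_iff[OF two y F])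
  also have "\<dots> \<longleftrightarrow> y * ?F \<in> forms ?m (form_sign T)"
  proof -
    have Ft: "(?F * transpose_mat y) $$ (a, b) = - form_sign T * (y * ?F) $$ (b, a)" if "a < ?m" "b < ?m" for a b
    proof -
      have "(?F * transpose_mat y) $$ (a, b) =
        (\<Sum>k<?m. if k = ?m - 1 - a then ref_sign T n (?m - 1 - a) * y $$ (b, ?m - 1 - a) else 0)"
        using that y by (subst index_mult_mat_sum[OF F _ that]) (auto simp: ref_form_def intro!: sum.cong simp del: sum.delta)
      also have "\<dots> = ref_sign T n (?m - 1 - a) * y $$ (b, ?m - 1 - a)" using that by simp
      also have "\<dots> = - form_sign T * (y * ?F) $$ (b, a)"
        unfolding ref_form_mult[OF y that(2,1)] ref_sign_reverse[OF that(1)] by (simp add: mult_ac)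
      finally show ?thesis .
    qed
    have zero: "(y * ?F) $$ (a, b) = 0" if "a < ?m" "b < ?m" "?m \<le> a + b + 1" for a b
    proof -
      have "?m - 1 - b \<le> a" using that by linarith
      then have "y $$ (a, ?m - 1 - b) = 0"
        using that wD(1,2) wD(3)[of "?m - 1 - b" a] by (cases "?m - 1 - b = a") (auto simp: y_def)
      then show ?thesis unfolding ref_form_mult[OF y that(1,2)] by simp
    qed
    have "(y * ?F) $$ (a, b) + (?F * transpose_mat y) $$ (a, b) = 0 \<longleftrightarrow>
      (y * ?F) $$ (b, a) = form_sign T * (y * ?F) $$ (a, b)" if "a < ?m" "b < ?m" for a b
      unfolding Ft[OF that] by (auto simp: form_sign_def eq_neg_iff_add_eq_0 add.commute)
    then show ?thesis
      using zero mult_carrier_mat[OF y F] unfolding forms_def by (auto simp del: index_mult_mat(1))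
  qed
  finally show ?thesis by (simp add: u_def y_def)
qed

lemma half_double:
  fixes G :: "'a::field mat"
  assumes "(2::'a) \<noteq> 0" "G \<in> carrier_mat m m"
  shows "(1/2) \<cdot>\<^sub>m (2 \<cdot>\<^sub>m G - 1\<^sub>m m + 1\<^sub>m m) = G"
  using assms by (intro eq_matI) auto

lemma cayley_cases:
  fixes u :: "'a::{field,finite} mat"
  assumes two: "(2::'a) \<noteq> 0" and u: "u \<in> unitriangular (mat_size T n)"
  obtains g w where "g \<in> unitriangular (mat_size T n)" "w \<in> unitriangular (mat_size T n)"
    "g * w = 1\<^sub>m (mat_size T n)" "u = 2 \<cdot>\<^sub>m g - 1\<^sub>m (mat_size T n)"
    "cayley_form T n u = (1\<^sub>m (mat_size T n) - w) * ref_form T n"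
proof -
  let ?m = "mat_size T n"
  define g where "g = (1/2) \<cdot>\<^sub>m (u + 1\<^sub>m ?m)"
  have g: "g \<in> unitriangular ?m" unfolding g_def by (rule half_unitriangular[OF two u])
  obtain w where w: "w \<in> unitriangular ?m" "g * w = 1\<^sub>m ?m" using unitriangular_inverse[OF g] by blast
  show thesis
  proof (rule that[OF g w])
    show "u = 2 \<cdot>\<^sub>m g - 1\<^sub>m ?m"
      unfolding g_def by (rule double_half[symmetric, OF two unitriangularD(1)[OF u]])
    show "cayley_form T n u = (1\<^sub>m ?m - w) * ref_form T n"
      using cayley_formI[OF two u w(1)] w(2) by (simp add: g_def)
  qed
qed

lemma cayley_form_forms:
  fixes u :: "'a::{field,finite} mat"
  assumes two: "(2::'a) \<noteq> 0" and u: "u \<in> isometries T n"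
  shows "cayley_form T n u \<in> forms (mat_size T n) (form_sign T)"
  using cayley_cases[OF two isometries_unitriangular[OF u]] cayley_isometry_iff[OF two] u by metis

lemma ref_form_cancel:
  fixes A B :: "'a::field mat"
  assumes A: "A \<in> carrier_mat (mat_size T n) (mat_size T n)" and B: "B \<in> carrier_mat (mat_size T n) (mat_size T n)"
    and eq: "A * ref_form T n = B * ref_form T n"
  shows "A = B"
proof (rule eq_matI)
  let ?m = "mat_size T n"
  fix a b assume "a < dim_row B" "b < dim_col B"
  then have ab: "a < ?m" "b < ?m" "?m - 1 - b < ?m" "?m - 1 - (?m - 1 - b) = b" using B by auto
  have "(A * ref_form T n) $$ (a, ?m - 1 - b) = (B * ref_form T n) $$ (a, ?m - 1 - b)" using eq by simp
  then have "A $$ (a, b) * ref_sign T n (?m - 1 - b) = B $$ (a, b) * ref_sign T n (?m - 1 - b)"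
    unfolding ref_form_mult[OF A ab(1,3)] ref_form_mult[OF B ab(1,3)] ab(4) .
  moreover have "ref_sign T n (?m - 1 - b) \<noteq> (0 :: 'a)" by (simp add: ref_sign_def)
  ultimately show "A $$ (a, b) = B $$ (a, b)" by simp
qed (use A B in auto)

lemma cayley_form_surj:
  fixes X :: "'a::{field,finite} mat"
  assumes two: "(2::'a) \<noteq> 0" and X: "X \<in> forms (mat_size T n) (form_sign T)"
  shows "\<exists>u \<in> isometries T n. cayley_form T n u = X"
proof -
  let ?m = "mat_size T n"
  note XD = formsD[OF X]
  \<comment> \<open>This is X F^-1: the columns are reversed and the signs are their own
    inverses.\<close>
  define y where "y = mat ?m ?m (\<lambda>(a, c). ref_sign T n (?m - 1 - c) * X $$ (a, ?m - 1 - c))"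
  have y: "y \<in> carrier_mat ?m ?m" by (simp add: y_def)
  have yF: "y * ref_form T n = X"
  proof (rule eq_matI)
    fix a b assume "a < dim_row X" "b < dim_col X"
    then have ab: "a < ?m" "b < ?m" using XD(1) by auto
    have "?m - 1 - (?m - 1 - b) = b" "?m - 1 - b < ?m" using ab by auto
    then have "(y * ref_form T n) $$ (a, b) = ref_sign T n b * X $$ (a, b) * ref_sign T n b"
      unfolding ref_form_mult[OF y ab] using ab by (simp add: y_def)
    then show "(y * ref_form T n) $$ (a, b) = X $$ (a, b)"
      using ref_sign_square[of T n b, where 'a='a] by (simp add: mult.commute mult.left_commute mult.assoc[symmetric])
  qed (use y XD(1) ref_form_carrier[of T n, where 'a='a] in auto)
  define w where "w = 1\<^sub>m ?m - y"
  have w: "w \<in> unitriangular ?m"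
  proof (rule unitriangularI)
    show "w \<in> carrier_mat ?m ?m" unfolding w_def by (rule minus_carrier_mat[OF y])
    have y0: "y $$ (a, b) = 0" if "b \<le> a" "a < ?m" for a b
    proof -
      have "?m \<le> a + (?m - 1 - b) + 1" "?m - 1 - b < ?m" using that by linarith+
      then show ?thesis using XD(3)[of a "?m - 1 - b"] that by (simp add: y_def)
    qed
    show "w $$ (a, a) = 1" if "a < ?m" for a using that y0 y by (simp add: w_def)
    show "w $$ (a, b) = 0" if "b < a" "a < ?m" for a b using that y0 y by (simp add: w_def)
  qed
  obtain g where g: "g \<in> unitriangular ?m" "w * g = 1\<^sub>m ?m" "g * w = 1\<^sub>m ?m"
    using unitriangular_inverse[OF w] by blast
  define u where "u = 2 \<cdot>\<^sub>m g - 1\<^sub>m ?m"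
  note gD = unitriangularD[OF g(1)]
  have uu: "u \<in> unitriangular ?m" unfolding u_def using gD by (intro unitriangularI) auto
  have "1\<^sub>m ?m - w = y" unfolding w_def using y by (intro eq_matI) auto
  then have wX: "(1\<^sub>m ?m - w) * ref_form T n = X" using yF by simp
  have "(1/2) \<cdot>\<^sub>m (u + 1\<^sub>m ?m) = g" unfolding u_def using gD(1) two by (intro eq_matI) auto
  then have "cayley_form T n u = X" using cayley_formI[OF two uu w] g(3) wX by simp
  moreover have "u \<in> isometries T n"
    unfolding u_def using cayley_isometry_iff[OF two g(1) w g(3)] wX X by simp
  ultimately show ?thesis by blast
qed

lemma cayley_form_inj:
  assumes two: "(2::'a::{field,finite}) \<noteq> 0"
  shows "inj_on (cayley_form T n) (isometries T n :: 'a mat set)"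
proof
  let ?m = "mat_size T n"
  fix u u' :: "'a mat" assume u: "u \<in> isometries T n" and u': "u' \<in> isometries T n"
    and eq: "cayley_form T n u = cayley_form T n u'"
  obtain g w where 1: "g \<in> unitriangular ?m" "w \<in> unitriangular ?m" "g * w = 1\<^sub>m ?m"
      "u = 2 \<cdot>\<^sub>m g - 1\<^sub>m ?m" "cayley_form T n u = (1\<^sub>m ?m - w) * ref_form T n"
    by (rule cayley_cases[OF two isometries_unitriangular[OF u]])
  obtain g' w' where 2: "g' \<in> unitriangular ?m" "w' \<in> unitriangular ?m" "g' * w' = 1\<^sub>m ?m"
      "u' = 2 \<cdot>\<^sub>m g' - 1\<^sub>m ?m" "cayley_form T n u' = (1\<^sub>m ?m - w') * ref_form T n"
    by (rule cayley_cases[OF two isometries_unitriangular[OF u']])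
  note wc = unitriangularD(1)[OF 1(2)] unitriangularD(1)[OF 2(2)]
  have y: "1\<^sub>m ?m - w = 1\<^sub>m ?m - w'"
    by (rule ref_form_cancel[OF minus_carrier_mat[OF wc(1)] minus_carrier_mat[OF wc(2)]]) (use eq 1 2 in simp)
  have "w = 1\<^sub>m ?m - (1\<^sub>m ?m - w)" using wc by (intro eq_matI) auto
  also have "\<dots> = w'" unfolding y using wc by (intro eq_matI) auto
  finally have w: "w = w'" .
  have "w * g = 1\<^sub>m ?m" "w * g' = 1\<^sub>m ?m"
    using cayley_relations(1)[OF 1(1-3)] cayley_relations(1)[OF 2(1-3)] w by auto
  then have "g = g'"
    using right_inverse_unique[OF 1(2)] unitriangularD(1) 1(1) 2(1) by metis
  then show "u = u'" using 1(4) 2(4) by simp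
qed

lemma bij_betw_cayley_form:
  assumes two: "(2::'a::{field,finite}) \<noteq> 0"
  shows "bij_betw (cayley_form T n) (isometries T n :: 'a mat set) (forms (mat_size T n) (form_sign T))"
  unfolding bij_betw_def
proof (intro conjI equalityI subsetI)
  show "inj_on (cayley_form T n) (isometries T n :: 'a mat set)" by (rule cayley_form_inj[OF two])
  show "X \<in> forms (mat_size T n) (form_sign T)" if "X \<in> cayley_form T n ` isometries T n" for X :: "'a mat"
    using that cayley_form_forms[OF two] by blast
  show "X \<in> cayley_form T n ` isometries T n" if "X \<in> forms (mat_size T n) (form_sign T)" for X :: "'a mat"
    using cayley_form_surj[OF two that] by blast
qed

text \<open>Conjugation commutes with the Cayley transform, so y becomes h y k. The relation h F h^T
  = F, rewritten as k F = F h^T, then turns h y k F into h (y F) h^T.\<close>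

lemma cayley_form_conj:
  fixes u h k :: "'a::{field,finite} mat"
  assumes two: "(2::'a) \<noteq> 0" and u: "u \<in> isometries T n" and h: "h \<in> isometries T n"
    and k: "k \<in> isometries T n" and hk: "h * k = 1\<^sub>m (mat_size T n)" and kh: "k * h = 1\<^sub>m (mat_size T n)"
  shows "cayley_form T n (h * u * k) = congr_act h (cayley_form T n u)"
proof -
  let ?m = "mat_size T n" and ?F = "ref_form T n :: 'a mat"
  note F = ref_form_carrier[of T n, where 'a='a]
  obtain g w where gw: "g \<in> unitriangular ?m" "w \<in> unitriangular ?m" "g * w = 1\<^sub>m ?m"
      "u = 2 \<cdot>\<^sub>m g - 1\<^sub>m ?m" "cayley_form T n u = (1\<^sub>m ?m - w) * ?F"
    by (rule cayley_cases[OF two isometries_unitriangular[OF u]])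
  note hu = isometries_unitriangular[OF h] and ku = isometries_unitriangular[OF k]
  note c = unitriangularD(1)[OF gw(1)] unitriangularD(1)[OF gw(2)] unitriangularD(1)[OF hu] unitriangularD(1)[OF ku]
  note as = assoc_mult_mat[of _ ?m ?m _ ?m _ ?m]
  have ht: "transpose_mat h \<in> carrier_mat ?m ?m" using c by simp
  have G: "h * g * k \<in> unitriangular ?m" and W: "h * w * k \<in> unitriangular ?m"
    using gw hu ku by (auto intro: unitriangular_mult)
  have kx: "k * (h * x) = x" if "x \<in> carrier_mat ?m ?m" for x
    using that c kh as[of k h x] by simp
  have gwx: "g * (w * x) = x" if "x \<in> carrier_mat ?m ?m" for x
    using that c gw(3) as[of g w x] by simp
  have "h * g * k * (h * w * k) = 1\<^sub>m ?m"
    using c by (simp add: as kx gwx hk)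
  moreover have "(1/2) \<cdot>\<^sub>m (h * u * k + 1\<^sub>m ?m) = h * g * k"
  proof -
    have "h * u * k = (2 \<cdot>\<^sub>m (h * g) - h) * k"
      unfolding gw(4) using c by (subst mult_minus_distrib_mat[of _ ?m ?m _ ?m]) (auto simp: mult_smult_distrib[of _ ?m ?m _ ?m])
    also have "\<dots> = 2 \<cdot>\<^sub>m (h * g * k) - 1\<^sub>m ?m"
      using c hk by (subst minus_mult_distrib_mat[of _ ?m ?m]) (auto simp: mult_smult_assoc_mat[of _ ?m ?m _ ?m])
    finally have e: "h * u * k = 2 \<cdot>\<^sub>m (h * g * k) - 1\<^sub>m ?m" .
    show ?thesis unfolding e by (rule half_double[OF two unitriangularD(1)[OF G]])
  qed
  moreover have "h * u * k \<in> unitriangular ?m"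
    using isometries_unitriangular[OF u] hu ku by (auto intro: unitriangular_mult)
  ultimately have "cayley_form T n (h * u * k) = (1\<^sub>m ?m - h * w * k) * ?F"
    using cayley_formI[OF two _ W] by simp
  also have "1\<^sub>m ?m - h * w * k = h * (1\<^sub>m ?m - w) * k"
  proof -
    have "h * (1\<^sub>m ?m - w) = h - h * w"
      using c by (subst mult_minus_distrib_mat[of _ ?m ?m _ ?m]) auto
    moreover have "(h - h * w) * k = h * k - h * w * k"
      using c by (subst minus_mult_distrib_mat[of _ ?m ?m]) auto
    ultimately show ?thesis using hk by simp
  qed
  also have "h * (1\<^sub>m ?m - w) * k * ?F = h * ((1\<^sub>m ?m - w) * (k * ?F))"
    using c F minus_carrier_mat[OF c(2), of "1\<^sub>m ?m"] by (simp add: as)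
  also have "k * ?F = ?F * transpose_mat h"
  proof -
    have "k * ?F = k * (h * ?F * transpose_mat h)" using h by (simp add: isometries_def)
    also have "\<dots> = k * (h * (?F * transpose_mat h))" using c F ht by (simp add: as)
    also have "\<dots> = ?F * transpose_mat h" using c F ht by (intro kx) auto
    finally show ?thesis .
  qed
  also have "h * ((1\<^sub>m ?m - w) * (?F * transpose_mat h)) = congr_act h (cayley_form T n u)"
    unfolding gw(5) using c F ht minus_carrier_mat[OF c(2), of "1\<^sub>m ?m"] by (simp add: as)
  finally show ?thesis .
qed

lemma cayley_form_one:
  assumes two: "(2::'a::{field,finite}) \<noteq> 0"
  shows "cayley_form T n (1\<^sub>m (mat_size T n)) = (0\<^sub>m (mat_size T n) (mat_size T n) :: 'a mat)"
proof -
  let ?m = "mat_size T n"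
  have "(1/2) \<cdot>\<^sub>m (1\<^sub>m ?m + 1\<^sub>m ?m) * 1\<^sub>m ?m = (1\<^sub>m ?m :: 'a mat)"
    using two by (intro eq_matI) (auto simp: field_simps)
  then have "cayley_form T n (1\<^sub>m ?m) = (1\<^sub>m ?m - 1\<^sub>m ?m) * (ref_form T n :: 'a mat)"
    by (intro cayley_formI two one_unitriangular)
  also have "1\<^sub>m ?m - 1\<^sub>m ?m = (0\<^sub>m ?m ?m :: 'a mat)" by (intro eq_matI) auto
  finally show ?thesis using ref_form_carrier[of T n, where 'a='a] by simp
qed

lemma upper_mult_row_zero:
  fixes A B :: "'a::comm_ring_1 mat"
  assumes "A \<in> carrier_mat m m" "B \<in> unitriangular m" "a < m" "\<And>l. l < c \<Longrightarrow> l < m \<Longrightarrow> A $$ (a, l) = 0" "l < c" "l < m"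
  shows "(A * B) $$ (a, l) = 0"
  using assms by (subst upper_mult_row[of _ m]) (auto simp: unitriangularD)

text \<open>\<open>u - 1\<close> and its Cayley transform differ by right multiplication with a unitriangular matrix,
  which preserves initial zero segments of rows.\<close>

lemma cayley_form_row:
  fixes u :: "'a::{field,finite} mat"
  assumes two: "(2::'a) \<noteq> 0" and u: "u \<in> unitriangular (mat_size T n)" and i: "i < mat_size T n"
    and c: "c \<le> mat_size T n"
  shows "(\<forall>l. i < l \<and> l < c \<longrightarrow> u $$ (i, l) = 0) \<longleftrightarrow>
    (\<forall>b<mat_size T n. mat_size T n \<le> b + c \<longrightarrow> cayley_form T n u $$ (i, b) = 0)"
proof -
  let ?m = "mat_size T n"
  note uD = unitriangularD[OF u]
  obtain g w where gw: "g \<in> unitriangular ?m" "w \<in> unitriangular ?m" "g * w = 1\<^sub>m ?m"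
      "u = 2 \<cdot>\<^sub>m g - 1\<^sub>m ?m" "cayley_form T n u = (1\<^sub>m ?m - w) * ref_form T n"
    by (rule cayley_cases[OF two u])
  define y where "y = 1\<^sub>m ?m - w"
  have y: "y \<in> carrier_mat ?m ?m" unfolding y_def by (rule minus_carrier_mat[OF unitriangularD(1)[OF gw(2)]])
  have u1: "u - 1\<^sub>m ?m \<in> carrier_mat ?m ?m" by (rule minus_carrier_mat) simp
  have rel: "u - 1\<^sub>m ?m = 2 \<cdot>\<^sub>m (y * g)" "(u - 1\<^sub>m ?m) * w = 2 \<cdot>\<^sub>m y"
    using cayley_relations(4,5)[OF gw(1-3)] by (simp_all add: gw(4) y_def)
  have "(\<forall>l. i < l \<and> l < c \<longrightarrow> u $$ (i, l) = 0) \<longleftrightarrow> (\<forall>l<c. (u - 1\<^sub>m ?m) $$ (i, l) = 0)"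
  proof -
    have "l \<le> i \<Longrightarrow> l < ?m \<Longrightarrow> (u - 1\<^sub>m ?m) $$ (i, l) = 0" for l
      using uD i by (cases "l = i") auto
    moreover have "i < l \<Longrightarrow> l < ?m \<Longrightarrow> (u - 1\<^sub>m ?m) $$ (i, l) = u $$ (i, l)" for l
      using uD i by auto
    ultimately show ?thesis using c by (metis less_le_trans not_less)
  qed
  also have "\<dots> \<longleftrightarrow> (\<forall>l<c. y $$ (i, l) = 0)"
  proof
    assume z: "\<forall>l<c. (u - 1\<^sub>m ?m) $$ (i, l) = 0"
    show "\<forall>l<c. y $$ (i, l) = 0"
    proof (intro allI impI)
      fix l assume l: "l < c"
      then have lm: "l < ?m" using c by simp
      have "((u - 1\<^sub>m ?m) * w) $$ (i, l) = 0"
        by (rule upper_mult_row_zero[OF u1 gw(2) i _ l lm]) (use z in blast)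
      then have "2 * y $$ (i, l) = 0" unfolding rel(2) using y i lm by simp
      then show "y $$ (i, l) = 0" using two by simp
    qed
  next
    assume z: "\<forall>l<c. y $$ (i, l) = 0"
    show "\<forall>l<c. (u - 1\<^sub>m ?m) $$ (i, l) = 0"
    proof (intro allI impI)
      fix l assume l: "l < c"
      then have lm: "l < ?m" using c by simp
      have "(y * g) $$ (i, l) = 0"
        by (rule upper_mult_row_zero[OF y gw(1) i _ l lm]) (use z in blast)
      then show "(u - 1\<^sub>m ?m) $$ (i, l) = 0"
        unfolding rel(1) using y unitriangularD(1)[OF gw(1)] i lm by (simp del: index_mult_mat(1))
    qed
  qed
  \<comment> \<open>The reference form sends column l to column m - 1 - l up to sign, so an initial
    segment of a row becomes a final one.\<close>
  also have "\<dots> \<longleftrightarrow> (\<forall>b<?m. ?m \<le> b + c \<longrightarrow> cayley_form T n u $$ (i, b) = 0)"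
  proof -
    have eq: "cayley_form T n u $$ (i, b) = y $$ (i, ?m - 1 - b) * ref_sign T n b" if "b < ?m" for b
      unfolding gw(5) y_def[symmetric] by (rule ref_form_mult[OF y i that])
    have sg: "ref_sign T n b \<noteq> (0::'a)" for b by (simp add: ref_sign_def)
    show ?thesis
    proof (intro iffI allI impI)
      fix b assume "\<forall>l<c. y $$ (i, l) = 0" "b < ?m" "?m \<le> b + c"
      moreover from this have "?m - 1 - b < c" by linarith
      ultimately show "cayley_form T n u $$ (i, b) = 0" by (simp add: eq)
    next
      fix l assume z: "\<forall>b<?m. ?m \<le> b + c \<longrightarrow> cayley_form T n u $$ (i, b) = 0" and l: "l < c"
      have "?m - 1 - l < ?m" "?m \<le> ?m - 1 - l + c" "?m - 1 - (?m - 1 - l) = l" using l c by linarith+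
      then show "y $$ (i, l) = 0" using z eq[of "?m - 1 - l"] sg by auto
    qed
  qed
  finally show ?thesis .
qed

text \<open>Under the vanishing conditions, the quadratic and higher terms of the Cayley transform do
  not contribute to the entry \<open>(i, m - 1 - k)\<close>.\<close>

lemma cayley_form_entry:
  fixes u :: "'a::{field,finite} mat"
  assumes two: "(2::'a) \<noteq> 0" and u: "u \<in> isometries T n"
    and ik: "i < mat_size T n" "k < mat_size T n" "i + k + 1 < mat_size T n"
    and row_i: "\<And>l. i < l \<Longrightarrow> l < A \<Longrightarrow> u $$ (i, l) = 0"
    and row_k: "\<And>b. b < mat_size T n \<Longrightarrow> A \<le> b \<Longrightarrow> cayley_form T n u $$ (k, b) = 0"
  shows "u $$ (i, mat_size T n - 1 - k) = 2 * ref_sign T n k * cayley_form T n u $$ (i, k)"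
proof -
  let ?m = "mat_size T n"
  note uu = isometries_unitriangular[OF u]
  note uD = unitriangularD[OF uu]
  obtain g w where gw: "g \<in> unitriangular ?m" "w \<in> unitriangular ?m" "g * w = 1\<^sub>m ?m"
      "u = 2 \<cdot>\<^sub>m g - 1\<^sub>m ?m" "cayley_form T n u = (1\<^sub>m ?m - w) * ref_form T n"
    by (rule cayley_cases[OF two uu])
  note wD = unitriangularD[OF gw(2)]
  define y where "y = 1\<^sub>m ?m - w"
  have y: "y \<in> carrier_mat ?m ?m" unfolding y_def by (rule minus_carrier_mat[OF wD(1)])
  have u1: "u - 1\<^sub>m ?m \<in> carrier_mat ?m ?m" by (rule minus_carrier_mat) simp
  have rel: "(u - 1\<^sub>m ?m) * w = 2 \<cdot>\<^sub>m y"
    using cayley_relations(5)[OF gw(1-3)] by (simp add: gw(4) y_def)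
  have eq: "cayley_form T n u $$ (a, b) = y $$ (a, ?m - 1 - b) * ref_sign T n b" if "a < ?m" "b < ?m" for a b
    unfolding gw(5) y_def[symmetric] by (rule ref_form_mult[OF y that])
  have sg: "ref_sign T n b \<noteq> (0::'a)" for b by (simp add: ref_sign_def)
  note X = formsD[OF cayley_form_forms[OF two u]]
  let ?j = "?m - 1 - k"
  have j: "?j < ?m" "i < ?j" using ik by linarith+
  \<comment> \<open>The symmetry of the form turns the vanishing in row k into vanishing in column
    k, that is, in column m - 1 - k of y.\<close>
  have col: "y $$ (l, ?j) = 0" if "A \<le> l" "l < ?m" for l
  proof -
    have "cayley_form T n u $$ (l, k) = 0"
      using X(2)[OF ik(2) that(2)] row_k[OF that(2,1)] by simp
    then show ?thesis using eq[OF that(2) ik(2)] sg by simp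
  qed
  have "2 * y $$ (i, ?j) = ((u - 1\<^sub>m ?m) * w) $$ (i, ?j)"
    unfolding rel using y ik j by simp
  also have "\<dots> = (\<Sum>l<?m. (u - 1\<^sub>m ?m) $$ (i, l) * w $$ (l, ?j))"
    by (rule index_mult_mat_sum[OF u1 wD(1) ik(1) j(1)])
  \<comment> \<open>For l < A the first factor can be nonzero only at l = m - 1 - k. For l \<ge> A
    the off-diagonal entries of w in this column are those of -y, which vanish.\<close>
  also have "\<dots> = (\<Sum>l<?m. if l = ?j then u $$ (i, ?j) else 0)"
  proof (intro sum.cong refl)
    fix l assume "l \<in> {..<?m}"
    then have l: "l < ?m" by simp
    have u1e: "(u - 1\<^sub>m ?m) $$ (i, l) = (if i < l then u $$ (i, l) else 0)"
      using uD l ik by (cases i l rule: linorder_cases) auto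
    show "(u - 1\<^sub>m ?m) $$ (i, l) * w $$ (l, ?j) = (if l = ?j then u $$ (i, ?j) else 0)"
    proof (cases "l = ?j")
      case True
      then show ?thesis using u1e wD(2) j by simp
    next
      case False
      have "w $$ (l, ?j) = - y $$ (l, ?j)" using False l j wD(1) by (simp add: y_def)
      then show ?thesis using False u1e row_i[of l] col[of l] l by (cases "l < A") auto
    qed
  qed
  also have "\<dots> = u $$ (i, ?j)" using j by simp
  finally have "u $$ (i, ?j) = 2 * y $$ (i, ?j)" by simp
  then show ?thesis
    unfolding eq[OF ik(1,2)] using ref_sign_square[of T n k, where 'a='a] by (simp add: mult.assoc mult.left_commute[of "ref_sign T n k"])
qed

section \<open>Elementary characters as averages\<close>

text \<open>A root corresponds to a pair \<open>i \<le> k\<close> of rows of the form matrix; its positive entry is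
  \<open>(i, m - 1 - k)\<close>. The bounds \<open>A\<close> and \<open>B\<close> describe the subgroup of the root: \<open>A = m - 1 - k\<close>
  for differences and short roots, \<open>A = n\<close> for sums and double roots.\<close>

locale root_data = form_char th m ep
  for th :: "'a::{field,finite} \<Rightarrow> complex" and m :: nat and ep :: 'a +
  fixes i k A B :: nat
  assumes ik: "i \<le> k" and reg: "i + k + 1 < m" and AB: "A + B = m" and iA: "i < A" and kB: "k < B"
    and diag: "i = k \<Longrightarrow> ep = 1 \<and> A = B" and A_cases: "k < A \<or> A = m - 1 - k"
begin

lemma i_less: "i < m" and k_less: "k < m" and A_le: "A \<le> m" and B_le: "B \<le> m"
  using reg AB by auto

text \<open>The choice B = k + 1, made for differences and short roots, encodes that these impose
  nothing on row k.\<close>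

definition root_group :: "'a mat set" where
  "root_group = {g \<in> unitriangular m. (\<forall>l. i < l \<and> l < A \<longrightarrow> g $$ (i, l) = 0) \<and>
     (\<forall>l. k < l \<and> l < B \<longrightarrow> g $$ (k, l) = 0)}"

text \<open>The image of the root subgroup under the Cayley transform. Column reversal exchanges the
  bounds: a condition up to A becomes one from B = m - A on.\<close>

definition root_forms :: "'a mat set" where
  "root_forms = {X \<in> forms m ep. (\<forall>b<m. B \<le> b \<longrightarrow> X $$ (i, b) = 0) \<and>
     (\<forall>b<m. A \<le> b \<longrightarrow> X $$ (k, b) = 0)}"

lemma finite_root_group: "finite root_group"
  using finite_unitriangular by (rule finite_subset[rotated]) (auto simp: root_group_def)

lemma one_root_group: "1\<^sub>m m \<in> root_group"
  using i_less k_less AB by (auto simp: root_group_def one_unitriangular)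

text \<open>The entry is affine in the free coordinates of g: a mixed term would need c \<ge> A and
  d \<ge> B, but X vanishes there because A + B = m.\<close>

lemma congr_root_group:
  assumes g: "g \<in> root_group" and X: "X \<in> forms m ep"
  shows "congr_act g X $$ (i, k) =
    X $$ (i, k) + (\<Sum>c\<in>{A..<m}. g $$ (i, c) * X $$ (c, k)) + (\<Sum>d\<in>{B..<m}. X $$ (i, d) * g $$ (k, d))"
proof -
  have gu: "g \<in> unitriangular m" using g by (simp add: root_group_def)
  note gD = unitriangularD[OF gu] and XD = formsD[OF X]
  have gi: "g $$ (i, c) = 0" if "c < A" "c \<noteq> i" for c
    using that g gD(3)[of c i] i_less by (cases "c < i") (auto simp: root_group_def)
  have gk: "g $$ (k, d) = 0" if "d < B" "d \<noteq> k" for d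
    using that g gD(3)[of d k] k_less by (cases "d < k") (auto simp: root_group_def)
  have split: "(\<Sum>c<m. f c) = f j + (\<Sum>c\<in>{C..<m}. f c)"
    if "j < C" "C \<le> m" "\<And>c. c < C \<Longrightarrow> c \<noteq> j \<Longrightarrow> f c = 0" for f :: "nat \<Rightarrow> 'a" and j C
  proof -
    have "(\<Sum>c<m. f c) = (\<Sum>c<C. f c) + (\<Sum>c\<in>{C..<m}. f c)"
      using that(2) by (simp add: lessThan_atLeast0 sum.atLeastLessThan_concat)
    also have "(\<Sum>c<C. f c) = (\<Sum>c<C. if c = j then f j else 0)"
      using that(3) by (intro sum.cong refl) auto
    finally show ?thesis using that(1) by simp
  qed
  have row: "(\<Sum>d<m. g $$ (i, c) * X $$ (c, d) * g $$ (k, d)) =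
      g $$ (i, c) * (X $$ (c, k) + (\<Sum>d\<in>{B..<m}. X $$ (c, d) * g $$ (k, d)))" for c
    using split[OF kB B_le, of "\<lambda>d. g $$ (i, c) * X $$ (c, d) * g $$ (k, d)"] gk gD(2)[OF k_less]
    by (simp add: sum_distrib_left distrib_left mult.assoc)
  have "congr_act g X $$ (i, k) =
      (\<Sum>c<m. g $$ (i, c) * (X $$ (c, k) + (\<Sum>d\<in>{B..<m}. X $$ (c, d) * g $$ (k, d))))"
    unfolding index_congr_act[OF gD(1) XD(1) i_less k_less] row ..
  also have "\<dots> = (X $$ (i, k) + (\<Sum>d\<in>{B..<m}. X $$ (i, d) * g $$ (k, d))) +
      (\<Sum>c\<in>{A..<m}. g $$ (i, c) * (X $$ (c, k) + (\<Sum>d\<in>{B..<m}. X $$ (c, d) * g $$ (k, d))))"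
    using split[OF iA A_le, of "\<lambda>c. g $$ (i, c) * (X $$ (c, k) + (\<Sum>d\<in>{B..<m}. X $$ (c, d) * g $$ (k, d)))"]
      gi gD(2)[OF i_less] by simp
  also have "(\<Sum>c\<in>{A..<m}. g $$ (i, c) * (X $$ (c, k) + (\<Sum>d\<in>{B..<m}. X $$ (c, d) * g $$ (k, d)))) =
      (\<Sum>c\<in>{A..<m}. g $$ (i, c) * X $$ (c, k))"
  proof (intro sum.cong refl)
    fix c assume c: "c \<in> {A..<m}"
    have "(\<Sum>d\<in>{B..<m}. X $$ (c, d) * g $$ (k, d)) = 0"
    proof (intro sum.neutral ballI)
      fix d assume "d \<in> {B..<m}"
      then have "X $$ (c, d) = 0" using c AB by (intro XD(3)) auto
      then show "X $$ (c, d) * g $$ (k, d) = 0" by simp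
    qed
    then show "g $$ (i, c) * (X $$ (c, k) + (\<Sum>d\<in>{B..<m}. X $$ (c, d) * g $$ (k, d))) = g $$ (i, c) * X $$ (c, k)"
      by simp
  qed
  finally show ?thesis by (simp add: add_ac)
qed

definition bump :: "nat \<Rightarrow> nat \<Rightarrow> 'a \<Rightarrow> 'a mat \<Rightarrow> 'a mat" where
  "bump a b t g = mat m m (\<lambda>(c, d). if c = a \<and> d = b then g $$ (c, d) + t else g $$ (c, d))"

text \<open>If the rows i and k coincide, the changed position must be free with respect to both
  bounds.\<close>

lemma bump_root_group:
  assumes "a = i \<and> A \<le> b \<and> (k = i \<longrightarrow> B \<le> b) \<or> a = k \<and> B \<le> b \<and> (k = i \<longrightarrow> A \<le> b)"
    and "b < m" "g \<in> root_group"
  shows "bump a b t g \<in> root_group"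
proof -
  have "g \<in> unitriangular m" using assms(3) by (simp add: root_group_def)
  note gD = unitriangularD[OF this]
  have "a < b" using assms(1) iA kB by auto
  have "bump a b t g \<in> unitriangular m"
    using gD \<open>a < b\<close> by (intro unitriangularI) (auto simp: bump_def)
  then show ?thesis
    using assms i_less k_less A_le B_le by (auto simp: root_group_def bump_def)
qed

lemma sum_root_group_zero:
  assumes ab: "a = i \<and> A \<le> b \<and> (k = i \<longrightarrow> B \<le> b) \<or> a = k \<and> B \<le> b \<and> (k = i \<longrightarrow> A \<le> b)" "b < m"
    and shift: "\<And>g t. g \<in> root_group \<Longrightarrow> f (bump a b t g) = f g + t * q" and q: "q \<noteq> 0"
  shows "(\<Sum>g\<in>root_group. th (f g)) = 0"
proof -
  obtain s where s: "th s \<noteq> 1" using th_nontrivial by auto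
  have inv: "bump a b (- t) (bump a b t g) = g" if "g \<in> root_group" for g t
    using that by (intro eq_matI) (auto simp: bump_def root_group_def dest: unitriangularD(1))
  have "(\<Sum>g\<in>root_group. th (f g)) = (\<Sum>g\<in>root_group. th (f (bump a b (s / q) g)))"
  proof (rule sum.reindex_bij_witness[where i="bump a b (s / q)" and j="bump a b (- (s / q))"])
    fix g assume g: "g \<in> root_group"
    show "bump a b (s / q) g \<in> root_group" "bump a b (- (s / q)) g \<in> root_group"
      by (rule bump_root_group[OF ab g])+
    show "bump a b (- (s / q)) (bump a b (s / q) g) = g" by (rule inv[OF g])
    show eq: "bump a b (s / q) (bump a b (- (s / q)) g) = g" using inv[OF g, of "- (s / q)"] by simp
    show "th (f (bump a b (s / q) (bump a b (- (s / q)) g))) = th (f g)" unfolding eq ..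
  qed
  also have "\<dots> = (\<Sum>g\<in>root_group. th (f g)) * th s"
    unfolding sum_distrib_right using q by (intro sum.cong refl) (simp add: shift th_add)
  finally show ?thesis using s by simp
qed

text \<open>On \<open>root_forms\<close> all coefficients of the affine function vanish and it is
  constant. Otherwise some free coordinate has a nonzero coefficient, and translating it shows that
  the sum is zero.\<close>

lemma sum_root_group:
  assumes X: "X \<in> forms m ep" and r: "r \<noteq> 0"
  shows "(\<Sum>g\<in>root_group. th (r * congr_act g X $$ (i, k))) =
    (if X \<in> root_forms then of_nat (card root_group) * th (r * X $$ (i, k)) else 0)"
proof -
  note XD = formsD[OF X]
  define L where "L g = (\<Sum>c\<in>{A..<m}. g $$ (i, c) * X $$ (c, k))" for g :: "'a mat"
  define R where "R g = (\<Sum>d\<in>{B..<m}. X $$ (i, d) * g $$ (k, d))" for g :: "'a mat"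
  have f: "congr_act g X $$ (i, k) = X $$ (i, k) + L g + R g" if "g \<in> root_group" for g
    unfolding L_def R_def by (rule congr_root_group[OF that X])
  have Lb: "L (bump a b t g) = L g + (if a = i \<and> A \<le> b then t * X $$ (b, k) else 0)" if "b < m" for a b t g
  proof -
    have "L (bump a b t g) = (\<Sum>c\<in>{A..<m}. g $$ (i, c) * X $$ (c, k) +
        (if c = b then if a = i then t * X $$ (b, k) else 0 else 0))"
      unfolding L_def using i_less by (intro sum.cong refl) (auto simp: bump_def distrib_right)
    then show ?thesis using that by (simp add: sum.distrib L_def)
  qed
  have Rb: "R (bump a b t g) = R g + (if a = k \<and> B \<le> b then t * X $$ (i, b) else 0)" if "b < m" for a b t g
  proof -
    have "R (bump a b t g) = (\<Sum>c\<in>{B..<m}. X $$ (i, c) * g $$ (k, c) +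
        (if c = b then if a = k then t * X $$ (i, b) else 0 else 0))"
      unfolding R_def using k_less by (intro sum.cong refl) (auto simp: bump_def distrib_left mult.commute)
    then show ?thesis using that by (simp add: sum.distrib R_def)
  qed
  consider "X \<in> root_forms" | b where "b < m" "B \<le> b" "X $$ (i, b) \<noteq> 0"
    | b where "b < m" "A \<le> b" "X $$ (k, b) \<noteq> 0" "i \<noteq> k"
  proof (cases "X \<in> root_forms")
    case False
    then obtain b where "b < m" "B \<le> b \<and> X $$ (i, b) \<noteq> 0 \<or> A \<le> b \<and> X $$ (k, b) \<noteq> 0"
      using X unfolding root_forms_def by blast
    then show ?thesis using that diag by (cases "i = k") auto
  qed
  then show ?thesis
  proof cases
    case 1
    have "L g = 0" for g
    proof -
      have "X $$ (c, k) = 0" if "c \<in> {A..<m}" for c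
        using that 1 XD(2)[OF k_less, of c] by (simp add: root_forms_def)
      then show ?thesis by (simp add: L_def)
    qed
    moreover have "R g = 0" for g
      unfolding R_def using 1 by (intro sum.neutral) (auto simp: root_forms_def)
    ultimately have "(\<Sum>g\<in>root_group. th (r * congr_act g X $$ (i, k))) = (\<Sum>g\<in>root_group. th (r * X $$ (i, k)))"
      by (intro sum.cong refl) (simp add: f)
    then show ?thesis using 1 by simp
  next
    case (2 b)
    have ab: "k = i \<and> A \<le> b \<and> (k = i \<longrightarrow> B \<le> b) \<or> k = k \<and> B \<le> b \<and> (k = i \<longrightarrow> A \<le> b)"
      using 2 diag by auto
    \<comment> \<open>For i = k both linear sums contain the same entry of g, so its coefficient is
      doubled.\<close>
    define q where "q = r * ((if i = k then 2 else 1) * X $$ (i, b))"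
    have "q \<noteq> 0" using 2 r two by (simp add: q_def)
    have "r * congr_act (bump k b t g) X $$ (i, k) = r * congr_act g X $$ (i, k) + t * q" if "g \<in> root_group" for g t
    proof (cases "i = k")
      case True
      then have "ep = 1" "A = B" using diag by auto
      then have "X $$ (b, k) = X $$ (i, b)" using XD(2)[OF i_less \<open>b < m\<close>] True by simp
      then show ?thesis
        unfolding f[OF that] f[OF bump_root_group[OF ab \<open>b < m\<close> that]] Lb[OF \<open>b < m\<close>] Rb[OF \<open>b < m\<close>]
        using True \<open>A = B\<close> 2 by (simp add: q_def algebra_simps)
    next
      case False
      then show ?thesis
        unfolding f[OF that] f[OF bump_root_group[OF ab \<open>b < m\<close> that]] Lb[OF \<open>b < m\<close>] Rb[OF \<open>b < m\<close>]
        using 2 by (simp add: q_def algebra_simps)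
    qed
    then have "(\<Sum>g\<in>root_group. th (r * congr_act g X $$ (i, k))) = 0"
      by (intro sum_root_group_zero[OF ab \<open>b < m\<close> _ \<open>q \<noteq> 0\<close>])
    moreover have "X \<notin> root_forms" using 2 by (auto simp: root_forms_def)
    ultimately show ?thesis by simp
  next
    case (3 b)
    have ab: "i = i \<and> A \<le> b \<and> (k = i \<longrightarrow> B \<le> b) \<or> i = k \<and> B \<le> b \<and> (k = i \<longrightarrow> A \<le> b)"
      using 3 by auto
    define q where "q = r * X $$ (b, k)"
    have "q \<noteq> 0" using 3 r XD(2)[OF \<open>b < m\<close> k_less] by (auto simp: q_def)
    have "r * congr_act (bump i b t g) X $$ (i, k) = r * congr_act g X $$ (i, k) + t * q" if "g \<in> root_group" for g t
      unfolding f[OF that] f[OF bump_root_group[OF ab \<open>b < m\<close> that]] Lb[OF \<open>b < m\<close>] Rb[OF \<open>b < m\<close>]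
      using 3 by (simp add: q_def algebra_simps)
    then have "(\<Sum>g\<in>root_group. th (r * congr_act g X $$ (i, k))) = 0"
      by (intro sum_root_group_zero[OF ab \<open>b < m\<close> _ \<open>q \<noteq> 0\<close>])
    moreover have "X \<notin> root_forms" using 3 by (auto simp: root_forms_def)
    ultimately show ?thesis by simp
  qed
qed

text \<open>The coordinates of \<open>g\<close> that are forced to vanish on \<open>root_group\<close> are stored in a form; this
  trades \<open>unitriangular m \<times> root_forms\<close> for \<open>forms m ep \<times> root_group\<close>.\<close>

definition stored :: "'a mat \<Rightarrow> nat \<Rightarrow> nat \<Rightarrow> 'a" where
  "stored g a b = (if a + b + 1 < m \<and> (a = i \<and> B \<le> b \<or> a = k \<and> i \<noteq> k \<and> A \<le> b) then g $$ (a, m - 1 - b) else 0)"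

definition stored_form :: "'a mat \<Rightarrow> 'a mat" where
  "stored_form g = mat m m (\<lambda>(a, b). stored g a b + ep * stored g b a)"

definition cleared_part :: "'a mat \<Rightarrow> 'a mat" where
  "cleared_part g = mat m m (\<lambda>(a, b). if a = i \<and> i < b \<and> b < A \<or> a = k \<and> k < b \<and> b < B then 0 else g $$ (a, b))"

lemma stored_form_forms: "stored_form g \<in> forms m ep"
proof (rule formsI)
  fix a b assume ab: "a < m" "b < m"
  have "ep * (ep * x) = x" for x using ep_square by (simp add: mult.assoc[symmetric])
  then show "stored_form g $$ (b, a) = ep * stored_form g $$ (a, b)"
    using ab by (simp add: stored_form_def distrib_left add.commute)
  show "stored_form g $$ (a, b) = 0" if "m \<le> a + b + 1"
    using ab that by (simp add: stored_form_def stored_def)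
qed (simp add: stored_form_def)

text \<open>The position of a stored coordinate never collides with the mirror image of another one.
  For row k this is due to \<open>A_cases\<close>: either k < A, so position k lies outside the
  stored range, or the range of l is empty.\<close>

lemma stored_form_index:
  shows "i < l \<Longrightarrow> l < A \<Longrightarrow> stored_form g $$ (i, m - 1 - l) = g $$ (i, l)"
    and "i \<noteq> k \<Longrightarrow> k < l \<Longrightarrow> l < B \<Longrightarrow> stored_form g $$ (k, m - 1 - l) = g $$ (k, l)"
proof -
  show "stored_form g $$ (i, m - 1 - l) = g $$ (i, l)" if l: "i < l" "l < A"
  proof -
    define b where "b = m - 1 - l"
    have b: "b < m" "B \<le> b" "i + b + 1 < m" "m - 1 - b = l" "b \<noteq> i" "b \<noteq> k"
      unfolding b_def using l AB ik kB by linarith+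
    then have "stored g i b = g $$ (i, l)" "stored g b i = 0" by (auto simp: stored_def)
    then show ?thesis using b(1) i_less unfolding b_def[symmetric] by (simp add: stored_form_def)
  qed
  show "stored_form g $$ (k, m - 1 - l) = g $$ (k, l)" if l: "i \<noteq> k" "k < l" "l < B"
  proof -
    define b where "b = m - 1 - l"
    have b: "b < m" "A \<le> b" "k + b + 1 < m" "m - 1 - b = l" "b \<noteq> i"
      unfolding b_def using l AB ik iA by linarith+
    have "b \<noteq> k" using A_cases b by auto
    then have "stored g k b = g $$ (k, l)" "stored g b k = 0" using b l by (auto simp: stored_def)
    then show ?thesis using b(1) k_less unfolding b_def[symmetric] by (simp add: stored_form_def)
  qed
qed

lemma cleared_part_root_group:
  assumes "g \<in> unitriangular m"
  shows "cleared_part g \<in> root_group"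
proof -
  note gD = unitriangularD[OF assms]
  have "cleared_part g \<in> unitriangular m"
    using gD by (intro unitriangularI) (auto simp: cleared_part_def)
  then show ?thesis
    using i_less k_less A_le B_le by (auto simp: root_group_def cleared_part_def)
qed

text \<open>An element Y of \<open>root_forms\<close> vanishes at the storage positions in rows i
  and k, so the sum reveals the stored coordinates. With \<open>cleared_part\<close> these determine
  g, and then Y. An inequality is enough, since \<open>card_factors_le\<close> bounds the fibres
  from the other side.\<close>

lemma card_root_le:
  "card (unitriangular m :: 'a mat set) * card root_forms \<le> card (forms m ep) * card root_group"
proof -
  have "inj_on (\<lambda>(g, Y). (Y + stored_form g, cleared_part g)) (unitriangular m \<times> root_forms)"
  proof (rule inj_onI, clarify)
    fix g Y g' Y'
    assume g: "g \<in> unitriangular m" "g' \<in> unitriangular m" and Y: "Y \<in> root_forms" "Y' \<in> root_forms"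
      and eq: "Y + stored_form g = Y' + stored_form g'" "cleared_part g = cleared_part g'"
    have Yc: "Y \<in> carrier_mat m m" "Y' \<in> carrier_mat m m" using Y by (auto simp: root_forms_def formsD(1))
    have Sc: "stored_form h \<in> carrier_mat m m" for h by (simp add: stored_form_def)
    have add: "Y $$ (a, b) + stored_form g $$ (a, b) = Y' $$ (a, b) + stored_form g' $$ (a, b)"
      if "a < m" "b < m" for a b
      using arg_cong[OF eq(1), of "\<lambda>M. M $$ (a, b)"] that Yc Sc[of g] Sc[of g'] by simp
    have gi: "g $$ (i, l) = g' $$ (i, l)" if "i < l" "l < A" for l
    proof -
      have "B \<le> m - 1 - l" "m - 1 - l < m" using that AB by linarith+
      then have "Y $$ (i, m - 1 - l) = 0" "Y' $$ (i, m - 1 - l) = 0" using Y by (auto simp: root_forms_def)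
      then show ?thesis
        using add[OF i_less \<open>m - 1 - l < m\<close>] stored_form_index(1)[OF that] by simp
    qed
    have gk: "g $$ (k, l) = g' $$ (k, l)" if "k < l" "l < B" for l
    proof (cases "i = k")
      case True then show ?thesis using gi that diag by auto
    next
      case False
      have "A \<le> m - 1 - l" "m - 1 - l < m" using that AB by linarith+
      then have "Y $$ (k, m - 1 - l) = 0" "Y' $$ (k, m - 1 - l) = 0" using Y by (auto simp: root_forms_def)
      then show ?thesis
        using add[OF k_less \<open>m - 1 - l < m\<close>] stored_form_index(2)[OF False that] by simp
    qed
    have "g = g'"
    proof (rule eq_matI)
      fix a b assume "a < dim_row g'" "b < dim_col g'"
      then have ab: "a < m" "b < m" using unitriangularD(1)[OF g(2)] by auto
      show "g $$ (a, b) = g' $$ (a, b)"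
      proof (cases "a = i \<and> i < b \<and> b < A \<or> a = k \<and> k < b \<and> b < B")
        case True then show ?thesis using gi gk by auto
      next
        case False
        then show ?thesis using arg_cong[OF eq(2), of "\<lambda>M. M $$ (a, b)"] ab by (auto simp: cleared_part_def)
      qed
    qed (use g in \<open>auto dest: unitriangularD(1)\<close>)
    moreover from this have "Y = Y'"
      using add Yc by (intro eq_matI) auto
    ultimately show "g = g' \<and> Y = Y'" by simp
  qed
  moreover have "(\<lambda>(g, Y). (Y + stored_form g, cleared_part g)) ` (unitriangular m \<times> root_forms) \<subseteq>
      forms m ep \<times> root_group"
    using cleared_part_root_group stored_form_forms by (auto simp: root_forms_def intro: add_forms)
  ultimately have "card ((unitriangular m :: 'a mat set) \<times> root_forms) \<le> card (forms m ep \<times> root_group)"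
    by (rule card_inj_on_le) (simp add: finite_forms finite_root_group)
  then show ?thesis by (simp add: card_cartesian_product)
qed

lemma root_group_mult_row:
  assumes p: "p \<in> root_group" and t: "t \<in> unitriangular m"
  shows "l < A \<Longrightarrow> (p * t) $$ (i, l) = t $$ (i, l)" and "l < B \<Longrightarrow> (p * t) $$ (k, l) = t $$ (k, l)"
proof -
  have pu: "p \<in> unitriangular m" using p by (simp add: root_group_def)
  note pD = unitriangularD[OF pu] and tD = unitriangularD[OF t]
  have row: "(p * t) $$ (a, l) = t $$ (a, l)" if a: "a < m" and C: "C \<le> m" "l < C" and z: "\<And>c. a < c \<Longrightarrow> c < C \<Longrightarrow> p $$ (a, c) = 0" for a C l
  proof -
    have lm: "l < m" using C by simp
    have "(p * t) $$ (a, l) = (\<Sum>c<m. if c = a then t $$ (a, l) else 0)"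
      unfolding index_mult_mat_sum[OF pD(1) tD(1) a lm]
    proof (intro sum.cong refl)
      fix c assume "c \<in> {..<m}"
      then show "p $$ (a, c) * t $$ (c, l) = (if c = a then t $$ (a, l) else 0)"
        using pD(2)[OF a] pD(3)[of c a] a z[of c] tD(3)[of l c] C
        by (cases c a rule: linorder_cases; cases "c < C") auto
    qed
    then show ?thesis using a by simp
  qed
  show "l < A \<Longrightarrow> (p * t) $$ (i, l) = t $$ (i, l)"
    using p by (intro row[OF i_less A_le]) (auto simp: root_group_def)
  show "l < B \<Longrightarrow> (p * t) $$ (k, l) = t $$ (k, l)"
    using p by (intro row[OF k_less B_le]) (auto simp: root_group_def)
qed

text \<open>Membership looks only at initial segments of rows i and k, and left multiplication by p
  does not change them.\<close>

lemma root_group_cancel: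
  assumes "p \<in> root_group" "t \<in> unitriangular m"
  shows "p * t \<in> root_group \<longleftrightarrow> t \<in> root_group"
proof -
  have "p * t \<in> unitriangular m"
    using assms by (intro unitriangular_mult) (auto simp: root_group_def)
  then show ?thesis
    using assms(2) by (auto simp: root_group_def[unfolded atomize_eq] root_group_mult_row[OF assms])
qed

end

section \<open>Root subgroups of U and the product decomposition\<close>

locale unipotent_root = root_data th "mat_size T n" "form_sign T" i k A B
  for th :: "'a::{field,finite} \<Rightarrow> complex" and T :: classical and n i k A B :: nat
begin

abbreviation "size_m \<equiv> mat_size T n"

abbreviation "root_subgroup \<equiv> isometries T n \<inter> root_group"

lemma cayley_form_root_forms:
  assumes u: "u \<in> isometries T n"
  shows "cayley_form T n u \<in> root_forms \<longleftrightarrow> u \<in> root_group"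
proof -
  note uu = isometries_unitriangular[OF u]
  have e: "size_m \<le> b + A \<longleftrightarrow> B \<le> b" "size_m \<le> b + B \<longleftrightarrow> A \<le> b" for b using AB by auto
  show ?thesis
    using cayley_form_row[OF two uu i_less A_le] cayley_form_row[OF two uu k_less B_le]
      cayley_form_forms[OF two u] uu
    unfolding root_forms_def root_group_def e by blast
qed

lemma root_entry:
  assumes u: "u \<in> root_subgroup"
  shows "u $$ (i, size_m - 1 - k) = 2 * ref_sign T n k * cayley_form T n u $$ (i, k)"
proof (rule cayley_form_entry[OF two _ i_less k_less reg])
  have X: "cayley_form T n u \<in> root_forms" using u cayley_form_root_forms by blast
  show "u \<in> isometries T n" using u by simp
  show "u $$ (i, l) = 0" if "i < l" "l < A" for l using u that by (simp add: root_group_def)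
  show "cayley_form T n u $$ (k, b) = 0" if "b < size_m" "A \<le> b" for b
    using X that by (simp add: root_forms_def)
qed

lemma card_isometries: "card (isometries T n :: 'a mat set) = card (forms size_m (form_sign T :: 'a))"
  by (rule bij_betw_same_card[OF bij_betw_cayley_form[OF two]])

lemma card_root_subgroup: "card root_subgroup = card root_forms"
proof -
  have "inj_on (cayley_form T n) root_subgroup"
    by (rule inj_on_subset[OF cayley_form_inj[OF two]]) blast
  moreover have "cayley_form T n ` root_subgroup = root_forms"
  proof (intro equalityI subsetI)
    fix X assume "X \<in> cayley_form T n ` root_subgroup"
    then show "X \<in> root_forms" using cayley_form_root_forms by blast
  next
    fix X assume X: "X \<in> root_forms"
    then have "X \<in> forms size_m (form_sign T)" by (simp add: root_forms_def)
    then obtain u where "u \<in> isometries T n" "cayley_form T n u = X" using cayley_form_surj[OF two] by blast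
    then show "X \<in> cayley_form T n ` root_subgroup" using X cayley_form_root_forms by blast
  qed
  ultimately show ?thesis using card_image by fastforce
qed

lemma finite_isometries: "finite (isometries T n :: 'a mat set)"
  by (rule finite_subset[OF _ finite_unitriangular[of size_m]]) (auto simp: isometries_def)

lemma card_root_subgroup_pos: "card root_subgroup > 0"
  using one_isometries one_root_group finite_isometries by (auto simp: card_gt_0_iff)

text \<open>The U-components of the factorizations x = p h; its size is that of the fibre over x,
  since p is determined by h.\<close>

definition factors :: "'a mat \<Rightarrow> 'a mat set" where
  "factors x = {h \<in> isometries T n. \<exists>p\<in>root_group. p * h = x}"

lemma sum_factors:
  fixes f :: "'a mat \<Rightarrow> complex"
  shows "(\<Sum>h\<in>isometries T n. \<Sum>g\<in>root_group. f (g * h)) =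
    (\<Sum>x\<in>unitriangular size_m. of_nat (card (factors x)) * f x)"
proof -
  have inner: "(\<Sum>g\<in>root_group. f (g * h)) = (\<Sum>x | x \<in> unitriangular size_m \<and> (\<exists>p\<in>root_group. p * h = x). f x)"
    if h: "h \<in> isometries T n" for h
  proof -
    obtain k where k: "k \<in> unitriangular size_m" "h * k = 1\<^sub>m size_m"
      using unitriangular_inverse[OF isometries_unitriangular[OF h]] by blast
    have "inj_on (\<lambda>g. g * h) root_group"
    proof (rule inj_on_inverseI[where g="\<lambda>x. x * k"])
      fix g assume "g \<in> root_group"
      then have "g \<in> carrier_mat size_m size_m" by (auto simp: root_group_def dest: unitriangularD(1))
      then show "g * h * k = g"
        using assoc_mult_mat[of g size_m size_m h size_m k size_m] k isometries_carrier[OF h] unitriangularD(1)[OF k(1)]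
        by simp
    qed
    moreover have "(\<lambda>g. g * h) ` root_group = {x \<in> unitriangular size_m. \<exists>p\<in>root_group. p * h = x}"
      using unitriangular_mult[OF _ isometries_unitriangular[OF h]] by (auto simp: root_group_def)
    ultimately show ?thesis using sum.reindex[of "\<lambda>g. g * h" root_group f] by simp
  qed
  have "(\<Sum>h\<in>isometries T n. \<Sum>g\<in>root_group. f (g * h)) =
    (\<Sum>h\<in>isometries T n. \<Sum>x | x \<in> unitriangular size_m \<and> (\<exists>p\<in>root_group. p * h = x). f x)"
    by (intro sum.cong refl inner)
  also have "\<dots> = (\<Sum>x\<in>unitriangular size_m. \<Sum>h | h \<in> isometries T n \<and> (\<exists>p\<in>root_group. p * h = x). f x)"
    by (rule sum.swap_restrict[OF finite_isometries finite_unitriangular])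
  finally show ?thesis by (simp add: factors_def)
qed

text \<open>Once one factorization x = q h is fixed, any other factor u differs from h by u h^-1,
  which lies in U and, by cancellation, also in \<open>root_group\<close>.\<close>

lemma card_factors_le:
  assumes x: "x \<in> unitriangular size_m"
  shows "card (factors x) \<le> card root_subgroup"
proof (cases "factors x = {}")
  case False
  then obtain h q where h: "h \<in> isometries T n" and q: "q \<in> root_group" "q * h = x"
    by (auto simp: factors_def)
  obtain k where k: "k \<in> isometries T n" "h * k = 1\<^sub>m size_m" "k * h = 1\<^sub>m size_m"
    using isometries_inverse[OF h] by blast
  note hc = isometries_carrier[OF h] and kc = isometries_carrier[OF k(1)]
  have "inj_on (\<lambda>u. u * k) (factors x)"
  proof (rule inj_on_inverseI[where g="\<lambda>u. u * h"])
    fix u assume "u \<in> factors x"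
    then have "u \<in> carrier_mat size_m size_m" by (auto simp: factors_def isometries_carrier)
    then show "u * k * h = u"
      using assoc_mult_mat[of u size_m size_m k size_m h size_m] k hc kc by simp
  qed
  moreover have "(\<lambda>u. u * k) ` factors x \<subseteq> root_subgroup"
  proof
    fix v assume "v \<in> (\<lambda>u. u * k) ` factors x"
    then obtain u p where u: "u \<in> isometries T n" "v = u * k" and p: "p \<in> root_group" "p * u = x"
      by (auto simp: factors_def)
    have pc: "p \<in> carrier_mat size_m size_m" and qc: "q \<in> carrier_mat size_m size_m"
      using p q by (auto simp: root_group_def dest: unitriangularD(1))
    have v: "v \<in> isometries T n" using isometries_mult[OF u(1) k(1)] u by simp
    have "p * v = x * k" using assoc_mult_mat[OF pc isometries_carrier[OF u(1)] kc] u p by simp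
    also have "\<dots> = q" using assoc_mult_mat[OF qc hc kc] k(2) qc q(2) by simp
    finally have "v \<in> root_group"
      using root_group_cancel[OF p(1) isometries_unitriangular[OF v]] q(1) by simp
    with v show "v \<in> root_subgroup" by simp
  qed
  ultimately show ?thesis
    by (rule card_inj_on_le) (simp add: finite_root_group)
qed simp

text \<open>The counting inequality forces every fibre of multiplication to have full size; in
  particular \<open>unitriangular m\<close> is the product of \<open>root_group\<close> and the isometry group.\<close>

lemma card_factors:
  assumes x: "x \<in> unitriangular size_m"
  shows "card (factors x) = card root_subgroup"
proof (rule ccontr)
  let ?G = "unitriangular size_m :: 'a mat set"
  assume ne: "card (factors x) \<noteq> card root_subgroup"
  have "complex_of_nat (card (isometries T n :: 'a mat set) * card root_group) = of_nat (\<Sum>x\<in>?G. card (factors x))"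
    using sum_factors[of "\<lambda>_. 1"] by simp
  then have "card (isometries T n :: 'a mat set) * card root_group = (\<Sum>x\<in>?G. card (factors x))"
    by (simp only: of_nat_eq_iff)
  \<comment> \<open>One deficient fibre would give |U| |K| < |G| |U cap K|, against
    \<open>card_root_le\<close>.\<close>
  also have "\<dots> < (\<Sum>x\<in>?G. card root_subgroup)"
    using x ne card_factors_le finite_unitriangular by (intro sum_strict_mono_ex1) (auto simp: less_le)
  finally show False
    using card_root_le card_isometries card_root_subgroup by simp
qed

lemma sum_root_fibres:
  fixes f :: "'a mat \<Rightarrow> complex"
  shows "(\<Sum>h\<in>isometries T n. \<Sum>g\<in>root_group. f (g * h)) =
    of_nat (card root_subgroup) * (\<Sum>x\<in>unitriangular size_m. f x)"
  unfolding sum_factors sum_distrib_left by (intro sum.cong refl) (simp add: card_factors)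

text \<open>In the induction formula, \<open>sum_root_group\<close> replaces the indicator function
  of the root subgroup by an average over K. The resulting double sum over U and K then collapses to
  a sum over all unitriangular matrices.\<close>

lemma induced_root_char:
  assumes r: "r \<noteq> 0" and u: "u \<in> isometries T n"
  shows "induced_char (U_group T n) root_subgroup (\<lambda>x. th (r * x $$ (i, size_m - 1 - k))) u =
    of_nat (card (unitriangular size_m :: 'a mat set)) / of_nat (card root_group) *
    avg_char (unit_form size_m (form_sign T) i k (r * ref_sign T n k)) (cayley_form T n u)"
proof -
  interpret U: group "U_group T n :: 'a mat monoid" by (rule group_U)
  let ?U = "U_group T n :: 'a mat monoid" and ?H = root_subgroup
  define \<chi> where "\<chi> x = th (r * x $$ (i, size_m - 1 - k))" for x :: "'a mat"
  define X where "X = cayley_form T n u"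
  \<comment> \<open>The factor that \<open>root_entry\<close> introduces when the matrix entry is
    replaced by the entry of the Cayley form.\<close>
  define \<rho> where "\<rho> = 2 * r * ref_sign T n k"
  have \<rho>: "\<rho> \<noteq> 0" using r two by (simp add: \<rho>_def ref_sign_def)
  have X: "X \<in> forms size_m (form_sign T)" unfolding X_def by (rule cayley_form_forms[OF two u])
  have inv: "inv\<^bsub>?U\<^esub> h \<in> isometries T n" "h * inv\<^bsub>?U\<^esub> h = 1\<^sub>m size_m" "inv\<^bsub>?U\<^esub> h * h = 1\<^sub>m size_m"
    if "h \<in> isometries T n" for h
    using that U.inv_closed[of h] U.r_inv[of h] U.l_inv[of h] by (simp_all add: U_group_simps)
  have "(\<Sum>x | x \<in> carrier ?U \<and> inv\<^bsub>?U\<^esub> x \<otimes>\<^bsub>?U\<^esub> u \<otimes>\<^bsub>?U\<^esub> x \<in> ?H. \<chi> (inv\<^bsub>?U\<^esub> x \<otimes>\<^bsub>?U\<^esub> u \<otimes>\<^bsub>?U\<^esub> x)) =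
    (\<Sum>x\<in>carrier ?U. if inv\<^bsub>?U\<^esub> x \<otimes>\<^bsub>?U\<^esub> u \<otimes>\<^bsub>?U\<^esub> x \<in> ?H then \<chi> (inv\<^bsub>?U\<^esub> x \<otimes>\<^bsub>?U\<^esub> u \<otimes>\<^bsub>?U\<^esub> x) else 0)"
    by (rule sum.inter_filter) (simp add: U_group_simps finite_isometries)
  \<comment> \<open>Substituting h for the inverse of x puts the conjugate into the shape h u h^-1,
    for which \<open>cayley_form_conj\<close> is stated.\<close>
  also have "\<dots> = (\<Sum>h\<in>isometries T n. if h * u * inv\<^bsub>?U\<^esub> h \<in> ?H then \<chi> (h * u * inv\<^bsub>?U\<^esub> h) else 0)"
    by (rule sum.reindex_bij_witness[where i="\<lambda>h. inv\<^bsub>?U\<^esub> h" and j="\<lambda>h. inv\<^bsub>?U\<^esub> h"])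
      (simp_all add: U.inv_inv[unfolded U_group_simps] inv(1) U_group_simps(1) U_group_simps(2))
  also have "\<dots> = (\<Sum>h\<in>isometries T n. if congr_act h X \<in> root_forms then th (\<rho> * congr_act h X $$ (i, k)) else 0)"
  proof (intro sum.cong refl)
    fix h :: "'a mat" assume h: "h \<in> isometries T n"
    define v where "v = h * u * inv\<^bsub>?U\<^esub> h"
    have v: "v \<in> isometries T n" unfolding v_def using h u inv(1)[OF h] by (auto intro: isometries_mult)
    have cv: "cayley_form T n v = congr_act h X"
      unfolding v_def X_def by (rule cayley_form_conj[OF two u h inv[OF h]])
    have "v \<in> ?H \<longleftrightarrow> congr_act h X \<in> root_forms"
      using cayley_form_root_forms[OF v] v cv by simp
    moreover have "\<chi> v = th (\<rho> * congr_act h X $$ (i, k))" if "v \<in> ?H"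
      using root_entry[OF that] by (simp add: \<chi>_def cv \<rho>_def mult_ac del: index_mult_mat(1))
    ultimately show "(if v \<in> ?H then \<chi> v else 0) =
      (if congr_act h X \<in> root_forms then th (\<rho> * congr_act h X $$ (i, k)) else 0)" by simp
  qed
  also have "\<dots> = (\<Sum>h\<in>isometries T n. (\<Sum>g\<in>root_group. th (\<rho> * congr_act (g * h) X $$ (i, k))) / of_nat (card root_group))"
  proof (intro sum.cong refl)
    fix h :: "'a mat" assume h: "h \<in> isometries T n"
    have Xh: "congr_act h X \<in> forms size_m (form_sign T)"
      by (rule congr_act_forms[OF isometries_unitriangular[OF h] X])
    have "(\<Sum>g\<in>root_group. th (\<rho> * congr_act (g * h) X $$ (i, k))) =
        (\<Sum>g\<in>root_group. th (\<rho> * congr_act g (congr_act h X) $$ (i, k)))"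
    proof (intro sum.cong refl)
      fix g assume "g \<in> root_group"
      then have gc: "g \<in> carrier_mat size_m size_m" by (auto simp: root_group_def dest: unitriangularD(1))
      show "th (\<rho> * congr_act (g * h) X $$ (i, k)) = th (\<rho> * congr_act g (congr_act h X) $$ (i, k))"
        unfolding congr_act_mult[OF gc isometries_carrier[OF h] formsD(1)[OF X]] ..
    qed
    moreover have "card root_group \<noteq> 0"
      using one_root_group finite_root_group by (auto simp: card_eq_0_iff)
    ultimately show "(if congr_act h X \<in> root_forms then th (\<rho> * congr_act h X $$ (i, k)) else 0) =
      (\<Sum>g\<in>root_group. th (\<rho> * congr_act (g * h) X $$ (i, k))) / of_nat (card root_group)"
      unfolding sum_root_group[OF Xh \<rho>] by simp
  qed
  also have "\<dots> = of_nat (card ?H) * (\<Sum>x\<in>unitriangular size_m. th (\<rho> * congr_act x X $$ (i, k))) / of_nat (card root_group)"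
    unfolding sum_divide_distrib[symmetric]
    using sum_root_fibres[of "\<lambda>x. th (\<rho> * congr_act x X $$ (i, k))"] by simp
  also have "(\<Sum>x\<in>unitriangular size_m. th (\<rho> * congr_act x X $$ (i, k))) =
      of_nat (card (unitriangular size_m :: 'a mat set)) * avg_char (unit_form size_m (form_sign T) i k (r * ref_sign T n k)) X"
  proof -
    have "card (unitriangular size_m :: 'a mat set) \<noteq> 0"
      using one_unitriangular[of size_m, where 'a='a] finite_unitriangular[of size_m, where 'a='a]
      by (auto simp: card_eq_0_iff)
    moreover have "th (\<rho> * congr_act x X $$ (i, k)) =
        th (pairing size_m (unit_form size_m (form_sign T) i k (r * ref_sign T n k)) (congr_act x X))"
      if "x \<in> unitriangular size_m" for x
      unfolding pairing_unit_form[OF ep_square congr_act_forms[OF that X] i_less k_less] by (simp add: \<rho>_def mult_ac del: index_mult_mat(1))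
    ultimately show ?thesis by (simp add: avg_char_def del: index_mult_mat(1))
  qed
  finally show ?thesis
    unfolding induced_char_def \<chi>_def[symmetric] X_def[symmetric] using card_root_subgroup_pos by simp
qed

end

section \<open>Products of elementary characters\<close>

definition mix_rows :: "nat \<Rightarrow> nat set \<Rightarrow> 'a mat \<Rightarrow> 'a mat \<Rightarrow> 'a mat" where
  "mix_rows m J g h = mat m m (\<lambda>(a, b). if a \<in> J then g $$ (a, b) else h $$ (a, b))"

lemma mix_rows_unitriangular:
  "g \<in> unitriangular m \<Longrightarrow> h \<in> unitriangular m \<Longrightarrow> mix_rows m J g h \<in> unitriangular m"
  by (rule unitriangularI) (auto simp: mix_rows_def unitriangularD)

text \<open>Swapping the rows in \<open>J\<close> is a bijection on pairs of matrices, so different rows of a uniformly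
  random unitriangular matrix are independent.\<close>

lemma sum_unitriangular_independent:
  fixes F G :: "'a::{field,finite} mat \<Rightarrow> complex"
  assumes F: "\<And>g h. g \<in> unitriangular m \<Longrightarrow> h \<in> unitriangular m \<Longrightarrow> F (mix_rows m J g h) = F g"
    and G: "\<And>g h. g \<in> unitriangular m \<Longrightarrow> h \<in> unitriangular m \<Longrightarrow> G (mix_rows m J g h) = G h"
  shows "(\<Sum>g\<in>unitriangular m. F g) * (\<Sum>g\<in>unitriangular m. G g) =
    of_nat (card (unitriangular m :: 'a mat set)) * (\<Sum>g\<in>unitriangular m. F g * G g)"
proof -
  let ?U = "unitriangular m :: 'a mat set"
  have "(\<Sum>g\<in>?U. F g) * (\<Sum>g\<in>?U. G g) = (\<Sum>(g, h)\<in>?U \<times> ?U. F g * G h)"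
    by (simp add: sum_product sum.cartesian_product)
  also have "\<dots> = (\<Sum>(g, h)\<in>?U \<times> ?U. F g * G g)"
  proof (rule sum.reindex_bij_witness[where i="\<lambda>(g, h). (mix_rows m J g h, mix_rows m J h g)"
        and j="\<lambda>(g, h). (mix_rows m J g h, mix_rows m J h g)"])
    have "mix_rows m J (mix_rows m J g h) (mix_rows m J h g) = g" if "g \<in> ?U" "h \<in> ?U" for g h
      using that unitriangularD(1)[OF that(1)] by (intro eq_matI) (auto simp: mix_rows_def)
    then show "(case case p of (g, h) \<Rightarrow> (mix_rows m J g h, mix_rows m J h g) of
        (g, h) \<Rightarrow> (mix_rows m J g h, mix_rows m J h g)) = p" if "p \<in> ?U \<times> ?U" for p
      using that by auto
    then show "(case case p of (g, h) \<Rightarrow> (mix_rows m J g h, mix_rows m J h g) of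
        (g, h) \<Rightarrow> (mix_rows m J g h, mix_rows m J h g)) = p" if "p \<in> ?U \<times> ?U" for p
      using that by auto
  qed (auto simp: mix_rows_unitriangular F G)
  also have "\<dots> = (\<Sum>g\<in>?U. \<Sum>h\<in>?U. F g * G g)" by (rule sum.cartesian_product[symmetric])
  finally show ?thesis by (simp add: sum_distrib_left)
qed

definition sum_form :: "nat \<Rightarrow> 'a::field \<Rightarrow> ('r \<Rightarrow> nat \<times> nat) \<Rightarrow> ('r \<Rightarrow> 'a) \<Rightarrow> 'r set \<Rightarrow> 'a mat" where
  "sum_form m ep p t D = mat m m (\<lambda>(a, b).
     \<Sum>\<alpha>\<in>D. unit_form m ep (fst (p \<alpha>)) (snd (p \<alpha>)) (t \<alpha>) $$ (a, b))"

definition pair_rows :: "nat \<times> nat \<Rightarrow> nat set" where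
  "pair_rows q = {fst q, snd q}"

context form_char
begin

text \<open>Entry (a, b) of g X g^T involves g only through its rows a and b.\<close>

lemma congr_mix_rows:
  assumes "g \<in> unitriangular m" "h \<in> unitriangular m" "X \<in> forms m ep" "a < m" "b < m"
  shows "a \<in> J \<Longrightarrow> b \<in> J \<Longrightarrow> congr_act (mix_rows m J g h) X $$ (a, b) = congr_act g X $$ (a, b)"
    and "a \<notin> J \<Longrightarrow> b \<notin> J \<Longrightarrow> congr_act (mix_rows m J g h) X $$ (a, b) = congr_act h X $$ (a, b)"
proof -
  note c = unitriangularD(1)[OF assms(1)] unitriangularD(1)[OF assms(2)]
    unitriangularD(1)[OF mix_rows_unitriangular[OF assms(1,2)]]
  note e = index_congr_act[OF c(1) formsD(1)[OF assms(3)] assms(4,5)]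
    index_congr_act[OF c(2) formsD(1)[OF assms(3)] assms(4,5)]
    index_congr_act[OF c(3) formsD(1)[OF assms(3)] assms(4,5)]
  show "a \<in> J \<Longrightarrow> b \<in> J \<Longrightarrow> congr_act (mix_rows m J g h) X $$ (a, b) = congr_act g X $$ (a, b)"
    unfolding e using assms(4,5) by (simp add: mix_rows_def)
  show "a \<notin> J \<Longrightarrow> b \<notin> J \<Longrightarrow> congr_act (mix_rows m J g h) X $$ (a, b) = congr_act h X $$ (a, b)"
    unfolding e using assms(4,5) by (simp add: mix_rows_def)
qed

lemma sum_form_forms:
  assumes "\<And>\<alpha>. \<alpha> \<in> D \<Longrightarrow> fst (p \<alpha>) + snd (p \<alpha>) + 1 < m"
  shows "sum_form m ep p t D \<in> forms m ep"
proof (rule formsI)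
  have u: "unit_form m ep (fst (p \<alpha>)) (snd (p \<alpha>)) (t \<alpha>) \<in> forms m ep" if "\<alpha> \<in> D" for \<alpha>
    by (rule unit_form_forms[OF ep_square assms[OF that]])
  fix a b assume ab: "a < m" "b < m"
  have "(\<Sum>\<alpha>\<in>D. unit_form m ep (fst (p \<alpha>)) (snd (p \<alpha>)) (t \<alpha>) $$ (b, a)) =
      (\<Sum>\<alpha>\<in>D. ep * unit_form m ep (fst (p \<alpha>)) (snd (p \<alpha>)) (t \<alpha>) $$ (a, b))"
    by (intro sum.cong refl formsD(2)[OF u ab])
  then show "sum_form m ep p t D $$ (b, a) = ep * sum_form m ep p t D $$ (a, b)"
    using ab by (simp add: sum_form_def sum_distrib_left)
  show "sum_form m ep p t D $$ (a, b) = 0" if "m \<le> a + b + 1"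
    using ab formsD(3)[OF u ab that] by (simp add: sum_form_def)
qed (simp add: sum_form_def)

lemma pairing_sum_form:
  "pairing m (sum_form m ep p t D) X =
    (\<Sum>\<alpha>\<in>D. pairing m (unit_form m ep (fst (p \<alpha>)) (snd (p \<alpha>)) (t \<alpha>)) X)"
proof -
  let ?u = "\<lambda>\<alpha> a b. unit_form m ep (fst (p \<alpha>)) (snd (p \<alpha>)) (t \<alpha>) $$ (a, b) * X $$ (a, b)"
  have "pairing m (sum_form m ep p t D) X = (\<Sum>a<m. \<Sum>b<m. \<Sum>\<alpha>\<in>D. ?u \<alpha> a b)"
    unfolding pairing_def by (intro sum.cong refl) (simp add: sum_form_def sum_distrib_right)
  also have "\<dots> = (\<Sum>a<m. \<Sum>\<alpha>\<in>D. \<Sum>b<m. ?u \<alpha> a b)"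
    by (intro sum.cong refl sum.swap)
  also have "\<dots> = (\<Sum>\<alpha>\<in>D. \<Sum>a<m. \<Sum>b<m. ?u \<alpha> a b)" by (rule sum.swap)
  finally show ?thesis by (simp add: pairing_def)
qed

lemma card_unitriangular_pos: "card (unitriangular m :: 'a mat set) \<noteq> 0"
  using one_unitriangular[of m, where 'a='a] finite_unitriangular[of m, where 'a='a]
  by (auto simp: card_eq_0_iff)

lemma prod_avg_char:
  assumes X: "X \<in> forms m ep" and D: "finite D"
    and reg: "\<And>\<alpha>. \<alpha> \<in> D \<Longrightarrow> fst (p \<alpha>) + snd (p \<alpha>) + 1 < m"
    and disj: "\<And>\<alpha> \<beta>. \<alpha> \<in> D \<Longrightarrow> \<beta> \<in> D \<Longrightarrow> \<alpha> \<noteq> \<beta> \<Longrightarrow> pair_rows (p \<alpha>) \<inter> pair_rows (p \<beta>) = {}"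
  shows "(\<Prod>\<alpha>\<in>D. avg_char (unit_form m ep (fst (p \<alpha>)) (snd (p \<alpha>)) (t \<alpha>)) X) =
    avg_char (sum_form m ep p t D) X"
  using D reg disj
proof (induction D rule: finite_induct)
  case empty
  have "pairing m (sum_form m ep p t {}) Y = 0" for Y by (simp add: pairing_sum_form)
  then show ?case using card_unitriangular_pos by (simp add: avg_char_def th_zero)
next
  case (insert \<alpha> D)
  let ?G = "unitriangular m :: 'a mat set"
  let ?u = "\<lambda>\<alpha>. unit_form m ep (fst (p \<alpha>)) (snd (p \<alpha>)) (t \<alpha>)"
  have lt: "fst (p \<beta>) < m" "snd (p \<beta>) < m" if "\<beta> \<in> insert \<alpha> D" for \<beta>
    using insert.prems(1)[OF that] by auto
  have pu: "pairing m (?u \<beta>) (congr_act g X) = 2 * t \<beta> * congr_act g X $$ (fst (p \<beta>), snd (p \<beta>))"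
    if "\<beta> \<in> insert \<alpha> D" "g \<in> ?G" for \<beta> g
    by (rule pairing_unit_form[OF ep_square congr_act_forms[OF that(2) X] lt[OF that(1)]])
  define F where "F g = th (pairing m (?u \<alpha>) (congr_act g X))" for g
  define H where "H g = th (pairing m (sum_form m ep p t D) (congr_act g X))" for g
  have F: "F (mix_rows m (pair_rows (p \<alpha>)) g h) = F g" if "g \<in> ?G" "h \<in> ?G" for g h
    unfolding F_def
    using pu[of \<alpha>] congr_mix_rows(1)[OF that X lt[of \<alpha>], of "pair_rows (p \<alpha>)"] that
    by (simp add: mix_rows_unitriangular pair_rows_def del: index_mult_mat(1))
  have H: "H (mix_rows m (pair_rows (p \<alpha>)) g h) = H h" if "g \<in> ?G" "h \<in> ?G" for g h
    unfolding H_def pairing_sum_form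
  proof (intro arg_cong[of _ _ th] sum.cong refl)
    fix \<beta> assume \<beta>: "\<beta> \<in> D"
    then have "\<alpha> \<noteq> \<beta>" using insert.hyps by auto
    then have "pair_rows (p \<beta>) \<inter> pair_rows (p \<alpha>) = {}" using insert.prems(2)[of \<beta> \<alpha>] \<beta> by auto
    then show "pairing m (?u \<beta>) (congr_act (mix_rows m (pair_rows (p \<alpha>)) g h) X) = pairing m (?u \<beta>) (congr_act h X)"
      using pu[of \<beta>] congr_mix_rows(2)[OF that X lt[of \<beta>], of "pair_rows (p \<alpha>)"] that \<beta>
      by (simp add: mix_rows_unitriangular pair_rows_def del: index_mult_mat(1))
  qed
  have FH: "F g * H g = th (pairing m (sum_form m ep p t (insert \<alpha> D)) (congr_act g X))" for g
    unfolding F_def H_def pairing_sum_form th_add[symmetric] using insert.hyps by simp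
  have "(\<Prod>\<beta>\<in>insert \<alpha> D. avg_char (?u \<beta>) X) = avg_char (?u \<alpha>) X * avg_char (sum_form m ep p t D) X"
    using insert by simp
  also have "\<dots> = (\<Sum>g\<in>?G. F g) * (\<Sum>g\<in>?G. H g) / (of_nat (card ?G) * of_nat (card ?G))"
    by (simp add: avg_char_def F_def H_def)
  also have "\<dots> = (\<Sum>g\<in>?G. F g * H g) / of_nat (card ?G)"
  proof -
    have "(\<Sum>g\<in>?G. F g) * (\<Sum>g\<in>?G. H g) = of_nat (card ?G) * (\<Sum>g\<in>?G. F g * H g)"
      by (rule sum_unitriangular_independent[OF F H])
    then show ?thesis using card_unitriangular_pos by simp
  qed
  finally show ?case by (simp add: avg_char_def FH)
qed

end

section \<open>Roots as pairs of rows\<close>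

text \<open>For a positive entry in zero-based row i and column c, the pair (i, m - 1 - c).\<close>

fun root_pair :: "classical \<Rightarrow> nat \<Rightarrow> eps_root \<Rightarrow> nat \<times> nat" where
  "root_pair T n (Eps_minus i j) = (i - 1, mat_size T n - j)"
| "root_pair T n (Eps_plus i j) = (i - 1, j - 1)"
| "root_pair T n (Eps_double i) = (i - 1, i - 1)"
| "root_pair T n (Eps i) = (i - 1, n)"

definition row_pairs :: "classical \<Rightarrow> nat \<Rightarrow> (nat \<times> nat) set" where
  "row_pairs T n = {(i, k). i \<le> k \<and> i + k + 1 < mat_size T n \<and> (i = k \<longrightarrow> T = Sp)}"

lemma roots_cases:
  assumes "\<alpha> \<in> roots T n"
  obtains i j where "\<alpha> = Eps_minus i j" "1 \<le> i" "i < j" "j \<le> n"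
  | i j where "\<alpha> = Eps_plus i j" "1 \<le> i" "i < j" "j \<le> n"
  | i where "\<alpha> = Eps_double i" "1 \<le> i" "i \<le> n" "T = Sp"
  | i where "\<alpha> = Eps i" "1 \<le> i" "i \<le> n" "T = O_odd"
  using assms by (cases T) (auto simp: roots_def)

lemma root_pair_bij: "bij_betw (root_pair T n) (roots T n) (row_pairs T n)"
  unfolding bij_betw_def
proof
  show "inj_on (root_pair T n) (roots T n)"
  proof
    fix \<alpha> \<beta> assume "\<alpha> \<in> roots T n" "\<beta> \<in> roots T n" "root_pair T n \<alpha> = root_pair T n \<beta>"
    then show "\<alpha> = \<beta>"
      by (elim roots_cases) auto
  qed
  show "root_pair T n ` roots T n = row_pairs T n"
  proof (intro equalityI subsetI)
    fix q assume "q \<in> root_pair T n ` roots T n"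
    then obtain \<alpha> where \<alpha>: "\<alpha> \<in> roots T n" "q = root_pair T n \<alpha>" by auto
    from \<alpha>(1) show "q \<in> row_pairs T n"
      unfolding \<alpha>(2) by (cases rule: roots_cases) (auto simp: row_pairs_def)
  next
    fix q assume "q \<in> row_pairs T n"
    then obtain i k where q: "q = (i, k)" "i \<le> k" "i + k + 1 < mat_size T n" "i = k \<longrightarrow> T = Sp"
      by (auto simp: row_pairs_def)
    have i: "i < n" using q mid_cases[of T] by auto
    have "k < n \<and> i = k \<or> k < n \<and> i < k \<or> k = n \<and> T = O_odd \<or> n + mid T \<le> k"
      using q(2) by (cases T) auto
    then consider "k < n" "i = k" | "k < n" "i < k" | "k = n" "T = O_odd" | "n + mid T \<le> k"
      by blast
    then show "q \<in> root_pair T n ` roots T n"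
    proof cases
      case 1
      then have "Eps_double (Suc i) \<in> roots T n" "root_pair T n (Eps_double (Suc i)) = q"
        using q by (auto simp: roots_def)
      then show ?thesis by blast
    next
      case 2
      then have "Eps_plus (Suc i) (Suc k) \<in> roots T n" "root_pair T n (Eps_plus (Suc i) (Suc k)) = q"
        using q by (auto simp: roots_def)
      then show ?thesis by blast
    next
      case 3
      then have "Eps (Suc i) \<in> roots T n" "root_pair T n (Eps (Suc i)) = q"
        using q i by (auto simp: roots_def)
      then show ?thesis by blast
    next
      case 4
      then have "Eps_minus (Suc i) (mat_size T n - k) \<in> roots T n"
        "root_pair T n (Eps_minus (Suc i) (mat_size T n - k)) = q"
        using q i by (auto simp: roots_def)
      then show ?thesis by blast
    qed
  qed
qed

lemma root_pair_row_pairs: "\<alpha> \<in> roots T n \<Longrightarrow> root_pair T n \<alpha> \<in> row_pairs T n"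
  using root_pair_bij bij_betwE by blast

lemma root_pair_inj: "\<alpha> \<in> roots T n \<Longrightarrow> \<beta> \<in> roots T n \<Longrightarrow> root_pair T n \<alpha> = root_pair T n \<beta> \<Longrightarrow> \<alpha> = \<beta>"
  using root_pair_bij[of T n] by (meson bij_betw_imp_inj_on inj_onD)

lemma finite_roots: "finite (roots T n)"
proof -
  have "row_pairs T n \<subseteq> {..<mat_size T n} \<times> {..<mat_size T n}" by (auto simp: row_pairs_def)
  then have "finite (row_pairs T n)" by (rule finite_subset) simp
  then show ?thesis using bij_betw_finite[OF root_pair_bij] by simp
qed

text \<open>The inverse of \<open>idx_pos\<close>.\<close>

definition idx_of :: "classical \<Rightarrow> nat \<Rightarrow> nat \<Rightarrow> int" where
  "idx_of T n a = (if a < n then int a + 1 else if a < n + mid T then 0 else int a - int (mat_size T n))"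

lemma idx_of_inj: "a < mat_size T n \<Longrightarrow> b < mat_size T n \<Longrightarrow> idx_of T n a = idx_of T n b \<Longrightarrow> a = b"
  using mid_cases[of T] by (auto simp: idx_of_def split: if_splits)

lemma idx_of_simps:
  assumes "1 \<le> c" "c \<le> n"
  shows "idx_of T n (c - 1) = int c" "idx_of T n (mat_size T n - c) = - int c"
    "mat_size T n - 1 - (c - 1) = mat_size T n - c" "mat_size T n - 1 - (mat_size T n - c) = c - 1"
proof -
  have "\<not> mat_size T n - c < n + mid T" "\<not> mat_size T n - c < n" using assms by linarith+
  moreover have "int (mat_size T n - c) = int (mat_size T n) - int c" using assms by (intro of_nat_diff) linarith
  ultimately show "idx_of T n (mat_size T n - c) = - int c" by (simp add: idx_of_def)
  show "mat_size T n - 1 - (c - 1) = mat_size T n - c" "mat_size T n - 1 - (mat_size T n - c) = c - 1"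
    using assms by linarith+
qed (use assms in \<open>auto simp: idx_of_def\<close>)

text \<open>The two entries of a root are mirror images in the antidiagonal. They coincide when i =
  k, which accounts for the single entry of a double root.\<close>

lemma entries_root:
  assumes "\<alpha> \<in> roots T n" "root_pair T n \<alpha> = (i, k)"
  shows "entries \<alpha> = {(idx_of T n i, idx_of T n (mat_size T n - 1 - k)),
    (idx_of T n k, idx_of T n (mat_size T n - 1 - i))}"
  using assms(1)
proof (cases rule: roots_cases)
  case (1 a b)
  then have "i = a - 1" "k = mat_size T n - b" "1 \<le> b" "a \<le> n" using assms(2) by auto
  then show ?thesis using 1 by (simp only: idx_of_simps entries.simps)
next
  case (2 a b)
  then have "i = a - 1" "k = b - 1" "1 \<le> b" "a \<le> n" using assms(2) by auto
  then show ?thesis using 2 by (simp only: idx_of_simps entries.simps)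
next
  case (3 a)
  then have "i = a - 1" "k = a - 1" using assms(2) by auto
  then show ?thesis using 3 by (simp only: idx_of_simps entries.simps) simp
next
  case (4 a)
  then have "i = a - 1" "k = n" using assms(2) by auto
  moreover have "mat_size T n - 1 - n = n" "idx_of T n n = 0" using 4 by (auto simp: idx_of_def)
  ultimately show ?thesis using 4 by (simp only: idx_of_simps entries.simps)
qed

text \<open>Since a root contributes both mirror images, its rows and its reversed columns form the
  same set {i, k}. The row condition and the column condition therefore both amount to disjointness
  of these sets.\<close>

lemma basic_iff:
  "basic T n D \<longleftrightarrow> D \<subseteq> roots T n \<and>
    (\<forall>\<alpha>\<in>D. \<forall>\<beta>\<in>D. \<alpha> \<noteq> \<beta> \<longrightarrow> pair_rows (root_pair T n \<alpha>) \<inter> pair_rows (root_pair T n \<beta>) = {})"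
proof -
  let ?m = "mat_size T n" and ?E = "\<Union> (entries ` D)"
  have mem: "(x, y) \<in> entries \<alpha> \<longleftrightarrow> (\<exists>a b. a < ?m \<and> b < ?m \<and> x = idx_of T n a \<and> y = idx_of T n (?m - 1 - b) \<and>
      ((a, b) = root_pair T n \<alpha> \<or> (b, a) = root_pair T n \<alpha>))" if "\<alpha> \<in> roots T n" for x y \<alpha>
  proof -
    obtain i k where ik: "root_pair T n \<alpha> = (i, k)" by (rule prod.exhaust)
    have "i < ?m" "k < ?m" using root_pair_row_pairs[OF that] ik by (auto simp: row_pairs_def)
    then show ?thesis unfolding entries_root[OF that ik] ik by auto
  qed
  \<comment> \<open>A pair in \<open>row_pairs\<close> is ordered, so it can be recovered from
    either arrangement of its components.\<close>
  have swap_eq: "\<alpha> = \<beta>" if "\<alpha> \<in> roots T n" "\<beta> \<in> roots T n"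
    "(a, b) = root_pair T n \<alpha> \<or> (b, a) = root_pair T n \<alpha>" "(a, b) = root_pair T n \<beta> \<or> (b, a) = root_pair T n \<beta>" for \<alpha> \<beta> a b
  proof (rule root_pair_inj[OF that(1,2)])
    show "root_pair T n \<alpha> = root_pair T n \<beta>"
      using that root_pair_row_pairs[OF that(1)] root_pair_row_pairs[OF that(2)]
      by (cases "root_pair T n \<alpha>"; cases "root_pair T n \<beta>") (auto simp: row_pairs_def)
  qed
  have partner: "\<exists>b<?m. (r, b) = root_pair T n \<alpha> \<or> (b, r) = root_pair T n \<alpha>"
    if "\<alpha> \<in> roots T n" "r \<in> pair_rows (root_pair T n \<alpha>)" for \<alpha> r
  proof -
    obtain i k where ik: "root_pair T n \<alpha> = (i, k)" by (rule prod.exhaust)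
    then have "i < ?m" "k < ?m" "r = i \<or> r = k"
      using that root_pair_row_pairs[OF that(1)] by (auto simp: row_pairs_def pair_rows_def)
    then show ?thesis unfolding ik by auto
  qed
  have rows_lt: "r < ?m" if "\<alpha> \<in> roots T n" "r \<in> pair_rows (root_pair T n \<alpha>)" for \<alpha> r
    using that root_pair_row_pairs[OF that(1)] by (cases "root_pair T n \<alpha>") (auto simp: pair_rows_def row_pairs_def)
  have in_rows: "a \<in> pair_rows (root_pair T n \<alpha>)" "b \<in> pair_rows (root_pair T n \<alpha>)"
    if "(a, b) = root_pair T n \<alpha> \<or> (b, a) = root_pair T n \<alpha>" for a b \<alpha>
    using that by (cases "root_pair T n \<alpha>"; auto simp: pair_rows_def)+
  show ?thesis
  proof (cases "D \<subseteq> roots T n")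
    case True
    show ?thesis
    proof (intro iffI conjI True ballI impI)
      fix \<alpha> \<beta> assume bas: "basic T n D" and \<alpha>: "\<alpha> \<in> D" and \<beta>: "\<beta> \<in> D" and ne: "\<alpha> \<noteq> \<beta>"
      have \<alpha>r: "\<alpha> \<in> roots T n" and \<beta>r: "\<beta> \<in> roots T n" using True \<alpha> \<beta> by auto
      show "pair_rows (root_pair T n \<alpha>) \<inter> pair_rows (root_pair T n \<beta>) = {}"
      proof (rule ccontr)
        assume "pair_rows (root_pair T n \<alpha>) \<inter> pair_rows (root_pair T n \<beta>) \<noteq> {}"
        then obtain r where r: "r \<in> pair_rows (root_pair T n \<alpha>)" "r \<in> pair_rows (root_pair T n \<beta>)" by auto
        obtain b where b: "b < ?m" "(r, b) = root_pair T n \<alpha> \<or> (b, r) = root_pair T n \<alpha>"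
          using partner[OF \<alpha>r r(1)] by blast
        obtain c where c: "c < ?m" "(r, c) = root_pair T n \<beta> \<or> (c, r) = root_pair T n \<beta>"
          using partner[OF \<beta>r r(2)] by blast
        have rm: "r < ?m" using rows_lt[OF \<alpha>r r(1)] .
        have "(idx_of T n r, idx_of T n (?m - 1 - b)) \<in> entries \<alpha>"
          unfolding mem[OF \<alpha>r] using b rm by blast
        moreover have "(idx_of T n r, idx_of T n (?m - 1 - c)) \<in> entries \<beta>"
          unfolding mem[OF \<beta>r] using c rm by blast
        ultimately have "(idx_of T n r, idx_of T n (?m - 1 - b)) \<in> ?E" "(idx_of T n r, idx_of T n (?m - 1 - c)) \<in> ?E"
          using \<alpha> \<beta> by blast+
        then have "idx_of T n (?m - 1 - b) = idx_of T n (?m - 1 - c)"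
          using bas unfolding basic_def by blast
        then have "?m - 1 - b = ?m - 1 - c" using b c by (intro idx_of_inj[where T=T and n=n]) auto
        then have "b = c" using b c by linarith
        then show False using swap_eq[OF \<alpha>r \<beta>r b(2)] c(2) ne by simp
      qed
    next
      assume R: "D \<subseteq> roots T n \<and>
        (\<forall>\<alpha>\<in>D. \<forall>\<beta>\<in>D. \<alpha> \<noteq> \<beta> \<longrightarrow> pair_rows (root_pair T n \<alpha>) \<inter> pair_rows (root_pair T n \<beta>) = {})"
      have unique: "\<alpha> = \<beta>" if "\<alpha> \<in> D" "\<beta> \<in> D" "r \<in> pair_rows (root_pair T n \<alpha>)" "r \<in> pair_rows (root_pair T n \<beta>)" for \<alpha> \<beta> r
        using R that by blast
      have key: "(a = a') = (b = b')" if \<alpha>: "\<alpha> \<in> D" "\<beta> \<in> D"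
        and p: "(a, b) = root_pair T n \<alpha> \<or> (b, a) = root_pair T n \<alpha>"
          "(a', b') = root_pair T n \<beta> \<or> (b', a') = root_pair T n \<beta>" for \<alpha> \<beta> a b a' b'
      proof -
        have "\<alpha> = \<beta>" if "a = a' \<or> b = b'"
          using unique[OF \<alpha>, of a] unique[OF \<alpha>, of b] in_rows[OF p(1)] in_rows[OF p(2)] that by auto
        then show ?thesis using p by (cases "root_pair T n \<beta>") auto
      qed
      show "basic T n D"
        unfolding basic_def
      proof (intro conjI True allI impI)
        fix x y z assume "(x, y) \<in> ?E \<and> (x, z) \<in> ?E"
        then obtain \<alpha> \<beta> where \<alpha>: "\<alpha> \<in> D" "\<beta> \<in> D" "(x, y) \<in> entries \<alpha>" "(x, z) \<in> entries \<beta>" by auto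
        have r: "\<alpha> \<in> roots T n" "\<beta> \<in> roots T n" using True \<alpha> by auto
        from \<alpha>(3) obtain a b where 1: "a < ?m" "x = idx_of T n a" "y = idx_of T n (?m - 1 - b)"
          "(a, b) = root_pair T n \<alpha> \<or> (b, a) = root_pair T n \<alpha>" unfolding mem[OF r(1)] by blast
        from \<alpha>(4) obtain a' b' where 2: "a' < ?m" "x = idx_of T n a'" "z = idx_of T n (?m - 1 - b')"
          "(a', b') = root_pair T n \<beta> \<or> (b', a') = root_pair T n \<beta>" unfolding mem[OF r(2)] by blast
        have "a = a'" using idx_of_inj[where T=T and n=n and a=a and b=a'] 1 2 by simp
        then show "y = z" using key[OF \<alpha>(1,2) 1(4) 2(4)] 1 2 by simp
      next
        fix x y z assume "(x, z) \<in> ?E \<and> (y, z) \<in> ?E"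
        then obtain \<alpha> \<beta> where \<alpha>: "\<alpha> \<in> D" "\<beta> \<in> D" "(x, z) \<in> entries \<alpha>" "(y, z) \<in> entries \<beta>" by auto
        have r: "\<alpha> \<in> roots T n" "\<beta> \<in> roots T n" using True \<alpha> by auto
        from \<alpha>(3) obtain a b where 1: "b < ?m" "x = idx_of T n a" "z = idx_of T n (?m - 1 - b)"
          "(a, b) = root_pair T n \<alpha> \<or> (b, a) = root_pair T n \<alpha>" unfolding mem[OF r(1)] by blast
        from \<alpha>(4) obtain a' b' where 2: "b' < ?m" "y = idx_of T n a'" "z = idx_of T n (?m - 1 - b')"
          "(a', b') = root_pair T n \<beta> \<or> (b', a') = root_pair T n \<beta>" unfolding mem[OF r(2)] by blast
        have "?m - 1 - b = ?m - 1 - b'" using 1 2 by (intro idx_of_inj[where T=T and n=n]) auto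
        then have "b = b'" using 1 2 by linarith
        then show "x = y" using key[OF \<alpha>(1,2) 1(4) 2(4)] 1 2 by simp
      qed
    qed
  qed (simp add: basic_def)
qed

section \<open>Supercharacters and the regular character\<close>

lemma idx_pos_simps:
  "1 \<le> c \<Longrightarrow> c \<le> n \<Longrightarrow> idx_pos T n (int c) = c - 1"
  "1 \<le> c \<Longrightarrow> c \<le> n \<Longrightarrow> idx_pos T n (- int c) = mat_size T n - c"
  "T = O_odd \<Longrightarrow> idx_pos T n 0 = n"
  by (auto simp: idx_pos_eq idx_set_def nat_diff_distrib)

text \<open>The bound c = n + 1 serves the root conditions that run to the end of the first
  block.\<close>

lemma entry_row_zero_iff:
  assumes "1 \<le> i" "c \<le> n + 1"
  shows "(\<forall>k. int i < k \<and> k < int c \<longrightarrow> entry T n x (int i) k = 0) \<longleftrightarrow>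
    (\<forall>l. i - 1 < l \<and> l < c - 1 \<longrightarrow> x $$ (i - 1, l) = 0)"
proof (intro iffI allI impI)
  fix l assume *: "\<forall>k. int i < k \<and> k < int c \<longrightarrow> entry T n x (int i) k = 0" and l: "i - 1 < l \<and> l < c - 1"
  then have "entry T n x (int i) (int (l + 1)) = 0" using assms(1) by (intro *[rule_format]) linarith
  moreover have "idx_pos T n (int i) = i - 1" "idx_pos T n (int (l + 1)) = l"
    using l assms idx_pos_simps(1)[of i n T] idx_pos_simps(1)[of "l + 1" n T] by auto
  ultimately show "x $$ (i - 1, l) = 0" by (simp add: entry_def)
next
  fix k assume *: "\<forall>l. i - 1 < l \<and> l < c - 1 \<longrightarrow> x $$ (i - 1, l) = 0" and k: "int i < k \<and> k < int c"
  then obtain l where l: "k = int l" using nonneg_int_cases[of k] by auto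
  have "idx_pos T n (int i) = i - 1" "idx_pos T n (int l) = l - 1"
    using k l assms idx_pos_simps(1)[of i n T] idx_pos_simps(1)[of l n T] by auto
  moreover have "x $$ (i - 1, l - 1) = 0" using k l assms by (intro *[rule_format]) linarith
  ultimately show "entry T n x (int i) k = 0" by (simp add: entry_def l)
qed

lemma entry_row_zero_mid_iff:
  assumes "1 \<le> j" "j \<le> n"
  shows "(\<forall>l \<in> idx_set T n. int j \<prec> l \<and> l \<preceq> 0 \<longrightarrow> entry T n x (int j) l = 0) \<longleftrightarrow>
    (\<forall>l. j - 1 < l \<and> l < n + mid T \<longrightarrow> x $$ (j - 1, l) = 0)"
proof -
  have set: "{l \<in> idx_set T n. int j \<prec> l \<and> l \<preceq> 0} = {int j<..<int (n + 1)} \<union> (if T = O_odd then {0} else {})"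
    using assms by (auto simp: idx_set_def idx_less_def)
  have "(\<forall>l \<in> idx_set T n. int j \<prec> l \<and> l \<preceq> 0 \<longrightarrow> entry T n x (int j) l = 0) \<longleftrightarrow>
    (\<forall>l\<in>{l \<in> idx_set T n. int j \<prec> l \<and> l \<preceq> 0}. entry T n x (int j) l = 0)" by blast
  also have "\<dots> \<longleftrightarrow> (\<forall>k. int j < k \<and> k < int (n + 1) \<longrightarrow> entry T n x (int j) k = 0) \<and>
      (T = O_odd \<longrightarrow> entry T n x (int j) 0 = 0)"
    unfolding set by auto
  also have "\<dots> \<longleftrightarrow> (\<forall>l. j - 1 < l \<and> l < n + 1 - 1 \<longrightarrow> x $$ (j - 1, l) = 0) \<and>
      (T = O_odd \<longrightarrow> x $$ (j - 1, n) = 0)"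
    using assms by (subst entry_row_zero_iff) (auto simp: entry_def idx_pos_simps)
  also have "\<dots> \<longleftrightarrow> (\<forall>l. j - 1 < l \<and> l < n + mid T \<longrightarrow> x $$ (j - 1, l) = 0)"
  proof (cases "T = O_odd")
    case True
    then show ?thesis using assms by (auto simp: less_Suc_eq)
  next
    case False
    then show ?thesis using mid_cases[of T] by simp
  qed
  finally show ?thesis .
qed

locale unipotent_char = form_char th "mat_size T n" "form_sign T"
  for th :: "'a::{field,finite} \<Rightarrow> complex" and T :: classical and n :: nat
begin

abbreviation "size_m \<equiv> mat_size T n"

definition root_form :: "eps_root \<Rightarrow> 'a \<Rightarrow> 'a mat" where
  "root_form \<alpha> r = unit_form size_m (form_sign T) (fst (root_pair T n \<alpha>)) (snd (root_pair T n \<alpha>))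
     (r * ref_sign T n (snd (root_pair T n \<alpha>)))"

text \<open>The constant is |G| / |K|, but only its being real and nonzero is recorded: it cancels
  in the end, and being real it is fixed by complex conjugation.\<close>

lemma elementary_charI:
  assumes pair: "root_pair T n \<alpha> = (i, k)"
    and arith: "i \<le> k" "i + k + 1 < size_m" "A + B = size_m" "i < A" "k < B" "k < A \<or> A = size_m - 1 - k"
    and diag: "i = k \<Longrightarrow> T = Sp \<and> A = B"
    and cond: "\<And>u :: 'a mat. U_root_cond T n \<alpha> u \<longleftrightarrow>
      (\<forall>l. i < l \<and> l < A \<longrightarrow> u $$ (i, l) = 0) \<and> (\<forall>l. k < l \<and> l < B \<longrightarrow> u $$ (k, l) = 0)"
    and pos: "idx_pos T n (fst (positive_entry n \<alpha>)) = i" "idx_pos T n (snd (positive_entry n \<alpha>)) = size_m - 1 - k"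
  shows "\<exists>d::real. d \<noteq> 0 \<and> (\<forall>r u. r \<noteq> 0 \<longrightarrow> u \<in> isometries T n \<longrightarrow>
    elementary_char th T n \<alpha> r u = of_real d * avg_char (root_form \<alpha> r) (cayley_form T n u))"
proof -
  interpret R: unipotent_root th T n i k A B
    using arith diag by unfold_locales (simp_all add: form_sign_def)
  define d :: real where "d = of_nat (card (unitriangular size_m :: 'a mat set)) / of_nat (card R.root_group)"
  have H: "U_root T n \<alpha> = isometries T n \<inter> R.root_group"
    unfolding U_root_def R.root_group_def U_carrier_eq cond using isometries_unitriangular by blast
  have ch: "lambda_char th T n \<alpha> r = (\<lambda>x. th (r * x $$ (i, size_m - 1 - k)))" for r
    by (simp add: lambda_char_def entry_def pos fun_eq_iff)
  have "card R.root_group \<noteq> 0"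
    using R.one_root_group R.finite_root_group by (auto simp: card_eq_0_iff)
  then have "d \<noteq> 0" using card_unitriangular_pos by (simp add: d_def)
  moreover have "elementary_char th T n \<alpha> r u = of_real d * avg_char (root_form \<alpha> r) (cayley_form T n u)"
    if "r \<noteq> 0" "u \<in> isometries T n" for r u
    unfolding elementary_char_def H ch R.induced_root_char[OF that] root_form_def pair by (simp add: d_def)
  ultimately show ?thesis by blast
qed

lemma elementary_char_eq:
  assumes "\<alpha> \<in> roots T n"
  shows "\<exists>d::real. d \<noteq> 0 \<and> (\<forall>r u. r \<noteq> 0 \<longrightarrow> u \<in> isometries T n \<longrightarrow>
    elementary_char th T n \<alpha> r u = of_real d * avg_char (root_form \<alpha> r) (cayley_form T n u))"
proof -
  note pe = positive_entry_eq[OF assms]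
  have le_n: "(\<forall>k. int i < k \<and> k \<le> int n \<longrightarrow> entry T n x (int i) k = 0) \<longleftrightarrow>
      (\<forall>l. i - 1 < l \<and> l < n \<longrightarrow> x $$ (i - 1, l) = 0)" if "1 \<le> i" for i and x :: "'a mat"
  proof -
    have "k < int (n + 1) \<longleftrightarrow> k \<le> int n" for k by auto
    then show ?thesis using entry_row_zero_iff[OF that, of "n + 1" n T x] by simp
  qed
  from assms show ?thesis
  proof (cases rule: roots_cases)
    case (1 i j)
    show ?thesis
    \<comment> \<open>Here B = k + 1, so the second row condition ranges over no column.\<close>
    proof (rule elementary_charI[where i="i - 1" and k="size_m - j" and A="j - 1" and B="size_m - j + 1"])
      show "U_root_cond T n \<alpha> u \<longleftrightarrow> (\<forall>l. i - 1 < l \<and> l < j - 1 \<longrightarrow> u $$ (i - 1, l) = 0) \<and>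
          (\<forall>l. size_m - j < l \<and> l < size_m - j + 1 \<longrightarrow> u $$ (size_m - j, l) = 0)" for u :: "'a mat"
        using 1 entry_row_zero_iff[of i j n T u] by auto
      show "idx_pos T n (fst (positive_entry n \<alpha>)) = i - 1"
        "idx_pos T n (snd (positive_entry n \<alpha>)) = size_m - 1 - (size_m - j)"
        unfolding pe using 1 idx_pos_simps(1)[of i n T] idx_pos_simps(1)[of j n T] by auto
    qed (use 1 in auto)
  next
    case (2 i j)
    show ?thesis
    \<comment> \<open>Row i is constrained inside the first block, row j also in the middle column
      if there is one; this is the term \<open>mid T\<close> in B.\<close>
    proof (rule elementary_charI[where i="i - 1" and k="j - 1" and A=n and B="n + mid T"])
      show "U_root_cond T n \<alpha> u \<longleftrightarrow> (\<forall>l. i - 1 < l \<and> l < n \<longrightarrow> u $$ (i - 1, l) = 0) \<and>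
          (\<forall>l. j - 1 < l \<and> l < n + mid T \<longrightarrow> u $$ (j - 1, l) = 0)" for u :: "'a mat"
        using 2 le_n[of i u] entry_row_zero_mid_iff[of j n T u] by auto
      show "idx_pos T n (fst (positive_entry n \<alpha>)) = i - 1"
        "idx_pos T n (snd (positive_entry n \<alpha>)) = size_m - 1 - (j - 1)"
        unfolding pe using 2 idx_pos_simps(1)[of i n T] idx_pos_simps(2)[of j n T] by auto
    qed (use 2 in auto)
  next
    case (3 i)
    show ?thesis
    proof (rule elementary_charI[where i="i - 1" and k="i - 1" and A=n and B=n])
      show "U_root_cond T n \<alpha> u \<longleftrightarrow> (\<forall>l. i - 1 < l \<and> l < n \<longrightarrow> u $$ (i - 1, l) = 0) \<and>
          (\<forall>l. i - 1 < l \<and> l < n \<longrightarrow> u $$ (i - 1, l) = 0)" for u :: "'a mat"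
        using 3 le_n[of i u] by auto
      show "idx_pos T n (fst (positive_entry n \<alpha>)) = i - 1"
        "idx_pos T n (snd (positive_entry n \<alpha>)) = size_m - 1 - (i - 1)"
        unfolding pe using 3 idx_pos_simps(1)[of i n T] idx_pos_simps(2)[of i n T] by auto
    qed (use 3 in auto)
  next
    case (4 i)
    show ?thesis
    proof (rule elementary_charI[where i="i - 1" and k=n and A=n and B="n + 1"])
      show "U_root_cond T n \<alpha> u \<longleftrightarrow> (\<forall>l. i - 1 < l \<and> l < n \<longrightarrow> u $$ (i - 1, l) = 0) \<and>
          (\<forall>l. n < l \<and> l < n + 1 \<longrightarrow> u $$ (n, l) = 0)" for u :: "'a mat"
        using 4 le_n[of i u] by auto
      show "idx_pos T n (fst (positive_entry n \<alpha>)) = i - 1"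
        "idx_pos T n (snd (positive_entry n \<alpha>)) = size_m - 1 - n"
        unfolding pe using 4 idx_pos_simps(1)[of i n T] idx_pos_simps(3)[of T n] by auto
    qed (use 4 in auto)
  qed
qed

section \<open>Basic pairs and normal forms\<close>

definition basic_form :: "eps_root set \<Rightarrow> (eps_root \<Rightarrow> 'a) \<Rightarrow> 'a mat" where
  "basic_form D \<phi> = sum_form size_m (form_sign T) (root_pair T n)
     (\<lambda>\<alpha>. \<phi> \<alpha> * ref_sign T n (snd (root_pair T n \<alpha>))) D"

lemma root_reg: "\<alpha> \<in> roots T n \<Longrightarrow> fst (root_pair T n \<alpha>) + snd (root_pair T n \<alpha>) + 1 < size_m"
  using root_pair_row_pairs by (fastforce simp: row_pairs_def)

lemma basic_form_forms: "basic T n D \<Longrightarrow> basic_form D \<phi> \<in> forms size_m (form_sign T)"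
  unfolding basic_form_def basic_iff using root_reg by (intro sum_form_forms) blast

lemma supercharacter_eq:
  assumes D: "basic T n D" and \<phi>: "\<And>\<alpha>. \<alpha> \<in> D \<Longrightarrow> \<phi> \<alpha> \<noteq> 0"
  shows "\<exists>d::real. d \<noteq> 0 \<and> (\<forall>u \<in> isometries T n.
    supercharacter th T n D \<phi> u = of_real d * avg_char (basic_form D \<phi>) (cayley_form T n u))"
proof -
  have Dr: "D \<subseteq> roots T n" and disj: "\<And>\<alpha> \<beta>. \<alpha> \<in> D \<Longrightarrow> \<beta> \<in> D \<Longrightarrow> \<alpha> \<noteq> \<beta> \<Longrightarrow>
      pair_rows (root_pair T n \<alpha>) \<inter> pair_rows (root_pair T n \<beta>) = {}"
    using D unfolding basic_iff by blast+
  have fin: "finite D" using Dr finite_roots by (rule finite_subset)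
  have "\<forall>\<alpha>\<in>D. \<exists>d::real. d \<noteq> 0 \<and> (\<forall>r u. r \<noteq> 0 \<longrightarrow> u \<in> isometries T n \<longrightarrow>
    elementary_char th T n \<alpha> r u = of_real d * avg_char (root_form \<alpha> r) (cayley_form T n u))"
    using elementary_char_eq Dr by blast
  then obtain d :: "eps_root \<Rightarrow> real" where d: "\<And>\<alpha>. \<alpha> \<in> D \<Longrightarrow> d \<alpha> \<noteq> 0"
    "\<And>\<alpha> r u. \<alpha> \<in> D \<Longrightarrow> r \<noteq> 0 \<Longrightarrow> u \<in> isometries T n \<Longrightarrow>
      elementary_char th T n \<alpha> r u = of_real (d \<alpha>) * avg_char (root_form \<alpha> r) (cayley_form T n u)"
    by (metis (no_types))
  have "supercharacter th T n D \<phi> u = of_real (\<Prod>\<alpha>\<in>D. d \<alpha>) * avg_char (basic_form D \<phi>) (cayley_form T n u)"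
    if u: "u \<in> isometries T n" for u
  proof -
    have "supercharacter th T n D \<phi> u =
      (\<Prod>\<alpha>\<in>D. of_real (d \<alpha>) * avg_char (root_form \<alpha> (\<phi> \<alpha>)) (cayley_form T n u))"
      unfolding supercharacter_def using d(2)[OF _ \<phi> u] by (intro prod.cong refl) blast
    also have "\<dots> = of_real (\<Prod>\<alpha>\<in>D. d \<alpha>) * (\<Prod>\<alpha>\<in>D. avg_char (root_form \<alpha> (\<phi> \<alpha>)) (cayley_form T n u))"
      by (simp add: prod.distrib)
    also have "(\<Prod>\<alpha>\<in>D. avg_char (root_form \<alpha> (\<phi> \<alpha>)) (cayley_form T n u)) =
        avg_char (basic_form D \<phi>) (cayley_form T n u)"
      unfolding root_form_def basic_form_def
      by (rule prod_avg_char[OF cayley_form_forms[OF two u] fin root_reg disj]) (use Dr in auto)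
    finally show ?thesis .
  qed
  moreover have "(\<Prod>\<alpha>\<in>D. d \<alpha>) \<noteq> 0" using d(1) fin by simp
  ultimately show ?thesis by blast
qed

lemma basic_form_index:
  assumes "a < size_m" "b < size_m"
  shows "basic_form D \<phi> $$ (a, b) = (\<Sum>\<alpha>\<in>D.
    (if (a, b) = root_pair T n \<alpha> then \<phi> \<alpha> * ref_sign T n (snd (root_pair T n \<alpha>)) else 0) +
    form_sign T * (if (b, a) = root_pair T n \<alpha> then \<phi> \<alpha> * ref_sign T n (snd (root_pair T n \<alpha>)) else 0))"
  unfolding basic_form_def sum_form_def using assms
  by (auto simp: unit_form_def prod_eq_iff conj_commute intro!: sum.cong)

lemma basic_form_root:
  assumes D: "basic T n D" and \<alpha>: "\<alpha> \<in> roots T n" "root_pair T n \<alpha> = (i, k)"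
  shows "basic_form D \<phi> $$ (i, k) =
    (if \<alpha> \<in> D then (if i = k then 2 else 1) * (\<phi> \<alpha> * ref_sign T n k) else 0)"
proof -
  have Dr: "D \<subseteq> roots T n" using D by (simp add: basic_iff)
  have q: "i \<le> k" "i < size_m" "k < size_m" "i = k \<Longrightarrow> T = Sp"
    using root_pair_row_pairs[OF \<alpha>(1)] \<alpha>(2) by (auto simp: row_pairs_def)
  have eq: "(i, k) = root_pair T n \<beta> \<longleftrightarrow> \<beta> = \<alpha>" "(k, i) = root_pair T n \<beta> \<longleftrightarrow> \<beta> = \<alpha> \<and> i = k"
    if \<beta>: "\<beta> \<in> D" for \<beta>
  proof -
    have \<beta>r: "\<beta> \<in> roots T n" using \<beta> Dr by auto
    show 1: "(i, k) = root_pair T n \<beta> \<longleftrightarrow> \<beta> = \<alpha>" using root_pair_inj[OF \<beta>r \<alpha>(1)] \<alpha>(2) by auto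
    have "i = k" if "(k, i) = root_pair T n \<beta>"
      using root_pair_row_pairs[OF \<beta>r] q(1) unfolding that[symmetric] by (auto simp: row_pairs_def)
    then show "(k, i) = root_pair T n \<beta> \<longleftrightarrow> \<beta> = \<alpha> \<and> i = k" using 1 \<alpha>(2) by auto
  qed
  have "basic_form D \<phi> $$ (i, k) =
    (\<Sum>\<beta>\<in>D. if \<beta> = \<alpha> then (if i = k then 2 else 1) * (\<phi> \<alpha> * ref_sign T n k) else 0)"
    unfolding basic_form_index[OF q(2,3)]
  proof (intro sum.cong refl)
    fix \<beta> assume \<beta>: "\<beta> \<in> D"
    show "(if (i, k) = root_pair T n \<beta> then \<phi> \<beta> * ref_sign T n (snd (root_pair T n \<beta>)) else 0) +
      form_sign T * (if (k, i) = root_pair T n \<beta> then \<phi> \<beta> * ref_sign T n (snd (root_pair T n \<beta>)) else 0) =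
      (if \<beta> = \<alpha> then (if i = k then 2 else 1) * (\<phi> \<alpha> * ref_sign T n k) else 0)"
      unfolding eq[OF \<beta>] using \<alpha>(2) q(4) by (auto simp: form_sign_def)
  qed
  also have "\<dots> = (if \<alpha> \<in> D then (if i = k then 2 else 1) * (\<phi> \<alpha> * ref_sign T n k) else 0)"
    using Dr finite_subset[OF Dr finite_roots] by (simp add: sum.delta)
  finally show ?thesis .
qed

lemma basic_form_nonzero:
  assumes D: "basic T n D" and "a < size_m" "b < size_m" and nz: "basic_form D \<phi> $$ (a, b) \<noteq> 0"
  shows "\<exists>\<alpha>\<in>D. (a, b) = root_pair T n \<alpha> \<or> (b, a) = root_pair T n \<alpha>"
proof (rule ccontr)
  assume "\<not> ?thesis"
  then have "basic_form D \<phi> $$ (a, b) = 0"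
    unfolding basic_form_index[OF assms(2,3)] by (intro sum.neutral) auto
  then show False using nz by simp
qed

lemma basic_form_normal:
  assumes D: "basic T n D"
  shows "normal_form size_m (basic_form D \<phi>)"
  unfolding normal_form_def
proof (intro allI impI)
  fix a b c assume abc: "a < size_m" "b < size_m" "c < size_m"
    and nz: "basic_form D \<phi> $$ (a, b) \<noteq> 0 \<and> basic_form D \<phi> $$ (a, c) \<noteq> 0"
  obtain \<alpha> where \<alpha>: "\<alpha> \<in> D" "(a, b) = root_pair T n \<alpha> \<or> (b, a) = root_pair T n \<alpha>"
    using basic_form_nonzero[OF D abc(1,2)] nz by blast
  obtain \<beta> where \<beta>: "\<beta> \<in> D" "(a, c) = root_pair T n \<beta> \<or> (c, a) = root_pair T n \<beta>"
    using basic_form_nonzero[OF D abc(1,3)] nz by blast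
  have "a \<in> pair_rows (root_pair T n \<alpha>)" "a \<in> pair_rows (root_pair T n \<beta>)"
    using \<alpha>(2) \<beta>(2) by (cases "root_pair T n \<alpha>"; cases "root_pair T n \<beta>"; auto simp: pair_rows_def)+
  then have "\<alpha> = \<beta>" using D \<alpha>(1) \<beta>(1) unfolding basic_iff by blast
  then show "b = c" using \<alpha>(2) \<beta>(2) by (cases "root_pair T n \<beta>") auto
qed

text \<open>The entry at the pair of a root is, up to a nonzero factor, the value of \<phi> there,
  and 0 off D. This recovers the basic pair from its form, and conversely reads a basic pair off any
  normal form.\<close>

lemma bij_basic_form:
  "bij_betw (\<lambda>(D, \<phi>). basic_form D \<phi>) (basic_pairs T n)
    {Z \<in> forms size_m (form_sign T). normal_form size_m Z}"
  unfolding bij_betw_def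
proof
  have sg: "ref_sign T n k \<noteq> (0::'a)" for k by (simp add: ref_sign_def)
  show "inj_on (\<lambda>(D, \<phi>). basic_form D \<phi>) (basic_pairs T n)"
  proof (rule inj_onI, clarify)
    fix D D' \<phi> \<phi>' assume "(D, \<phi>) \<in> basic_pairs T n" "(D', \<phi>') \<in> basic_pairs T n"
      and eq: "basic_form D \<phi> = basic_form D' \<phi>'"
    then have D: "basic T n D" "basic T n D'" and \<phi>: "\<phi> \<in> D \<rightarrow>\<^sub>E UNIV - {0}" "\<phi>' \<in> D' \<rightarrow>\<^sub>E UNIV - {0}"
      by (auto simp: basic_pairs_def)
    have e: "(if \<alpha> \<in> D then \<phi> \<alpha> else 0) = (if \<alpha> \<in> D' then \<phi>' \<alpha> else 0)" if \<alpha>: "\<alpha> \<in> roots T n" for \<alpha>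
    proof -
      obtain i k where ik: "root_pair T n \<alpha> = (i, k)" by (rule prod.exhaust)
      show ?thesis
        using basic_form_root[OF D(1) \<alpha> ik, of \<phi>] basic_form_root[OF D(2) \<alpha> ik, of \<phi>'] eq sg two
        by (cases "\<alpha> \<in> D"; cases "\<alpha> \<in> D'") (auto split: if_splits)
    qed
    have Dr: "D \<subseteq> roots T n" "D' \<subseteq> roots T n" using D by (auto simp: basic_iff)
    have "\<alpha> \<in> D \<longleftrightarrow> \<alpha> \<in> D'" for \<alpha>
      using e[of \<alpha>] Dr \<phi> PiE_mem[OF \<phi>(1), of \<alpha>] PiE_mem[OF \<phi>(2), of \<alpha>] by (auto split: if_splits)
    then have DD: "D = D'" by blast
    have "\<phi> = \<phi>'"
    proof (rule PiE_ext[OF \<phi>(1)])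
      show "\<phi>' \<in> D \<rightarrow>\<^sub>E UNIV - {0}" using \<phi>(2) DD by simp
      show "\<phi> \<alpha> = \<phi>' \<alpha>" if "\<alpha> \<in> D" for \<alpha> using e[of \<alpha>] that DD Dr by auto
    qed
    then show "D = D' \<and> \<phi> = \<phi>'" using DD by simp
  qed
  show "(\<lambda>(D, \<phi>). basic_form D \<phi>) ` basic_pairs T n = {Z \<in> forms size_m (form_sign T). normal_form size_m Z}"
  proof (intro equalityI subsetI)
    fix Z assume "Z \<in> (\<lambda>(D, \<phi>). basic_form D \<phi>) ` basic_pairs T n"
    then show "Z \<in> {Z \<in> forms size_m (form_sign T). normal_form size_m Z}"
      using basic_form_forms basic_form_normal by (auto simp: basic_pairs_def)
  next
    fix Z :: "'a mat" assume "Z \<in> {Z \<in> forms size_m (form_sign T). normal_form size_m Z}"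
    then have Z: "Z \<in> forms size_m (form_sign T)" and nf: "normal_form size_m Z" by auto
    note ZD = formsD[OF Z]
    define D where "D = {\<alpha> \<in> roots T n. Z $$ root_pair T n \<alpha> \<noteq> 0}"
    \<comment> \<open>The denominators undo the factors of \<open>basic_form_root\<close>: the
      doubled diagonal and the reference sign.\<close>
    define \<phi> where "\<phi> = restrict (\<lambda>\<alpha>. Z $$ root_pair T n \<alpha> /
      ((if fst (root_pair T n \<alpha>) = snd (root_pair T n \<alpha>) then 2 else 1) * ref_sign T n (snd (root_pair T n \<alpha>)))) D"
    have D: "basic T n D"
      unfolding basic_iff
    proof (intro conjI ballI impI)
      show "D \<subseteq> roots T n" by (auto simp: D_def)
      fix \<alpha> \<beta> assume \<alpha>: "\<alpha> \<in> D" and \<beta>: "\<beta> \<in> D" and ne: "\<alpha> \<noteq> \<beta>"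
      obtain i k where ik: "root_pair T n \<alpha> = (i, k)" by (rule prod.exhaust)
      obtain i' k' where ik': "root_pair T n \<beta> = (i', k')" by (rule prod.exhaust)
      have r: "\<alpha> \<in> roots T n" "\<beta> \<in> roots T n" using \<alpha> \<beta> by (auto simp: D_def)
      have q: "i \<le> k" "i < size_m" "k < size_m" "i' \<le> k'" "i' < size_m" "k' < size_m"
        using root_pair_row_pairs[OF r(1)] root_pair_row_pairs[OF r(2)] ik ik' by (auto simp: row_pairs_def)
      have nz: "Z $$ (i, k) \<noteq> 0" "Z $$ (i', k') \<noteq> 0" using \<alpha> \<beta> ik ik' by (auto simp: D_def)
      have nz': "Z $$ (k, i) \<noteq> 0" "Z $$ (k', i') \<noteq> 0"
        using nz ZD(2)[of i k] ZD(2)[of i' k'] q by (auto simp: form_sign_def split: if_splits)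
      have neq: "(i, k) \<noteq> (i', k')" using root_pair_inj[OF r] ne ik ik' by auto
      have u: "b = c" if "Z $$ (a, b) \<noteq> 0" "Z $$ (a, c) \<noteq> 0" "a < size_m" "b < size_m" "c < size_m" for a b c
        using nf that unfolding normal_form_def by blast
      have "i \<noteq> i'" using u[OF nz(1)] nz(2) q neq by blast
      moreover have "k \<noteq> k'" using u[OF nz'(1)] nz'(2) q neq by blast
      moreover have "i \<noteq> k'"
      proof
        assume "i = k'"
        then have "k = i'" using u[OF nz(1)] nz'(2) q by blast
        then show False using \<open>i = k'\<close> q neq by auto
      qed
      moreover have "k \<noteq> i'"
      proof
        assume "k = i'"
        then have "i = k'" using u[OF nz'(1)] nz(2) q by blast
        then show False using \<open>k = i'\<close> q neq by auto
      qed
      ultimately show "pair_rows (root_pair T n \<alpha>) \<inter> pair_rows (root_pair T n \<beta>) = {}"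
        unfolding ik ik' by (auto simp: pair_rows_def)
    qed
    have \<phi>: "\<phi> \<in> D \<rightarrow>\<^sub>E UNIV - {0}"
      using two sg by (auto simp: \<phi>_def D_def)
    have W: "basic_form D \<phi> \<in> forms size_m (form_sign T)" by (rule basic_form_forms[OF D])
    note WD = formsD[OF W]
    have upper: "basic_form D \<phi> $$ (a, b) = Z $$ (a, b)" if ab: "a \<le> b" "b < size_m" for a b
    proof (cases "(a, b) \<in> row_pairs T n")
      case True
      then obtain \<alpha> where \<alpha>: "\<alpha> \<in> roots T n" "root_pair T n \<alpha> = (a, b)"
        using root_pair_bij[of T n] unfolding bij_betw_def by (metis imageE)
      show ?thesis
        unfolding basic_form_root[OF D \<alpha>] using \<alpha> two sg[of b] by (auto simp: \<phi>_def D_def)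
    next
      case False
      then consider "size_m \<le> a + b + 1" | "a = b" "T \<noteq> Sp" using ab by (auto simp: row_pairs_def)
      then show ?thesis
      proof cases
        case 1 then show ?thesis using ZD(3)[of a b] WD(3)[of a b] ab by simp
      next
        case 2
        have "V $$ (a, a) = 0" if V: "V \<in> forms size_m (form_sign T)" for V :: "'a mat"
        proof -
          have "V $$ (a, a) = - V $$ (a, a)" using formsD(2)[OF V, of a a] 2 ab by (simp add: form_sign_def)
          then have "2 * V $$ (a, a) = 0" by (metis add.right_inverse mult_2)
          then show ?thesis using two by simp
        qed
        then show ?thesis using W Z 2 by simp
      qed
    qed
    have "basic_form D \<phi> = Z"
    proof (rule eq_matI)
      fix a b assume "a < dim_row Z" "b < dim_col Z"
      then have ab: "a < size_m" "b < size_m" using ZD(1) by auto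
      show "basic_form D \<phi> $$ (a, b) = Z $$ (a, b)"
      proof (cases "a \<le> b")
        case True then show ?thesis using upper ab by blast
      next
        case False
        then have "basic_form D \<phi> $$ (b, a) = Z $$ (b, a)" using upper ab by simp
        then show ?thesis using ZD(2)[OF ab(2,1)] WD(2)[OF ab(2,1)] by simp
      qed
    qed (use ZD(1) WD(1) in auto)
    moreover have "(D, \<phi>) \<in> basic_pairs T n" using D \<phi> by (simp add: basic_pairs_def)
    ultimately show "Z \<in> (\<lambda>(D, \<phi>). basic_form D \<phi>) ` basic_pairs T n" by force
  qed
qed

section \<open>The sum over all basic pairs\<close>

lemma avg_char_zero:
  assumes "Z \<in> forms size_m (form_sign T)"
  shows "avg_char Z (0\<^sub>m size_m size_m) = 1"
proof -
  have "pairing size_m W (0\<^sub>m size_m size_m) = 0" for W :: "'a mat" by (simp add: pairing_def)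
  then show ?thesis
    using avg_char_orbit[OF assms zero_forms] card_orbit_pos[OF assms] by (simp add: th_zero)
qed

text \<open>If xi = d S_Z, then xi(1) = d and <xi, xi> = d^2 / |orbit of Z|, so d cancels and the
  orbit size is left as the weight.\<close>

lemma supercharacter_term:
  assumes D: "basic T n D" and \<phi>: "\<And>\<alpha>. \<alpha> \<in> D \<Longrightarrow> \<phi> \<alpha> \<noteq> 0" and g: "g \<in> isometries T n"
  shows "supercharacter th T n D \<phi> (1\<^sub>m size_m) /
      cf_scalar_prod (U_group T n) (supercharacter th T n D \<phi>) (supercharacter th T n D \<phi>) *
      supercharacter th T n D \<phi> g =
    of_nat (card (orbit size_m (basic_form D \<phi>))) * avg_char (basic_form D \<phi>) (cayley_form T n g)"
proof -
  let ?Z = "basic_form D \<phi>" and ?F = "forms size_m (form_sign T :: 'a)" and ?\<xi> = "supercharacter th T n D \<phi>"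
  have Z: "?Z \<in> ?F" by (rule basic_form_forms[OF D])
  from supercharacter_eq[of D \<phi>, OF D \<phi>] obtain d :: real where "d \<noteq> 0 \<and>
      (\<forall>u\<in>isometries T n. ?\<xi> u = of_real d * avg_char ?Z (cayley_form T n u))" by (rule exE)
  then have d: "d \<noteq> 0"
    "\<And>u. u \<in> isometries T n \<Longrightarrow> ?\<xi> u = of_real d * avg_char ?Z (cayley_form T n u)" by simp_all
  have one: "?\<xi> (1\<^sub>m size_m) = of_real d"
    using d(2)[OF one_isometries] avg_char_zero[OF Z] by (simp add: cayley_form_one[OF two])
  have cards: "card (isometries T n :: 'a mat set) = card ?F"
    by (rule bij_betw_same_card[OF bij_betw_cayley_form[OF two]])
  have F0: "card ?F \<noteq> 0" using zero_forms[of size_m "form_sign T :: 'a"] finite_forms by (auto simp: card_eq_0_iff)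
  have "(\<Sum>u\<in>isometries T n. ?\<xi> u * cnj (?\<xi> u)) =
      (\<Sum>u\<in>isometries T n. (of_real d)\<^sup>2 * (avg_char ?Z (cayley_form T n u) * cnj (avg_char ?Z (cayley_form T n u))))"
    by (intro sum.cong refl) (simp add: d(2) power2_eq_square)
  also have "\<dots> = (of_real d)\<^sup>2 * (\<Sum>X\<in>?F. avg_char ?Z X * cnj (avg_char ?Z X))"
    unfolding sum_distrib_left[symmetric]
    by (intro arg_cong[of _ _ "(*) _"] sum.reindex_bij_betw bij_betw_cayley_form two)
  also have "\<dots> = (of_real d)\<^sup>2 * (of_nat (card ?F) / of_nat (card (orbit size_m ?Z)))"
    by (simp add: avg_char_norm[OF Z])
  finally have "cf_scalar_prod (U_group T n) ?\<xi> ?\<xi> = (of_real d)\<^sup>2 / of_nat (card (orbit size_m ?Z))"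
    using F0 by (simp add: cf_scalar_prod_def U_group_simps cards)
  then show ?thesis
    using d(1) card_orbit_pos[OF Z] by (simp add: one d(2)[OF g] power2_eq_square)
qed

lemma regular_char_eq_sum:
  assumes g: "g \<in> isometries T n"
  shows "regular_char (U_group T n) g =
    (\<Sum>(D, \<phi>) \<in> basic_pairs T n. supercharacter th T n D \<phi> (1\<^sub>m size_m) /
      cf_scalar_prod (U_group T n) (supercharacter th T n D \<phi>) (supercharacter th T n D \<phi>) *
      supercharacter th T n D \<phi> g)"
proof -
  let ?F = "forms size_m (form_sign T :: 'a)" and ?X = "cayley_form T n g"
  have X: "?X \<in> ?F" by (rule cayley_form_forms[OF two g])
  have "(\<Sum>(D, \<phi>) \<in> basic_pairs T n. supercharacter th T n D \<phi> (1\<^sub>m size_m) /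
      cf_scalar_prod (U_group T n) (supercharacter th T n D \<phi>) (supercharacter th T n D \<phi>) *
      supercharacter th T n D \<phi> g) =
    (\<Sum>q \<in> basic_pairs T n. (\<lambda>Z. of_nat (card (orbit size_m Z)) * avg_char Z ?X) ((\<lambda>(D, \<phi>). basic_form D \<phi>) q))"
  proof (intro sum.cong refl)
    fix q :: "eps_root set \<times> (eps_root \<Rightarrow> 'a)" assume q: "q \<in> basic_pairs T n"
    obtain D \<phi> where D: "q = (D, \<phi>)" by (rule prod.exhaust)
    have "basic T n D" "\<And>\<alpha>. \<alpha> \<in> D \<Longrightarrow> \<phi> \<alpha> \<noteq> 0"
      using q unfolding D by (auto simp: basic_pairs_def PiE_def Pi_def)
    from supercharacter_term[OF this g]
    show "(case q of (D, \<phi>) \<Rightarrow> supercharacter th T n D \<phi> (1\<^sub>m size_m) /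
        cf_scalar_prod (U_group T n) (supercharacter th T n D \<phi>) (supercharacter th T n D \<phi>) *
        supercharacter th T n D \<phi> g) =
      (\<lambda>Z. of_nat (card (orbit size_m Z)) * avg_char Z ?X) ((\<lambda>(D, \<phi>). basic_form D \<phi>) q)"
      unfolding D by simp
  qed
  also have "\<dots> = (\<Sum>Z | Z \<in> ?F \<and> normal_form size_m Z. of_nat (card (orbit size_m Z)) * avg_char Z ?X)"
    by (rule sum.reindex_bij_betw[OF bij_basic_form])
  also have "\<dots> = (if ?X = 0\<^sub>m size_m size_m then of_nat (card ?F) else 0)"
    by (rule sum_avg_char[OF X])
  also have "?X = 0\<^sub>m size_m size_m \<longleftrightarrow> g = 1\<^sub>m size_m"
    using inj_onD[OF cayley_form_inj[OF two] _ g one_isometries] cayley_form_one[OF two, of T n] by auto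
  also have "(if g = 1\<^sub>m size_m then of_nat (card ?F) else 0) = regular_char (U_group T n) g"
    using regular_char_eq[OF group_U[of T n, where 'a='a], of g] g
      bij_betw_same_card[OF bij_betw_cayley_form[OF two, of T n]]
    by (simp add: U_group_simps)
  finally show ?thesis ..
qed

end

text \<open>Adding 1 permutes the field, so comparing the sums over all elements shows that the
  order of the field is zero in it. With 2 = 0 an odd order would be 1.\<close>

lemma two_nonzero:
  assumes "odd (CARD('a::{field,finite}))"
  shows "(2::'a) \<noteq> 0"
proof
  assume two: "(2::'a) = 0"
  have "(\<Sum>x\<in>UNIV. x + 1) = (\<Sum>x\<in>UNIV. (x::'a))"
    by (rule sum.reindex_bij_witness[where i="\<lambda>x. x - 1" and j="\<lambda>x. x + 1"]) auto
  then have "of_nat (CARD('a)) = (0::'a)" by (simp add: sum.distrib)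
  moreover obtain k where "CARD('a) = 2 * k + 1" using assms by (rule oddE)
  ultimately show False using two by simp
qed

theorem theorem4p8:
  fixes \<theta> :: "'a :: {field, finite} \<Rightarrow> complex"
    and T :: classical and n p e :: nat
  assumes "prime p" and "odd p" and "e \<ge> 1" and "CARD('a) = p ^ e"
    and "n \<ge> 1"
    and "nontrivial_linear_char \<theta>"
  shows "\<forall>g \<in> (carrier (U_group T n) :: 'a mat set).
    regular_char (U_group T n) g =
      (\<Sum>(D, \<phi>) \<in> (basic_pairs T n :: (eps_root set \<times> (eps_root \<Rightarrow> 'a)) set).
         supercharacter \<theta> T n D \<phi> (\<one>\<^bsub>U_group T n\<^esub>) /
         cf_scalar_prod (U_group T n) (supercharacter \<theta> T n D \<phi>) (supercharacter \<theta> T n D \<phi>) *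
         supercharacter \<theta> T n D \<phi> g)"
proof -
  have "(2::'a) \<noteq> 0" using assms by (intro two_nonzero) simp
  then interpret unipotent_char \<theta> T n
    using assms(6) by unfold_locales (auto simp: form_sign_def)
  show ?thesis unfolding U_group_simps using regular_char_eq_sum by blast
qed

end
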